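(* The equivalence class $\mathcal{M}_\infty$ can be characterized in the following two ways: (1) $\mathcal{M}_\infty=\bigcap_{n=0}^\infty\mathcal{L}_n$; (2) $\mathcal{M}_\infty$ is precisely the collection of all MSF wavelets.
   Context: On $L^2(\mathbb{R})$ define the unitary operators $Df(x)=\sqrt{2}\,f(2x)$, $T_\alpha f(x)=f(x-\alpha)$ for $\alpha\in\mathbb{R}$, and $T=T_1$. A function $\psi\in L^2(\mathbb{R})$ is a wavelet if $\{D^nT^l\psi: n,l\in\mathbb{Z}\}$ is an orthonormal basis of $L^2(\mathbb{R})$. Its core space is $V_0=\overline{\operatorname{span}}\{D^nT^l\psi: n<0,\ l\in\mathbb{Z}\}$. For an integer $n\ge 0$ let $\mathcal{G}_n=\{T_{m/2^n}: m\in\mathbb{Z}\}$, and let $\mathcal{G}_\infty=\{T_\alpha:\alpha\in\mathbb{R}\}$. For $n\in\{0,1,2,\ldots\}\cup\{\infty\}$ let $\mathcal{L}_n$ be the collection of all wavelets whose core space is invariant under $\mathcal{G}_n$ (i.e. mapped into itself by every element of $\mathcal{G}_n$). These collections are nested decreasingly, and an equivalence relation on wavelets is defined by taking as equivalence classes $\mathcal{M}_n=\mathcal{L}_n\setminus\mathcal{L}_{n+1}$ for finite $n\ge 0$ and $\mathcal{M}_\infty=\mathcal{L}_\infty$. The Fourier transform is the unitary one, $\hat f(\xi)=\frac{1}{\sqrt{2\pi}}\int f(x)e^{-ix\xi}\,dx$. A wavelet set is a set $W\subset\mathbb{R}$ such that the function $\psi$ defined by $\hat\psi=\frac{1}{\sqrt{2\pi}}\chi_W$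 is a wavelet; such a wavelet $\psi$ is called a Minimally Supported Frequency (MSF) wavelet.
   Formalization: In (2), an MSF wavelet is a wavelet with |ψ̂| = χ_W/√(2π) a.e. for some wavelet set W, instead of ψ̂ = χ_W/√(2π); without the modulus (2) is false, since −ψ has the same core space as ψ but transform −χ_W/√(2π). *)

theory Defs
  imports "HOL-Analysis.Analysis" "HOL-Library.Function_Algebras" "HOL-Library.Extended_Nat"
begin

text \<open>Elements of \<open>L\<^sup>2(\<real>)\<close> are represented by square-integrable functions. All notions below
  are invariant under changing a function on a null set, so no quotient is formed.\<close>

definition L2 :: "(real \<Rightarrow> complex) set" where
  "L2 = {f \<in> borel_measurable lebesgue. integrable lebesgue (\<lambda>x. (cmod (f x))\<^sup>2)}"

definition l2_inner :: "(real \<Rightarrow> complex) \<Rightarrow> (real \<Rightarrow> complex) \<Rightarrow> complex" where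
  "l2_inner f g = (LINT x|lebesgue. f x * cnj (g x))"

definition l2_norm :: "(real \<Rightarrow> complex) \<Rightarrow> real" where
  "l2_norm f = sqrt (LINT x|lebesgue. (cmod (f x))\<^sup>2)"

text \<open>Membership in \<^const>\<open>L2\<close> is required explicitly, because the Bochner integral of a
  non-integrable function is 0.\<close>

definition l2_tendsto :: "(nat \<Rightarrow> real \<Rightarrow> complex) \<Rightarrow> (real \<Rightarrow> complex) \<Rightarrow> bool" where
  "l2_tendsto u f \<longleftrightarrow>
     (\<forall>n. u n \<in> L2) \<and> f \<in> L2 \<and> (\<lambda>n. l2_norm (u n - f)) \<longlonglongrightarrow> 0"

interpretation cfun: vector_space "\<lambda>(c::complex) (f::real \<Rightarrow> complex) x. c * f x"
  by unfold_locales (auto simp: fun_eq_iff algebra_simps)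

definition l2_closed_span :: "(real \<Rightarrow> complex) set \<Rightarrow> (real \<Rightarrow> complex) set" where
  "l2_closed_span S = {f. \<exists>u. (\<forall>n. u n \<in> cfun.span S) \<and> l2_tendsto u f}"

definition orthonormal_basis :: "('i \<Rightarrow> real \<Rightarrow> complex) \<Rightarrow> bool" where
  "orthonormal_basis e \<longleftrightarrow>
     (\<forall>i. e i \<in> L2) \<and>
     (\<forall>i j. l2_inner (e i) (e j) = (if i = j then 1 else 0)) \<and>
     l2_closed_span (range e) = L2"

definition dilation :: "(real \<Rightarrow> complex) \<Rightarrow> real \<Rightarrow> complex" where
  "dilation f = (\<lambda>x. complex_of_real (sqrt 2) * f (2 * x))"

definition translation :: "real \<Rightarrow> (real \<Rightarrow> complex) \<Rightarrow> real \<Rightarrow> complex" where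
  "translation \<alpha> f = (\<lambda>x. f (x - \<alpha>))"

definition int_pow :: "('a \<Rightarrow> 'a) \<Rightarrow> int \<Rightarrow> 'a \<Rightarrow> 'a" where
  "int_pow U n = (if 0 \<le> n then U ^^ nat n else inv U ^^ nat (- n))"

text \<open>\<^const>\<open>dilation\<close> and \<^term>\<open>translation 1\<close> are bijections of the space of all functions,
  so the use of \<^const>\<open>inv\<close> in their negative powers is genuine.\<close>

lemma inv_dilation: "inv dilation = (\<lambda>f x. f (x / 2) / complex_of_real (sqrt 2))"
  by (rule inv_equality) (auto simp: dilation_def fun_eq_iff simp flip: of_real_mult)

lemma bij_dilation: "bij dilation"
  by (rule o_bij[where g = "\<lambda>f x. f (x / 2) / complex_of_real (sqrt 2)"])
     (auto simp: dilation_def fun_eq_iff)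

lemma inv_translation: "inv (translation \<alpha>) = translation (- \<alpha>)"
  by (rule inv_equality) (auto simp: translation_def fun_eq_iff)

lemma bij_translation: "bij (translation \<alpha>)"
  by (rule o_bij[where g = "translation (- \<alpha>)"]) (auto simp: translation_def fun_eq_iff)

definition wavelet_system :: "(real \<Rightarrow> complex) \<Rightarrow> int \<times> int \<Rightarrow> real \<Rightarrow> complex" where
  "wavelet_system \<psi> = (\<lambda>(n, l). int_pow dilation n (int_pow (translation 1) l \<psi>))"

definition wavelet :: "(real \<Rightarrow> complex) \<Rightarrow> bool" where
  "wavelet \<psi> \<longleftrightarrow> \<psi> \<in> L2 \<and> orthonormal_basis (wavelet_system \<psi>)"

definition core_space :: "(real \<Rightarrow> complex) \<Rightarrow> (real \<Rightarrow> complex) set" where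
  "core_space \<psi> = l2_closed_span {wavelet_system \<psi> (n, l) | n l. n < 0}"

definition translation_group :: "enat \<Rightarrow> ((real \<Rightarrow> complex) \<Rightarrow> real \<Rightarrow> complex) set" where
  "translation_group n =
     (case n of enat k \<Rightarrow> {translation (real_of_int m / 2 ^ k) | m. True} | \<infinity> \<Rightarrow> range translation)"

definition wavelet_L :: "enat \<Rightarrow> (real \<Rightarrow> complex) set" where
  "wavelet_L n =
     {\<psi>. wavelet \<psi> \<and> (\<forall>U \<in> translation_group n. U ` core_space \<psi> \<subseteq> core_space \<psi>)}"

definition wavelet_M :: "enat \<Rightarrow> (real \<Rightarrow> complex) set" where
  "wavelet_M n =
     (case n of enat k \<Rightarrow> wavelet_L (enat k) - wavelet_L (enat (Suc k)) | \<infinity> \<Rightarrow> wavelet_L \<infinity>)"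

text \<open>The unitary Fourier transform on \<open>L\<^sup>2(\<real>)\<close> (Plancherel): the integral over the whole line
  need not exist, so the transform is the \<open>L\<^sup>2\<close>-limit of the integrals over \<open>[-N, N]\<close>. It is
  rendered as a relation, as it is determined only up to a null set.\<close>

definition fourier_transform :: "(real \<Rightarrow> complex) \<Rightarrow> (real \<Rightarrow> complex) \<Rightarrow> bool" where
  "fourier_transform f g \<longleftrightarrow>
     f \<in> L2 \<and>
     l2_tendsto
       (\<lambda>N \<xi>. complex_of_real (1 / sqrt (2 * pi)) *
          (LINT x:{- real N..real N}|lebesgue. f x * exp (- (\<i> * complex_of_real (x * \<xi>))))) g"

definition wavelet_set :: "real set \<Rightarrow> bool" where
  "wavelet_set W \<longleftrightarrow>
     (\<exists>\<psi>. wavelet \<psi> \<and>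
        fourier_transform \<psi> (\<lambda>\<xi>. complex_of_real (1 / sqrt (2 * pi) * indicator W \<xi>)))"

text \<open>The transform of an MSF wavelet is \<open>\<chi>\<^sub>W / sqrt (2 pi)\<close> up to a measurable unimodular factor,
  hence the modulus. Without it the class would not even be closed under \<open>\<psi> \<mapsto> - \<psi>\<close>, although
  \<open>\<psi>\<close> and \<open>- \<psi>\<close> have the same core space.\<close>

definition msf_wavelet :: "(real \<Rightarrow> complex) \<Rightarrow> bool" where
  "msf_wavelet \<psi> \<longleftrightarrow>
     wavelet \<psi> \<and>
     (\<exists>W g. wavelet_set W \<and> fourier_transform \<psi> g \<and>
        (AE \<xi> in lebesgue. cmod (g \<xi>) = 1 / sqrt (2 * pi) * indicator W \<xi>))"

end

theory Submission
  imports Defs "HOL-Probability.Probability"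
begin

text \<open>Write \<open>g\<close> for the Fourier transform of a wavelet \<open>\<psi>\<close>. All three classes turn out to consist of
  the wavelets for which the dilates \<open>g (2\<^sup>j \<xi>)\<close>, \<open>j \<in> \<int>\<close>, have essentially disjoint supports.

  The core space is orthogonal to \<open>\<psi>\<close>, so its invariance under all dyadic translations makes the
  continuous function \<open>\<alpha> \<mapsto> \<langle>T\<^sub>\<alpha> D\<^sup>-\<^sup>j \<psi>, \<psi>\<rangle>\<close> vanish at all dyadic \<open>\<alpha>\<close>, hence everywhere. It is the Fourier
  integral of \<open>2\<^sup>j\<^sup>/\<^sup>2 g (2\<^sup>j \<xi>) cnj (g \<xi>)\<close>, which is therefore zero almost everywhere. For an MSF wavelet
  the same product has a nonnegative companion \<open>\<chi>\<^sub>W (2\<^sup>j \<xi>) \<chi>\<^sub>W \<xi>\<close> whose integral is an inner product of two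
  distinct basis elements. Conversely, disjointness makes every translate of \<open>D\<^sup>n T\<^sup>l \<psi>\<close> orthogonal to every
  \<open>D\<^sup>m T\<^sup>k \<psi>\<close> with \<open>m \<noteq> n\<close>, which gives invariance under all translations.

  Finally, disjointness forces \<open>2 \<pi> \<bar>g\<bar>\<^sup>2 = 1\<close> on the support \<open>W\<close> of \<open>g\<close>: average Parseval's identity for the
  translates of a function with transform \<open>\<chi>\<^sub>A\<close>, \<open>A \<subseteq> W\<close>. The phases of all dilates of \<open>g\<close> can be removed by a
  single unimodular multiplier, so \<open>W\<close> is a wavelet set.\<close>

text \<open>A translation by \<open>\<alpha>\<close> sends \<open>D^n T^l \<psi>\<close> to the
  function of the same scale with shift \<open>l + 2^n \<alpha>\<close>, in general not an integer,
  so it does not permute the system. It does keep the scale. On the Fourier side shifts are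
  modulations, so disjoint supports give orthogonality of different scales for all real shifts, and
  completeness of the system turns orthogonality to the scales \<open>n \<ge> 0\<close> into
  membership in the core space.

  The constant \<open>2 \<pi>\<close> pairs the unit step of the integer translations with the
  normalisation \<open>1 / sqrt (2 \<pi>)\<close>: the coefficients of a function with transform
  \<open>\<chi>_A\<close> are samples, at spacing 1, of \<open>sqrt (2 \<pi>)\<close> times the
  Fourier integral of \<open>\<chi>_A cnj g\<close>.

  A modulus \<open>\<chi>_W / sqrt (2 \<pi>)\<close> is not enough for \<open>wavelet_set W\<close>,
  which asks for a wavelet with exactly this transform. A unimodular multiplier commutes with
  translations always, and with dilations if it agrees at \<open>\<xi>\<close> and
  \<open>2 \<xi>\<close>. Almost every orbit \<open>2^n \<xi>\<close> meets the support at most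
  once, so the conjugate phase of \<open>g\<close> at that point can be assigned to the whole
  orbit.\<close>

section \<open>Square-integrable functions and their inner product\<close>

lemma L2_measurable: "f \<in> L2 \<Longrightarrow> f \<in> borel_measurable lebesgue"
  by (simp add: L2_def)

lemma L2_integrable: "f \<in> L2 \<Longrightarrow> integrable lebesgue (\<lambda>x. (cmod (f x))\<^sup>2)"
  by (simp add: L2_def)

lemma L2_bound:
  assumes "f \<in> borel_measurable lebesgue" "integrable lebesgue g" "AE x in lebesgue. (cmod (f x))\<^sup>2 \<le> g x"
  shows "f \<in> L2"
proof -
  have [measurable]: "f \<in> borel_measurable lebesgue" by fact
  have "integrable lebesgue (\<lambda>x. (cmod (f x))\<^sup>2)"
    by (rule Bochner_Integration.integrable_bound[OF assms(2)])
       (use assms(3) in \<open>auto elim!: eventually_mono\<close>)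
  then show ?thesis by (simp add: L2_def assms(1))
qed

lemma cmod_add_sq_le: "(cmod (a + b))\<^sup>2 \<le> 2 * (cmod a)\<^sup>2 + 2 * (cmod b)\<^sup>2"
proof -
  have "(cmod (a + b))\<^sup>2 \<le> (cmod a + cmod b)\<^sup>2"
    by (simp add: norm_triangle_ineq power_mono)
  also have "\<dots> \<le> 2 * (cmod a)\<^sup>2 + 2 * (cmod b)\<^sup>2"
    using sum_squares_bound[of "cmod a" "cmod b"] by (simp add: power2_eq_square algebra_simps)
  finally show ?thesis .
qed

lemma L2_zero [simp, intro]: "(\<lambda>x. 0) \<in> L2"
  by (simp add: L2_def)

lemma L2_add [intro]:
  assumes "f \<in> L2" "g \<in> L2" shows "(\<lambda>x. f x + g x) \<in> L2"
proof (rule L2_bound)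
  show "(\<lambda>x. f x + g x) \<in> borel_measurable lebesgue"
    using assms by (auto dest!: L2_measurable)
  show "integrable lebesgue (\<lambda>x. 2 * (cmod (f x))\<^sup>2 + 2 * (cmod (g x))\<^sup>2)"
    using assms by (auto dest!: L2_integrable)
qed (simp add: cmod_add_sq_le)

lemma L2_mult_bounded:
  assumes "f \<in> L2" "m \<in> borel_measurable lebesgue" "\<And>x. cmod (m x) \<le> B"
  shows "(\<lambda>x. m x * f x) \<in> L2"
proof (rule L2_bound)
  show "(\<lambda>x. m x * f x) \<in> borel_measurable lebesgue"
    using assms by (auto dest!: L2_measurable)
  show "integrable lebesgue (\<lambda>x. B\<^sup>2 * (cmod (f x))\<^sup>2)"
    using assms by (auto dest!: L2_integrable)
  show "AE x in lebesgue. (cmod (m x * f x))\<^sup>2 \<le> B\<^sup>2 * (cmod (f x))\<^sup>2"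
    by (intro AE_I2) (auto simp: norm_mult power_mult_distrib intro!: mult_right_mono power_mono assms)
qed

lemma L2_cmult [intro]: "f \<in> L2 \<Longrightarrow> (\<lambda>x. c * f x) \<in> L2"
  by (rule L2_mult_bounded[where B = "cmod c"]) auto

lemma L2_diff [intro]:
  assumes "f \<in> L2" "g \<in> L2" shows "(\<lambda>x. f x - g x) \<in> L2"
  using L2_add[OF assms(1) L2_cmult[OF assms(2), of "-1"]] by simp

lemma L2_cnj [intro]: "f \<in> L2 \<Longrightarrow> (\<lambda>x. cnj (f x)) \<in> L2"
  by (simp add: L2_def borel_measurable_complex_iff)

lemma L2_sum [intro]: "(\<And>i. i \<in> F \<Longrightarrow> f i \<in> L2) \<Longrightarrow> (\<lambda>x. \<Sum>i\<in>F. f i x) \<in> L2"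
  by (induction F rule: infinite_finite_induct) auto

lemma lebesgue_measurable_cong_AE:
  fixes f g :: "real \<Rightarrow> complex"
  assumes "f \<in> borel_measurable lebesgue" "AE x in lebesgue. f x = g x"
  shows "g \<in> borel_measurable lebesgue"
  using borel_measurable_AE[of f g] assms by simp

lemma L2_cong_AE:
  assumes "f \<in> L2" "AE x in lebesgue. f x = g x" shows "g \<in> L2"
proof (rule L2_bound[OF _ L2_integrable[OF assms(1)]])
  show "g \<in> borel_measurable lebesgue"
    using assms L2_measurable lebesgue_measurable_cong_AE by blast
qed (use assms(2) in \<open>auto elim!: eventually_mono\<close>)

text \<open>\<open>L2\<close> is built on the completed measure, whereas Fubini and the uniqueness
  theorem for characteristic functions are applied to Borel functions. This representative moves
  between the two.\<close>

lemma ex_borel_complex: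
  fixes f :: "real \<Rightarrow> complex"
  assumes "f \<in> borel_measurable lebesgue"
  obtains f' where "f' \<in> borel_measurable borel" "AE x in lebesgue. f x = f' x"
proof -
  obtain r where r: "r \<in> borel_measurable lborel" "AE x in lborel. Re (f x) = r x"
    using completion_ex_borel_measurable_real[of "\<lambda>x. Re (f x)" lborel] assms
    by (auto simp: borel_measurable_complex_iff)
  obtain i where i: "i \<in> borel_measurable lborel" "AE x in lborel. Im (f x) = i x"
    using completion_ex_borel_measurable_real[of "\<lambda>x. Im (f x)" lborel] assms
    by (auto simp: borel_measurable_complex_iff)
  have "AE x in lebesgue. f x = Complex (r x) (i x)"
    using r(2)[THEN AE_completion] i(2)[THEN AE_completion] by eventually_elim (auto simp: complex_eq_iff)
  moreover have "(\<lambda>x. Complex (r x) (i x)) \<in> borel_measurable borel"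
    using r(1) i(1) by (simp add: borel_measurable_complex_iff)
  ultimately show ?thesis using that by blast
qed

lemma L2_prod_integrable [intro]:
  assumes "f \<in> L2" "g \<in> L2" shows "integrable lebesgue (\<lambda>x. f x * g x)"
proof (rule Bochner_Integration.integrable_bound)
  show "integrable lebesgue (\<lambda>x. (cmod (f x))\<^sup>2 + (cmod (g x))\<^sup>2)"
    using assms by (auto dest!: L2_integrable)
  show "(\<lambda>x. f x * g x) \<in> borel_measurable lebesgue"
    using assms by (auto dest!: L2_measurable)
  show "AE x in lebesgue. cmod (f x * g x) \<le> norm ((cmod (f x))\<^sup>2 + (cmod (g x))\<^sup>2)"
  proof (intro AE_I2)
    fix x
    show "cmod (f x * g x) \<le> norm ((cmod (f x))\<^sup>2 + (cmod (g x))\<^sup>2)"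
      using sum_squares_bound[of "cmod (f x)" "cmod (g x)"]
        mult_nonneg_nonneg[OF norm_ge_zero norm_ge_zero, of "f x" "g x"]
      unfolding norm_mult real_norm_def by linarith
  qed
qed

lemma L2_inner_integrable:
  "f \<in> L2 \<Longrightarrow> g \<in> L2 \<Longrightarrow> integrable lebesgue (\<lambda>x. f x * cnj (g x))"
  by (intro L2_prod_integrable L2_cnj)

lemma l2_inner_add_left:
  "f \<in> L2 \<Longrightarrow> g \<in> L2 \<Longrightarrow> h \<in> L2 \<Longrightarrow> l2_inner (\<lambda>x. f x + g x) h = l2_inner f h + l2_inner g h"
  by (simp add: l2_inner_def distrib_right L2_inner_integrable)

lemma l2_inner_diff_left:
  "f \<in> L2 \<Longrightarrow> g \<in> L2 \<Longrightarrow> h \<in> L2 \<Longrightarrow> l2_inner (\<lambda>x. f x - g x) h = l2_inner f h - l2_inner g h"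
  by (simp add: l2_inner_def left_diff_distrib L2_inner_integrable)

lemma l2_inner_cmult_left: "l2_inner (\<lambda>x. c * f x) h = c * l2_inner f h"
  by (simp add: l2_inner_def mult.assoc)

lemma l2_inner_commute: "l2_inner g f = cnj (l2_inner f g)"
proof -
  have eq: "(\<lambda>x. g x * cnj (f x)) = (\<lambda>x. cnj (f x * cnj (g x)))"
    by (simp add: mult.commute)
  show ?thesis unfolding l2_inner_def eq by (rule Bochner_Integration.integral_cnj)
qed

lemma l2_inner_diff_right:
  "f \<in> L2 \<Longrightarrow> g \<in> L2 \<Longrightarrow> h \<in> L2 \<Longrightarrow> l2_inner h (\<lambda>x. f x - g x) = l2_inner h f - l2_inner h g"
  using l2_inner_diff_left[of f g h] by (metis complex_cnj_diff l2_inner_commute)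

lemma l2_inner_cmult_right: "l2_inner h (\<lambda>x. c * f x) = cnj c * l2_inner h f"
  using l2_inner_cmult_left[of c f h] by (metis complex_cnj_mult l2_inner_commute)

lemma l2_inner_sum_left:
  assumes "\<And>i. i \<in> F \<Longrightarrow> f i \<in> L2" "h \<in> L2"
  shows "l2_inner (\<lambda>x. \<Sum>i\<in>F. c i * f i x) h = (\<Sum>i\<in>F. c i * l2_inner (f i) h)"
  using assms
proof (induction F rule: infinite_finite_induct)
  case (insert i F)
  then show ?case
    by (simp add: l2_inner_add_left l2_inner_cmult_left L2_sum L2_cmult)
qed (simp_all add: l2_inner_def)

lemma l2_inner_cong_AE:
  assumes "f \<in> L2" "g \<in> L2" "AE x in lebesgue. f x = f' x" "AE x in lebesgue. g x = g' x"
  shows "l2_inner f g = l2_inner f' g'"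
  unfolding l2_inner_def
proof (rule integral_cong_AE)
  have "f' \<in> L2" "g' \<in> L2" using L2_cong_AE assms by blast+
  then show "(\<lambda>x. f x * cnj (g x)) \<in> borel_measurable lebesgue"
     "(\<lambda>x. f' x * cnj (g' x)) \<in> borel_measurable lebesgue"
    using assms(1,2) by (auto intro!: borel_measurable_integrable L2_inner_integrable)
  show "AE x in lebesgue. f x * cnj (g x) = f' x * cnj (g' x)"
    using assms(3,4) by eventually_elim auto
qed

lemma l2_norm_nonneg [simp]: "0 \<le> l2_norm f"
  by (simp add: l2_norm_def)

lemma l2_norm_sq: "(l2_norm f)\<^sup>2 = (LINT x|lebesgue. (cmod (f x))\<^sup>2)"
  by (simp add: l2_norm_def)

lemma l2_inner_self: "l2_inner f f = complex_of_real ((l2_norm f)\<^sup>2)"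
  unfolding l2_norm_sq l2_inner_def
  unfolding integral_complex_of_real[symmetric] complex_norm_square ..

lemma l2_norm_cong: "(\<And>x. cmod (f x) = cmod (g x)) \<Longrightarrow> l2_norm f = l2_norm g"
  by (simp add: l2_norm_def)

lemma l2_norm_cong_AE:
  assumes "f \<in> L2" "AE x in lebesgue. f x = g x" shows "l2_norm f = l2_norm g"
  using l2_inner_cong_AE[OF assms(1,1,2,2)] 
  by (simp add: l2_inner_self del: of_real_power)

lemma l2_norm_cmult: "l2_norm (\<lambda>x. c * f x) = cmod c * l2_norm f"
  by (simp add: l2_norm_def norm_mult power_mult_distrib real_sqrt_mult)

lemma l2_norm_diff_sq:
  assumes "f \<in> L2" "g \<in> L2"
  shows "(l2_norm (\<lambda>x. f x - g x))\<^sup>2 = (l2_norm f)\<^sup>2 - 2 * Re (l2_inner f g) + (l2_norm g)\<^sup>2"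
proof -
  have "l2_inner (\<lambda>x. f x - g x) (\<lambda>x. f x - g x) = l2_inner f f - l2_inner f g - (l2_inner g f - l2_inner g g)"
    using assms by (simp add: l2_inner_diff_left l2_inner_diff_right L2_diff)
  then have "Re (l2_inner (\<lambda>x. f x - g x) (\<lambda>x. f x - g x)) = Re (l2_inner f f) - Re (l2_inner f g) - (Re (l2_inner g f) - Re (l2_inner g g))"
    by simp
  then show ?thesis
    unfolding l2_inner_commute[of g f] by (simp add: l2_inner_self)
qed

lemma l2_norm_add_sq:
  assumes "f \<in> L2" "g \<in> L2"
  shows "(l2_norm (\<lambda>x. f x + g x))\<^sup>2 = (l2_norm f)\<^sup>2 + 2 * Re (l2_inner f g) + (l2_norm g)\<^sup>2"
  using l2_norm_diff_sq[OF assms(1) L2_cmult[OF assms(2), of "-1"]]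
  by (simp add: l2_inner_cmult_right[of _ "-1", simplified] l2_norm_cong[of "\<lambda>x. - g x" g])

lemma l2_norm_minus_commute: "l2_norm (\<lambda>x. f x - g x) = l2_norm (\<lambda>x. g x - f x)"
  by (rule l2_norm_cong) (rule norm_minus_commute)

lemma l2_norm_cnj: "l2_norm (\<lambda>x. cnj (f x)) = l2_norm f"
  by (rule l2_norm_cong) simp

lemma l2_norm_zero_AE:
  assumes "f \<in> L2" "l2_norm f = 0" shows "AE x in lebesgue. f x = 0"
proof -
  have "(LINT x|lebesgue. (cmod (f x))\<^sup>2) = 0" using assms(2) by (simp add: l2_norm_def)
  then have "AE x in lebesgue. (cmod (f x))\<^sup>2 = 0"
    using L2_integrable[OF assms(1)] by (simp add: integral_nonneg_eq_0_iff_AE)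
  then show ?thesis by simp
qed

lemma l2_Cauchy_Schwarz:
  assumes "f \<in> L2" "g \<in> L2"
  shows "cmod (l2_inner f g) \<le> l2_norm f * l2_norm g"
proof (cases "l2_norm g = 0")
  case True
  then have "AE x in lebesgue. f x * cnj (g x) = 0"
    using l2_norm_zero_AE[OF assms(2)] by auto
  then have "l2_inner f g = 0"
    unfolding l2_inner_def by (metis integral_eq_zero_AE)
  then show ?thesis by simp
next
  case False
  define N where "N = (l2_norm g)\<^sup>2"
  \<comment> \<open>\<open>c\<close> is the coefficient of the orthogonal projection of
    \<open>f\<close> onto \<open>g\<close>, which minimises the norm of \<open>f - c g\<close>;
    nonnegativity at the minimum is the inequality.\<close>
  define c where "c = l2_inner f g / N"
  have N: "N > 0" using False by (simp add: N_def)
  have "0 \<le> (l2_norm (\<lambda>x. f x - c * g x))\<^sup>2" by simp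
  also have "\<dots> = (l2_norm f)\<^sup>2 - 2 * Re (cnj c * l2_inner f g) + (cmod c)\<^sup>2 * N"
    by (subst l2_norm_diff_sq) (use assms in \<open>auto simp: l2_inner_cmult_right l2_norm_cmult power_mult_distrib N_def\<close>)
  also have "cnj c * l2_inner f g = complex_of_real ((cmod (l2_inner f g))\<^sup>2 / N)"
    unfolding of_real_divide complex_norm_square by (simp add: c_def mult.commute)
  also have "(cmod c)\<^sup>2 * N = (cmod (l2_inner f g))\<^sup>2 / N"
    using N by (simp add: c_def norm_divide power_divide power2_eq_square)
  finally have "(cmod (l2_inner f g))\<^sup>2 / N \<le> (l2_norm f)\<^sup>2" by simp
  then have "(cmod (l2_inner f g))\<^sup>2 \<le> (l2_norm f * l2_norm g)\<^sup>2"
    using N by (simp add: field_simps N_def power_mult_distrib)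
  then show ?thesis by (rule power2_le_imp_le) simp
qed

lemma l2_norm_triangle:
  assumes "f \<in> L2" "g \<in> L2"
  shows "l2_norm (\<lambda>x. f x + g x) \<le> l2_norm f + l2_norm g"
proof -
  have "(l2_norm (\<lambda>x. f x + g x))\<^sup>2 \<le> (l2_norm f + l2_norm g)\<^sup>2"
    using l2_norm_add_sq[OF assms] l2_Cauchy_Schwarz[OF assms] complex_Re_le_cmod[of "l2_inner f g"]
    by (simp add: power2_sum)
  then show ?thesis by (rule power2_le_imp_le) simp
qed

lemma l2_norm_triangle_diff:
  assumes "f \<in> L2" "g \<in> L2" "h \<in> L2"
  shows "l2_norm (\<lambda>x. f x - h x) \<le> l2_norm (\<lambda>x. f x - g x) + l2_norm (\<lambda>x. g x - h x)"
  using l2_norm_triangle[of "\<lambda>x. f x - g x" "\<lambda>x. g x - h x"] assms by (simp add: L2_diff)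

lemma l2_tendsto_iff:
  "l2_tendsto u f \<longleftrightarrow> (\<forall>n. u n \<in> L2) \<and> f \<in> L2 \<and> (\<lambda>n. l2_norm (\<lambda>x. u n x - f x)) \<longlonglongrightarrow> 0"
  by (simp add: l2_tendsto_def fun_diff_def)

lemma l2_tendsto_inner:
  assumes "l2_tendsto u f" "l2_tendsto v g"
  shows "(\<lambda>n. l2_inner (u n) (v n)) \<longlonglongrightarrow> l2_inner f g"
proof -
  have L: "\<And>n. u n \<in> L2" "\<And>n. v n \<in> L2" "f \<in> L2" "g \<in> L2"
    and u: "(\<lambda>n. l2_norm (\<lambda>x. u n x - f x)) \<longlonglongrightarrow> 0" and v: "(\<lambda>n. l2_norm (\<lambda>x. v n x - g x)) \<longlonglongrightarrow> 0"
    using assms by (auto simp: l2_tendsto_iff)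
  define b where "b n = l2_norm (\<lambda>x. u n x - f x) * (l2_norm (\<lambda>x. v n x - g x) + l2_norm g)
      + l2_norm f * l2_norm (\<lambda>x. v n x - g x)" for n
  have "b \<longlonglongrightarrow> 0 * (0 + l2_norm g) + l2_norm f * 0"
    unfolding b_def[abs_def] by (intro tendsto_intros u v)
  then have b: "b \<longlonglongrightarrow> 0" by simp
  have le: "norm (l2_inner (u n) (v n) - l2_inner f g) \<le> b n" for n
  proof -
    have "l2_inner (u n) (v n) - l2_inner f g = l2_inner (\<lambda>x. u n x - f x) (v n) + l2_inner f (\<lambda>x. v n x - g x)"
      using L by (simp add: l2_inner_diff_left l2_inner_diff_right)
    also have "norm \<dots> \<le> l2_norm (\<lambda>x. u n x - f x) * l2_norm (v n) + l2_norm f * l2_norm (\<lambda>x. v n x - g x)"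
      using L by (intro order_trans[OF norm_triangle_ineq] add_mono l2_Cauchy_Schwarz) auto
    also have "\<dots> \<le> b n"
      unfolding b_def using l2_norm_triangle[of "\<lambda>x. v n x - g x" g] L
      by (intro add_mono mult_left_mono) (auto simp: L2_diff)
    finally show ?thesis .
  qed
  have "(\<lambda>n. l2_inner (u n) (v n) - l2_inner f g) \<longlonglongrightarrow> 0"
    by (rule Lim_null_comparison[OF always_eventually b]) (use le in blast)
  then show ?thesis using LIM_zero_iff by blast
qed

lemma l2_tendsto_const: "f \<in> L2 \<Longrightarrow> l2_tendsto (\<lambda>n. f) f"
  by (simp add: l2_tendsto_iff l2_norm_def)

lemma l2_tendsto_norm:
  assumes "l2_tendsto u f" shows "(\<lambda>n. l2_norm (u n)) \<longlonglongrightarrow> l2_norm f"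
proof -
  have "(\<lambda>n. sqrt (Re (l2_inner (u n) (u n)))) \<longlonglongrightarrow> sqrt (Re (l2_inner f f))"
    by (intro tendsto_intros l2_tendsto_inner assms)
  then show ?thesis by (simp add: l2_inner_self)
qed

section \<open>Orthonormal systems and their closed spans\<close>

text \<open>Completing the square isolates what does not depend on \<open>c\<close>. The last sum
  vanishes for the Fourier coefficients, so these approximate best; Bessel and the description of
  closed spans both follow.\<close>

lemma l2_norm_residual_sq:
  assumes eL: "\<And>i. e i \<in> L2" and on: "\<And>i j. l2_inner (e i) (e j) = (if i = j then 1 else 0)"
    and f: "f \<in> L2" and F: "finite F"
  shows "(l2_norm (\<lambda>x. f x - (\<Sum>i\<in>F. c i * e i x)))\<^sup>2
    = (l2_norm f)\<^sup>2 - (\<Sum>i\<in>F. (cmod (l2_inner f (e i)))\<^sup>2) + (\<Sum>i\<in>F. (cmod (l2_inner f (e i) - c i))\<^sup>2)"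
proof -
  define s where "s = (\<lambda>x. \<Sum>i\<in>F. c i * e i x)"
  have s: "s \<in> L2" unfolding s_def by (intro L2_sum L2_cmult eL)
  have inner_s: "l2_inner s h = (\<Sum>i\<in>F. c i * l2_inner (e i) h)" if "h \<in> L2" for h
    unfolding s_def using that by (intro l2_inner_sum_left eL)
  have "l2_inner s (e i) = c i" if "i \<in> F" for i
    using that F by (subst inner_s) (auto simp: eL on if_distrib cong: if_cong)
  then have "l2_inner s s = (\<Sum>i\<in>F. c i * cnj (c i))"
    by (subst inner_s[OF s], intro sum.cong refl) (subst l2_inner_commute, simp)
  also have "\<dots> = complex_of_real (\<Sum>i\<in>F. (cmod (c i))\<^sup>2)"
    by (simp add: complex_norm_square del: of_real_power)
  finally have ss: "(l2_norm s)\<^sup>2 = (\<Sum>i\<in>F. (cmod (c i))\<^sup>2)"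
    by (simp add: l2_inner_self del: of_real_power of_real_sum)
  have "Re (l2_inner f s) = Re (l2_inner s f)" by (subst l2_inner_commute) simp
  also have "\<dots> = (\<Sum>i\<in>F. Re (c i * cnj (l2_inner f (e i))))"
    unfolding inner_s[OF f] Re_sum by (intro sum.cong refl) (subst l2_inner_commute, simp)
  finally have fs: "Re (l2_inner f s) = (\<Sum>i\<in>F. Re (c i * cnj (l2_inner f (e i))))" .
  have "(cmod a)\<^sup>2 = (cmod (a - b))\<^sup>2 + 2 * Re (b * cnj a) - (cmod b)\<^sup>2" for a b
    unfolding cmod_power2 by (simp add: power2_eq_square algebra_simps)
  then have "(\<Sum>i\<in>F. (cmod (l2_inner f (e i)))\<^sup>2) = (\<Sum>i\<in>F. (cmod (l2_inner f (e i) - c i))\<^sup>2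
     + 2 * Re (c i * cnj (l2_inner f (e i))) - (cmod (c i))\<^sup>2)"
    by (intro sum.cong refl)
  also have "\<dots> = (\<Sum>i\<in>F. (cmod (l2_inner f (e i) - c i))\<^sup>2)
     + 2 * (\<Sum>i\<in>F. Re (c i * cnj (l2_inner f (e i)))) - (\<Sum>i\<in>F. (cmod (c i))\<^sup>2)"
    unfolding sum.distrib sum_subtractf sum_distrib_left ..
  finally have "(\<Sum>i\<in>F. (cmod (l2_inner f (e i)))\<^sup>2) = (\<Sum>i\<in>F. (cmod (l2_inner f (e i) - c i))\<^sup>2)
     + 2 * (\<Sum>i\<in>F. Re (c i * cnj (l2_inner f (e i)))) - (\<Sum>i\<in>F. (cmod (c i))\<^sup>2)" .
  then show ?thesis
    using l2_norm_diff_sq[OF f s] unfolding fs ss unfolding s_def by linarith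
qed

lemma l2_Bessel:
  assumes eL: "\<And>i. e i \<in> L2" and on: "\<And>i j. l2_inner (e i) (e j) = (if i = j then 1 else 0)"
    and f: "f \<in> L2" and F: "finite F"
  shows "(\<Sum>i\<in>F. (cmod (l2_inner f (e i)))\<^sup>2) \<le> (l2_norm f)\<^sup>2"
  using l2_norm_residual_sq[OF eL on f F, of "\<lambda>i. l2_inner f (e i)"]
    zero_le_power2[of "l2_norm (\<lambda>x. f x - (\<Sum>i\<in>F. l2_inner f (e i) * e i x))"] by simp

lemma cfun_span_image:
  "cfun.span (e ` J) = {\<lambda>x. \<Sum>i\<in>F. c i * e i x | F c. finite F \<and> F \<subseteq> J}"
proof (intro set_eqI iffI)
  fix f assume "f \<in> cfun.span (e ` J)"
  then show "f \<in> {\<lambda>x. \<Sum>i\<in>F. c i * e i x | F c. finite F \<and> F \<subseteq> J}"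
  proof (induction rule: cfun.span_induct_alt)
    case base
    show ?case by (intro CollectI exI[of _ "{}"]) auto
  next
    case (step c g h)
    then obtain j F d where j: "g = e j" "j \<in> J" and F: "finite F" "F \<subseteq> J"
      and h: "h = (\<lambda>x. \<Sum>i\<in>F. d i * e i x)" by auto
    \<comment> \<open>Adds \<open>c\<close> to the coefficient at \<open>j\<close>, whether
      \<open>j\<close> is new or already in \<open>F\<close>.\<close>
    define d' where "d' i = (if i \<in> F then d i else 0) + (if i = j then c else 0)" for i
    have "(\<Sum>i\<in>insert j F. d' i * e i x) = c * e j x + h x" for x
    proof -
      have "(\<Sum>i\<in>insert j F. d' i * e i x) = (\<Sum>i\<in>insert j F. if i \<in> F then d i * e i x else 0)
          + (\<Sum>i\<in>insert j F. if i = j then c * e i x else 0)"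
        unfolding d'_def sum.distrib[symmetric] by (intro sum.cong) (auto simp: distrib_right)
      also have "(\<Sum>i\<in>insert j F. if i \<in> F then d i * e i x else 0) = h x"
        unfolding h using F by (intro sum.mono_neutral_cong_right) auto
      also have "(\<Sum>i\<in>insert j F. if i = j then c * e i x else 0) = c * e j x"
        using F by simp
      finally show ?thesis by simp
    qed
    then have "(\<lambda>x. c * g x) + h = (\<lambda>x. \<Sum>i\<in>insert j F. d' i * e i x)"
      by (auto simp: j fun_eq_iff)
    then show ?case using F j by (intro CollectI exI[of _ "insert j F"] exI[of _ d']) auto
  qed
next
  fix f assume "f \<in> {\<lambda>x. \<Sum>i\<in>F. c i * e i x | F c. finite F \<and> F \<subseteq> J}"
  then obtain F c where F: "finite F" "F \<subseteq> J" and f: "f = (\<lambda>x. \<Sum>i\<in>F. c i * e i x)" by auto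
  have "f = (\<Sum>i\<in>F. (\<lambda>x. c i * e i x))"
    using F(1) unfolding f by (induction F) (auto simp: fun_eq_iff)
  moreover have "(\<Sum>i\<in>F. (\<lambda>x. c i * e i x)) \<in> cfun.span (e ` J)"
    using F(2) by (intro cfun.span_sum cfun.span_scale cfun.span_base) auto
  ultimately show "f \<in> cfun.span (e ` J)" by simp
qed

text \<open>Membership in a closed span is a condition on inner products only, so it is preserved by
  every isometry.\<close>

lemma l2_closed_span_iff:
  assumes eL: "\<And>i. e i \<in> L2" and on: "\<And>i j. l2_inner (e i) (e j) = (if i = j then 1 else 0)"
    and f: "f \<in> L2"
  shows "f \<in> l2_closed_span (e ` J) \<longleftrightarrow>
    (\<forall>\<epsilon>>0. \<exists>F. finite F \<and> F \<subseteq> J \<and> (l2_norm f)\<^sup>2 - (\<Sum>i\<in>F. (cmod (l2_inner f (e i)))\<^sup>2) < \<epsilon>)"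
    (is "_ \<longleftrightarrow> ?R")
proof
  assume "f \<in> l2_closed_span (e ` J)"
  then obtain u where u: "\<And>n. u n \<in> cfun.span (e ` J)" "l2_tendsto u f"
    unfolding l2_closed_span_def by auto
  show ?R
  proof (intro allI impI)
    fix \<epsilon> :: real assume "\<epsilon> > 0"
    have "(\<lambda>n. (l2_norm (\<lambda>x. u n x - f x))\<^sup>2) \<longlonglongrightarrow> 0\<^sup>2"
      using u(2) by (intro tendsto_power) (simp add: l2_tendsto_iff)
    then have "\<forall>\<^sub>F n in sequentially. (l2_norm (\<lambda>x. u n x - f x))\<^sup>2 < \<epsilon>"
      using \<open>\<epsilon> > 0\<close> by (intro order_tendstoD) auto
    then obtain n where n: "(l2_norm (\<lambda>x. f x - u n x))\<^sup>2 < \<epsilon>"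
      unfolding l2_norm_minus_commute[of f] eventually_sequentially by blast
    obtain F c where F: "finite F" "F \<subseteq> J" and un: "u n = (\<lambda>x. \<Sum>i\<in>F. c i * e i x)"
      using u(1)[of n] unfolding cfun_span_image by auto
    have "(l2_norm f)\<^sup>2 - (\<Sum>i\<in>F. (cmod (l2_inner f (e i)))\<^sup>2) < \<epsilon>"
      using n l2_norm_residual_sq[OF eL on f F(1), of c]
        sum_nonneg[of F "\<lambda>i. (cmod (l2_inner f (e i) - c i))\<^sup>2"] unfolding un by simp
    then show "\<exists>F. finite F \<and> F \<subseteq> J \<and> (l2_norm f)\<^sup>2 - (\<Sum>i\<in>F. (cmod (l2_inner f (e i)))\<^sup>2) < \<epsilon>"
      using F by blast
  qed
next
  assume R: ?R
  have "\<exists>F. finite F \<and> F \<subseteq> J \<and> (l2_norm f)\<^sup>2 - (\<Sum>i\<in>F. (cmod (l2_inner f (e i)))\<^sup>2) < inverse (real (Suc n))" for n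
    using R by simp
  then obtain F where F: "\<And>n. finite (F n)" "\<And>n. F n \<subseteq> J"
    and le: "\<And>n. (l2_norm f)\<^sup>2 - (\<Sum>i\<in>F n. (cmod (l2_inner f (e i)))\<^sup>2) < inverse (real (Suc n))"
    by metis
  \<comment> \<open>Orthogonal projections onto the finite subfamilies: for them the squared
    residual is exactly the defect controlled by \<open>le\<close>.\<close>
  define u where "u n = (\<lambda>x. \<Sum>i\<in>F n. l2_inner f (e i) * e i x)" for n
  have uL: "u n \<in> L2" for n unfolding u_def by (intro L2_sum L2_cmult eL)
  have bd: "(l2_norm (\<lambda>x. u n x - f x))\<^sup>2 \<le> inverse (real (Suc n))" for n
    using l2_norm_residual_sq[OF eL on f F(1)[of n], of "\<lambda>i. l2_inner f (e i)"] le[of n]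
    unfolding l2_norm_minus_commute[of f] u_def by simp
  have "(\<lambda>n. (l2_norm (\<lambda>x. u n x - f x))\<^sup>2) \<longlonglongrightarrow> 0"
    by (rule tendsto_sandwich[OF _ _ tendsto_const LIMSEQ_inverse_real_of_nat])
       (intro always_eventually allI bd zero_le_power2)+
  then have "(\<lambda>n. l2_norm (\<lambda>x. u n x - f x)) \<longlonglongrightarrow> 0"
    using tendsto_real_sqrt by fastforce
  then have "l2_tendsto u f" using uL f by (auto simp: l2_tendsto_iff)
  moreover have "u n \<in> cfun.span (e ` J)" for n
    unfolding cfun_span_image u_def
    by (intro CollectI exI[of _ "F n"] exI[of _ "\<lambda>i. l2_inner f (e i)"] conjI refl F)
  ultimately show "f \<in> l2_closed_span (e ` J)" unfolding l2_closed_span_def by blast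
qed

lemma l2_closed_span_orthogonal:
  assumes eL: "\<And>i. e i \<in> L2" and h: "h \<in> L2" "\<And>i. i \<in> J \<Longrightarrow> l2_inner (e i) h = 0"
    and f: "f \<in> l2_closed_span (e ` J)"
  shows "l2_inner f h = 0"
proof -
  obtain u where u: "\<And>n. u n \<in> cfun.span (e ` J)" "l2_tendsto u f"
    using f unfolding l2_closed_span_def by auto
  have "l2_inner (u n) h = 0" for n
  proof -
    obtain F c where F: "finite F" "F \<subseteq> J" and un: "u n = (\<lambda>x. \<Sum>i\<in>F. c i * e i x)"
      using u(1)[of n] unfolding cfun_span_image by auto
    show ?thesis unfolding un
      using F h by (subst l2_inner_sum_left) (auto intro!: sum.neutral eL)
  qed
  then show ?thesis
    using l2_tendsto_inner[OF u(2) l2_tendsto_const[OF h(1)]] by (simp add: LIMSEQ_const_iff)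
qed

text \<open>Bessel bounds every finite partial sum from above, and approximation within the span
  brings some finite sum within \<open>\<epsilon>\<close> of the bound; since the terms are
  nonnegative, all larger finite sums stay in between.\<close>

lemma l2_Parseval:
  assumes eL: "\<And>i. e i \<in> L2" and on: "\<And>i j. l2_inner (e i) (e j) = (if i = j then 1 else 0)"
    and f: "f \<in> l2_closed_span (range e)"
  shows "((\<lambda>i. (cmod (l2_inner f (e i)))\<^sup>2) has_sum (l2_norm f)\<^sup>2) UNIV"
proof -
  have fL: "f \<in> L2" using f by (auto simp: l2_closed_span_def l2_tendsto_def)
  show ?thesis
    unfolding has_sum_def tendsto_iff eventually_finite_subsets_at_top
  proof (intro allI impI)
    fix \<epsilon> :: real assume "\<epsilon> > 0"
    then obtain F where F: "finite F" "(l2_norm f)\<^sup>2 - (\<Sum>i\<in>F. (cmod (l2_inner f (e i)))\<^sup>2) < \<epsilon>"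
      using f l2_closed_span_iff[OF eL on fL, of UNIV] by blast
    have "dist (\<Sum>i\<in>G. (cmod (l2_inner f (e i)))\<^sup>2) ((l2_norm f)\<^sup>2) < \<epsilon>" if "finite G" "F \<subseteq> G" for G
      using l2_Bessel[OF eL on fL that(1)] F(2) sum_mono2[OF that, of "\<lambda>i. (cmod (l2_inner f (e i)))\<^sup>2"]
      by (auto simp: dist_real_def)
    then show "\<exists>X. finite X \<and> X \<subseteq> UNIV \<and> (\<forall>Y. finite Y \<and> X \<subseteq> Y \<and> Y \<subseteq> UNIV \<longrightarrow>
        dist (\<Sum>i\<in>Y. (cmod (l2_inner f (e i)))\<^sup>2) ((l2_norm f)\<^sup>2) < \<epsilon>)"
      using F(1) by blast
  qed
qed

section \<open>Completeness and dominated convergence\<close>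

text \<open>Provides the weight for the completeness proof: being strictly positive, it can be
  divided out pointwise once a subsequence converges. The density is at most 1, so it dominates its
  own square.\<close>

lemma gaussian_L2: "(\<lambda>x. complex_of_real (std_normal_density x)) \<in> L2"
proof (rule L2_bound)
  show "(\<lambda>x. complex_of_real (std_normal_density x)) \<in> borel_measurable lebesgue"
    by (rule measurable_completion) simp
  show "integrable lebesgue std_normal_density"
    by (subst integrable_completion) auto
  have "(std_normal_density x)\<^sup>2 \<le> std_normal_density x" for x
  proof -
    have "1 \<le> sqrt (2 * pi)" using pi_gt3 by (simp add: real_le_rsqrt)
    then have "std_normal_density x \<le> 1 * 1"
      unfolding std_normal_density_def by (intro mult_mono) auto
    then show ?thesis
      using mult_left_le_one_le[of "std_normal_density x" "std_normal_density x"] normal_density_nonneg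
      by (simp add: power2_eq_square)
  qed
  then show "AE x in lebesgue. (cmod (complex_of_real (std_normal_density x)))\<^sup>2 \<le> std_normal_density x"
    by simp
qed

text \<open>Riesz--Fischer: against a fixed positive weight in \<open>L\<^sup>2\<close>, a Cauchy sequence of \<open>L\<^sup>2\<close> becomes
  Cauchy in \<open>L\<^sup>1\<close>, so a subsequence converges almost everywhere and Fatou applies.\<close>

lemma L2_complete:
  assumes uL: "\<And>n. u n \<in> L2"
    and cauchy: "\<And>\<epsilon>. \<epsilon> > 0 \<Longrightarrow> \<exists>N. \<forall>i\<ge>N. \<forall>j\<ge>N. l2_norm (\<lambda>x. u i x - u j x) < \<epsilon>"
  obtains f where "l2_tendsto u f"
proof -
  define w where "w x = complex_of_real (std_normal_density x)" for x
  have wL: "w \<in> L2" unfolding w_def by (rule gaussian_L2)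
  define s where "s n x = u n x * w x" for n x
  have [measurable]: "u n \<in> borel_measurable lebesgue" "w \<in> borel_measurable lebesgue" for n
    using uL wL L2_measurable by blast+
  obtain r where r: "strict_mono r" "AE x in lebesgue. Cauchy (\<lambda>i. s (r i) x)"
  proof (rule cauchy_L1_AE_cauchy_subseq)
    show "integrable lebesgue (s n)" for n
      unfolding s_def[abs_def] by (intro L2_prod_integrable uL wL)
    fix \<epsilon> :: real assume \<epsilon>: "\<epsilon> > 0"
    have "0 < \<epsilon> / (l2_norm w + 1)" using \<epsilon> by (intro divide_pos_pos) (auto intro: add_nonneg_pos)
    then obtain N where N: "\<And>i j. i \<ge> N \<Longrightarrow> j \<ge> N \<Longrightarrow> l2_norm (\<lambda>x. u i x - u j x) < \<epsilon> / (l2_norm w + 1)"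
      using cauchy by meson
    have "LINT x|lebesgue. norm (s i x - s j x) < \<epsilon>" if "i \<ge> N" "j \<ge> N" for i j
    proof -
      have d: "(\<lambda>x. u i x - u j x) \<in> L2" using uL by auto
      have aL: "(\<lambda>x. complex_of_real (cmod (u i x - u j x))) \<in> L2"
        using L2_measurable[OF d] L2_integrable[OF d] by (simp add: L2_def)
      have "complex_of_real (LINT x|lebesgue. norm (s i x - s j x))
          = l2_inner (\<lambda>x. complex_of_real (cmod (u i x - u j x))) w"
        unfolding integral_complex_of_real[symmetric] l2_inner_def
        by (intro Bochner_Integration.integral_cong) (auto simp: s_def w_def norm_mult simp flip: left_diff_distrib)
      then have "\<bar>LINT x|lebesgue. norm (s i x - s j x)\<bar> = cmod (l2_inner (\<lambda>x. complex_of_real (cmod (u i x - u j x))) w)"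
        by (metis norm_of_real)
      also have "\<dots> \<le> l2_norm (\<lambda>x. complex_of_real (cmod (u i x - u j x))) * l2_norm w"
        by (rule l2_Cauchy_Schwarz[OF aL wL])
      also have "l2_norm (\<lambda>x. complex_of_real (cmod (u i x - u j x))) = l2_norm (\<lambda>x. u i x - u j x)"
        by (rule l2_norm_cong) simp
      also have "\<dots> * l2_norm w \<le> \<epsilon> / (l2_norm w + 1) * l2_norm w"
        using N[OF that] by (intro mult_right_mono) auto
      also have "\<dots> < \<epsilon>" using \<epsilon> add_nonneg_pos[OF l2_norm_nonneg zero_less_one, of w] by (simp add: field_simps)
      finally show ?thesis by simp
    qed
    then show "\<exists>N. \<forall>i\<ge>N. \<forall>j\<ge>N. LINT x|lebesgue. norm (s i x - s j x) < \<epsilon>" by blast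
  qed
  define f where "f x = lim (\<lambda>i. u (r i) x)" for x
  have conv: "AE x in lebesgue. (\<lambda>i. u (r i) x) \<longlonglongrightarrow> f x"
    using r(2)
  proof eventually_elim
    case (elim x)
    have "w x \<noteq> 0" using normal_density_pos[of 1 0 x] by (simp add: w_def)
    have "convergent (\<lambda>i. s (r i) x)" using elim by (simp add: Cauchy_convergent_iff)
    then have "convergent (\<lambda>i. inverse (w x) * s (r i) x)"
      using convergent_mult[OF convergent_const] by blast
    then have "convergent (\<lambda>i. u (r i) x)" using \<open>w x \<noteq> 0\<close> by (simp add: s_def field_simps)
    then show ?case by (simp add: f_def convergent_LIMSEQ_iff)
  qed
  have [measurable]: "f \<in> borel_measurable lebesgue"
    unfolding f_def[abs_def] by (intro borel_measurable_lim_metric) auto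
  \<comment> \<open>Fatou is applied to \<open>u i - u (r j)\<close> with \<open>i\<close> fixed, so
    the bound holds along the whole sequence and not only along \<open>r\<close>. Integrability is
    part of the claim because \<open>f\<close> is not yet known to lie in \<open>L2\<close>.\<close>
  have key: "integrable lebesgue (\<lambda>x. (cmod (u i x - f x))\<^sup>2) \<and> (l2_norm (\<lambda>x. u i x - f x))\<^sup>2 \<le> \<epsilon>\<^sup>2"
    if \<epsilon>: "\<epsilon> > 0" and N: "\<And>j. j \<ge> N \<Longrightarrow> l2_norm (\<lambda>x. u i x - u j x) < \<epsilon>" for i N \<epsilon>
  proof -
    have "(\<integral>\<^sup>+x. ennreal ((cmod (u i x - f x))\<^sup>2) \<partial>lebesgue)
        = (\<integral>\<^sup>+x. liminf (\<lambda>j. ennreal ((cmod (u i x - u (r j) x))\<^sup>2)) \<partial>lebesgue)"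
    proof (rule nn_integral_cong_AE, use conv in eventually_elim)
      fix x assume "(\<lambda>i. u (r i) x) \<longlonglongrightarrow> f x"
      then have "(\<lambda>j. ennreal ((cmod (u i x - u (r j) x))\<^sup>2)) \<longlonglongrightarrow> ennreal ((cmod (u i x - f x))\<^sup>2)"
        by (intro tendsto_intros tendsto_ennrealI)
      then show "ennreal ((cmod (u i x - f x))\<^sup>2) = liminf (\<lambda>j. ennreal ((cmod (u i x - u (r j) x))\<^sup>2))"
        by (metis lim_imp_Liminf sequentially_bot)
    qed
    also have "\<dots> \<le> liminf (\<lambda>j. \<integral>\<^sup>+x. ennreal ((cmod (u i x - u (r j) x))\<^sup>2) \<partial>lebesgue)"
      by (intro nn_integral_liminf) simp
    also have "\<dots> \<le> ennreal (\<epsilon>\<^sup>2)"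
    proof -
      have "(\<integral>\<^sup>+x. ennreal ((cmod (u i x - u (r j) x))\<^sup>2) \<partial>lebesgue) \<le> ennreal (\<epsilon>\<^sup>2)" if "j \<ge> N" for j
      proof -
        have "r j \<ge> N" using seq_suble[OF r(1), of j] that by simp
        have d: "(\<lambda>x. u i x - u (r j) x) \<in> L2" using uL by auto
        have "(\<integral>\<^sup>+x. ennreal ((cmod (u i x - u (r j) x))\<^sup>2) \<partial>lebesgue) = ennreal ((l2_norm (\<lambda>x. u i x - u (r j) x))\<^sup>2)"
          unfolding l2_norm_sq by (intro nn_integral_eq_integral L2_integrable[OF d]) auto
        also have "\<dots> \<le> ennreal (\<epsilon>\<^sup>2)"
          using N[OF \<open>r j \<ge> N\<close>] \<epsilon> by (intro ennreal_leI power_mono) auto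
        finally show ?thesis .
      qed
      then have "\<forall>\<^sub>F j in sequentially. (\<integral>\<^sup>+x. ennreal ((cmod (u i x - u (r j) x))\<^sup>2) \<partial>lebesgue) \<le> ennreal (\<epsilon>\<^sup>2)"
        unfolding eventually_sequentially by blast
      then show ?thesis
        by (intro order_trans[OF Liminf_le_Limsup Limsup_bounded]) auto
    qed
    finally have le: "(\<integral>\<^sup>+x. ennreal ((cmod (u i x - f x))\<^sup>2) \<partial>lebesgue) \<le> ennreal (\<epsilon>\<^sup>2)" .
    have int: "integrable lebesgue (\<lambda>x. (cmod (u i x - f x))\<^sup>2)"
      using le by (intro integrableI_bounded) (auto intro: le_less_trans[OF _ ennreal_less_top])
    have "ennreal ((l2_norm (\<lambda>x. u i x - f x))\<^sup>2) \<le> ennreal (\<epsilon>\<^sup>2)"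
      using le unfolding l2_norm_sq by (subst nn_integral_eq_integral[symmetric]) (use int in auto)
    then show ?thesis using int by simp
  qed
  have fL: "f \<in> L2"
  proof -
    obtain N where N: "\<And>i j. i \<ge> N \<Longrightarrow> j \<ge> N \<Longrightarrow> l2_norm (\<lambda>x. u i x - u j x) < 1"
      using cauchy[of 1] by auto
    have "(\<lambda>x. u N x - f x) \<in> L2"
      using key[of 1 N N] N by (simp add: L2_def)
    then have "(\<lambda>x. u N x - (u N x - f x)) \<in> L2" by (rule L2_diff[OF uL])
    then show ?thesis by simp
  qed
  have "(\<lambda>n. l2_norm (\<lambda>x. u n x - f x)) \<longlonglongrightarrow> 0"
  proof (rule LIMSEQ_I)
    fix \<epsilon> :: real assume "\<epsilon> > 0"
    then obtain N where N: "\<And>i j. i \<ge> N \<Longrightarrow> j \<ge> N \<Longrightarrow> l2_norm (\<lambda>x. u i x - u j x) < \<epsilon> / 2"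
      using cauchy[of "\<epsilon> / 2"] by auto
    have "norm (l2_norm (\<lambda>x. u i x - f x) - 0) < \<epsilon>" if "i \<ge> N" for i
    proof -
      have "(l2_norm (\<lambda>x. u i x - f x))\<^sup>2 \<le> (\<epsilon> / 2)\<^sup>2"
        using key[of "\<epsilon> / 2" N i, OF _ N[OF that]] \<open>\<epsilon> > 0\<close> by simp
      then have "l2_norm (\<lambda>x. u i x - f x) \<le> \<epsilon> / 2"
        by (rule power2_le_imp_le) (use \<open>\<epsilon> > 0\<close> in simp)
      then show ?thesis using \<open>\<epsilon> > 0\<close> by simp
    qed
    then show "\<exists>N. \<forall>n\<ge>N. norm (l2_norm (\<lambda>x. u n x - f x) - 0) < \<epsilon>" by blast
  qed
  then have "l2_tendsto u f" using uL fL by (auto simp: l2_tendsto_iff)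
  then show ?thesis by (rule that)
qed

lemma l2_dominated_convergence:
  assumes [measurable]: "\<And>n. u n \<in> borel_measurable lebesgue" "f \<in> borel_measurable lebesgue"
    and w: "w \<in> L2" and bd: "\<And>n x. cmod (u n x) \<le> cmod (w x)"
    and lim: "\<And>x. (\<lambda>n. u n x) \<longlonglongrightarrow> f x"
  shows "l2_tendsto u f"
proof -
  have fb: "cmod (f x) \<le> cmod (w x)" for x
    by (rule Lim_bounded[OF tendsto_norm[OF lim]]) (use bd in blast)
  have uL: "u n \<in> L2" for n
    by (rule L2_bound[OF assms(1) L2_integrable[OF w]]) (auto intro!: power_mono bd)
  have fL: "f \<in> L2"
    by (rule L2_bound[OF assms(2) L2_integrable[OF w]]) (auto intro!: power_mono fb)
  have "(\<lambda>n. LINT x|lebesgue. (cmod (u n x - f x))\<^sup>2) \<longlonglongrightarrow> (LINT x|(lebesgue :: real measure). 0)"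
  proof (rule integral_dominated_convergence[where w = "\<lambda>x. 4 * (cmod (w x))\<^sup>2"])
    show "integrable lebesgue (\<lambda>x. 4 * (cmod (w x))\<^sup>2)"
      using L2_integrable[OF w] by simp
    have "(\<lambda>n. (cmod (u n x - f x))\<^sup>2) \<longlonglongrightarrow> (cmod (f x - f x))\<^sup>2" for x
      by (intro tendsto_intros lim)
    then show "AE x in lebesgue. (\<lambda>n. (cmod (u n x - f x))\<^sup>2) \<longlonglongrightarrow> 0"
      by simp
    show "AE x in lebesgue. norm ((cmod (u n x - f x))\<^sup>2) \<le> 4 * (cmod (w x))\<^sup>2" for n
    proof (intro AE_I2)
      fix x
      have "(cmod (u n x - f x))\<^sup>2 \<le> (2 * cmod (w x))\<^sup>2"
        using norm_triangle_ineq4[of "u n x" "f x"] bd[of n x] fb[of x] by (intro power_mono) auto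
      then show "norm ((cmod (u n x - f x))\<^sup>2) \<le> 4 * (cmod (w x))\<^sup>2"
        by (simp add: power_mult_distrib)
    qed
  qed auto
  then have "(\<lambda>n. sqrt (LINT x|lebesgue. (cmod (u n x - f x))\<^sup>2)) \<longlonglongrightarrow> sqrt 0"
    by (intro tendsto_real_sqrt) simp
  then show ?thesis using uL fL by (simp add: l2_tendsto_iff l2_norm_def)
qed

subsection \<open>Affine changes of variable\<close>

text \<open>The factor \<open>sqrt a\<close> makes this unitary on \<open>L2\<close> for
  \<open>a > 0\<close>. With \<open>a = 2^n\<close> and \<open>b = l\<close> it is
  \<open>D^n T^l\<close>, with \<open>a = 1\<close> a translation, so a single change of variables
  serves all operators involved.\<close>

definition affine_op :: "real \<Rightarrow> real \<Rightarrow> (real \<Rightarrow> complex) \<Rightarrow> real \<Rightarrow> complex" where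
  "affine_op a b f = (\<lambda>x. complex_of_real (sqrt a) * f (a * x - b))"

lemma lebesgue_measurable_affine:
  assumes "f \<in> borel_measurable lebesgue" "a \<noteq> 0"
  shows "(\<lambda>x::real. f (a * x - b)) \<in> borel_measurable lebesgue"
proof -
  have "(\<lambda>x. - b + a * x) \<in> lebesgue \<rightarrow>\<^sub>M (lebesgue :: real measure)"
    using lebesgue_affine_measurable[where c = "\<lambda>x::real. a" and t = "- b"] assms(2) by simp
  from measurable_compose[OF this assms(1)] show ?thesis by simp
qed

lemma lebesgue_affine_AE:
  assumes "AE x in lebesgue. P x" "a \<noteq> 0"
  shows "AE x in lebesgue. P (a * x - b :: real)"
proof -
  obtain N where N: "N \<in> null_sets lborel" "\<And>x. x \<notin> N \<Longrightarrow> P x"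
    using assms(1) unfolding AE_completion_iff by (auto elim!: AE_E3)
  then have [measurable]: "N \<in> sets borel" by auto
  have "AE x in lborel. x \<notin> N" using N(1) by (rule AE_not_in)
  then have "AE x in lborel. - b + a * x \<notin> N"
    using assms(2) by (intro AE_borel_affine[of a "\<lambda>x. x \<notin> N" "-b"]) simp_all
  then have "AE x in lborel. P (a * x - b)"
    by eventually_elim (use N(2) in \<open>simp add: algebra_simps\<close>)
  then show ?thesis by (rule AE_completion)
qed

lemma affine_L2:
  assumes "f \<in> L2" "a > 0" shows "affine_op a b f \<in> L2"
proof -
  have "integrable lebesgue (\<lambda>x. (cmod (f (- b + a * x)))\<^sup>2)"
    using lebesgue_integrable_real_affine[OF L2_integrable[OF assms(1)], of a "-b"] assms(2) by simp
  then have "(\<lambda>x. f (a * x - b)) \<in> L2"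
    using lebesgue_measurable_affine[OF L2_measurable[OF assms(1)], of a b] assms(2)
    by (simp add: L2_def algebra_simps)
  then show ?thesis unfolding affine_op_def by (rule L2_cmult)
qed

lemma l2_inner_affine:
  assumes "a > 0" shows "l2_inner (affine_op a b f) (affine_op a b g) = l2_inner f g"
proof -
  have "l2_inner (affine_op a b f) (affine_op a b g) = (LINT x|lebesgue. a *\<^sub>R (f (- b + a * x) * cnj (g (- b + a * x))))"
    unfolding l2_inner_def affine_op_def using assms
    by (intro Bochner_Integration.integral_cong refl)
       (simp add: scaleR_conv_of_real algebra_simps flip: of_real_mult)
  also have "\<dots> = l2_inner f g"
    unfolding l2_inner_def using assms
    by (subst lebesgue_integral_real_affine[of a "\<lambda>x. f x * cnj (g x)" "-b"]) auto
  finally show ?thesis .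
qed

lemma l2_norm_affine: "a > 0 \<Longrightarrow> l2_norm (affine_op a b f) = l2_norm f"
  using l2_inner_affine[of a b f f] unfolding l2_inner_self of_real_eq_iff
  by (simp add: power2_eq_iff_nonneg)

lemma translation_eq_affine: "translation \<alpha> = affine_op 1 \<alpha>"
  by (simp add: translation_def affine_op_def fun_eq_iff)

lemma affine_diff: "affine_op a b (\<lambda>x. f x - g x) = (\<lambda>x. affine_op a b f x - affine_op a b g x)"
  by (simp add: affine_op_def fun_eq_iff right_diff_distrib)

subsection \<open>Continuity of translations\<close>

text \<open>Working predicate for a density argument that climbs from open sets over measurable sets
  of finite measure and simple functions to all of \<open>L2\<close> in
  \<open>L2_translation_tendsto\<close>. Sequences at 0 are the form that dominated convergence
  accepts.\<close>

definition translation_continuous :: "(real \<Rightarrow> complex) \<Rightarrow> bool" where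
  "translation_continuous f \<longleftrightarrow> f \<in> L2 \<and>
     (\<forall>t. t \<longlonglongrightarrow> 0 \<longrightarrow> l2_tendsto (\<lambda>n. translation (t n) f) f)"

lemma translation_L2: "f \<in> L2 \<Longrightarrow> translation t f \<in> L2"
  by (simp add: translation_eq_affine affine_L2)

lemma l2_norm_translation: "l2_norm (translation t f) = l2_norm f"
  by (simp add: translation_eq_affine l2_norm_affine)

text \<open>Translations are isometries, so replacing \<open>f\<close> by a nearby \<open>g\<close>
  costs the same before and after translating, uniformly in the shift.\<close>

lemma translation_continuous_approx:
  assumes f: "f \<in> L2"
    and ap: "\<And>\<epsilon>. \<epsilon> > 0 \<Longrightarrow> \<exists>g. translation_continuous g \<and> l2_norm (\<lambda>x. f x - g x) < \<epsilon>"
  shows "translation_continuous f"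
  unfolding translation_continuous_def
proof (intro conjI allI impI f)
  fix t :: "nat \<Rightarrow> real" assume t: "t \<longlonglongrightarrow> 0"
  have "(\<lambda>n. l2_norm (\<lambda>x. translation (t n) f x - f x)) \<longlonglongrightarrow> 0"
  proof (rule LIMSEQ_I)
    fix \<epsilon> :: real assume "\<epsilon> > 0"
    then obtain g where g: "translation_continuous g" "l2_norm (\<lambda>x. f x - g x) < \<epsilon> / 3"
      using ap[of "\<epsilon> / 3"] by auto
    have gL: "g \<in> L2" and "l2_tendsto (\<lambda>n. translation (t n) g) g"
      using g(1) t by (auto simp: translation_continuous_def)
    then have "(\<lambda>n. l2_norm (\<lambda>x. translation (t n) g x - g x)) \<longlonglongrightarrow> 0"
      by (simp add: l2_tendsto_iff)
    from LIMSEQ_D[OF this, of "\<epsilon> / 3"] \<open>\<epsilon> > 0\<close>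
    obtain N where N: "\<And>n. n \<ge> N \<Longrightarrow> l2_norm (\<lambda>x. translation (t n) g x - g x) < \<epsilon> / 3" by auto
    have "norm (l2_norm (\<lambda>x. translation (t n) f x - f x) - 0) < \<epsilon>" if "n \<ge> N" for n
    proof -
      have "l2_norm (\<lambda>x. translation (t n) f x - translation (t n) g x) = l2_norm (\<lambda>x. f x - g x)"
        unfolding translation_eq_affine affine_diff[symmetric] by (simp add: l2_norm_affine)
      moreover have "l2_norm (\<lambda>x. translation (t n) f x - f x)
         \<le> l2_norm (\<lambda>x. translation (t n) f x - translation (t n) g x) + l2_norm (\<lambda>x. translation (t n) g x - f x)"
        by (intro l2_norm_triangle_diff translation_L2 f gL)
      moreover have "l2_norm (\<lambda>x. translation (t n) g x - f x)
         \<le> l2_norm (\<lambda>x. translation (t n) g x - g x) + l2_norm (\<lambda>x. g x - f x)"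
        by (intro l2_norm_triangle_diff translation_L2 f gL)
      ultimately show ?thesis
        using g(2) N[OF that] l2_norm_minus_commute[of f g] by simp
    qed
    then show "\<exists>N. \<forall>n\<ge>N. norm (l2_norm (\<lambda>x. translation (t n) f x - f x) - 0) < \<epsilon>" by blast
  qed
  then show "l2_tendsto (\<lambda>n. translation (t n) f) f"
    using f translation_L2 by (auto simp: l2_tendsto_iff)
qed

lemma indicator_L2:
  assumes "A \<in> lmeasurable" shows "(indicator A :: real \<Rightarrow> complex) \<in> L2"
proof -
  have [measurable]: "A \<in> sets lebesgue" using assms by auto
  have "(cmod (indicator A x))\<^sup>2 = indicator A x" for x :: real
    by (simp add: indicator_def)
  then show ?thesis
    using assms by (simp add: L2_def lmeasurable_iff_integrable)
qed

lemma l2_norm_indicator: "A \<in> lmeasurable \<Longrightarrow> (l2_norm (indicator A))\<^sup>2 = measure lebesgue A"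
proof -
  have "(cmod (indicator A x))\<^sup>2 = indicator A x" for x :: real
    by (simp add: indicator_def)
  then show "A \<in> lmeasurable \<Longrightarrow> ?thesis" unfolding l2_norm_sq by simp
qed

text \<open>For an open set the overlap \<open>U \<inter> (U + t)\<close> tends to \<open>U\<close> pointwise as \<open>t\<close> tends to 0, with no
  condition at the boundary.\<close>

lemma translation_continuous_open:
  assumes U: "open U" "U \<in> lmeasurable"
  shows "translation_continuous (indicator U)"
  unfolding translation_continuous_def
proof (intro conjI allI impI)
  define f where "f = (indicator U :: real \<Rightarrow> complex)"
  show fL: "(indicator U :: real \<Rightarrow> complex) \<in> L2" by (rule indicator_L2[OF U(2)])
  then have L: "f \<in> L2" "\<And>t. translation t f \<in> L2" by (auto simp: f_def translation_L2)
  fix t :: "nat \<Rightarrow> real" assume t: "t \<longlonglongrightarrow> 0"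
  have "(\<lambda>n. LINT x|lebesgue. translation (t n) f x * cnj (f x)) \<longlonglongrightarrow> (LINT x|lebesgue. f x * cnj (f x))"
  proof (rule integral_dominated_convergence[where w = "\<lambda>x. (cmod (f x))\<^sup>2"])
    show "AE x in lebesgue. (\<lambda>n. translation (t n) f x * cnj (f x)) \<longlonglongrightarrow> f x * cnj (f x)"
    proof (intro AE_I2)
      fix x
      show "(\<lambda>n. translation (t n) f x * cnj (f x)) \<longlonglongrightarrow> f x * cnj (f x)"
      proof (cases "x \<in> U")
        case True
        have "(\<lambda>n. x - t n) \<longlonglongrightarrow> x - 0" by (intro tendsto_intros t)
        then have "\<forall>\<^sub>F n in sequentially. x - t n \<in> U"
          using U(1) True by (intro topological_tendstoD) auto
        then have "\<forall>\<^sub>F n in sequentially. translation (t n) f x * cnj (f x) = f x * cnj (f x)"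
          by eventually_elim (use True in \<open>simp add: translation_def f_def\<close>)
        then show ?thesis by (rule tendsto_eventually)
      qed (simp add: f_def)
    qed
    show "integrable lebesgue (\<lambda>x. (cmod (f x))\<^sup>2)" by (rule L2_integrable[OF L(1)])
    show "AE x in lebesgue. norm (translation (t n) f x * cnj (f x)) \<le> (cmod (f x))\<^sup>2" for n
      by (intro AE_I2) (simp add: f_def translation_def indicator_def)
  qed (use L in \<open>auto intro!: borel_measurable_integrable L2_inner_integrable\<close>)
  \<comment> \<open>Translation preserves the norm, so convergence of this inner product to the
    squared norm already yields convergence in norm.\<close>
  then have "(\<lambda>n. Re (l2_inner (translation (t n) f) f)) \<longlonglongrightarrow> (l2_norm f)\<^sup>2"
    unfolding l2_inner_def[symmetric] by (drule_tac tendsto_Re) (simp add: l2_inner_self)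
  then have "(\<lambda>n. sqrt ((l2_norm f)\<^sup>2 - 2 * Re (l2_inner (translation (t n) f) f) + (l2_norm f)\<^sup>2))
      \<longlonglongrightarrow> sqrt ((l2_norm f)\<^sup>2 - 2 * (l2_norm f)\<^sup>2 + (l2_norm f)\<^sup>2)"
    by (intro tendsto_intros)
  moreover have "sqrt ((l2_norm f)\<^sup>2 - 2 * Re (l2_inner (translation (t n) f) f) + (l2_norm f)\<^sup>2)
      = l2_norm (\<lambda>x. translation (t n) f x - f x)" for n
  proof -
    have "(l2_norm f)\<^sup>2 - 2 * Re (l2_inner (translation (t n) f) f) + (l2_norm f)\<^sup>2
      = (l2_norm (\<lambda>x. translation (t n) f x - f x))\<^sup>2"
      by (simp add: l2_norm_diff_sq L l2_norm_translation)
    then show ?thesis by (simp only: real_sqrt_abs abs_of_nonneg l2_norm_nonneg)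
  qed
  ultimately have "(\<lambda>n. l2_norm (\<lambda>x. translation (t n) f x - f x)) \<longlonglongrightarrow> 0" by simp
  then show "l2_tendsto (\<lambda>n. translation (t n) (indicator U)) (indicator U)"
    using L unfolding l2_tendsto_iff f_def by blast
qed

text \<open>Outer regularity: some open \<open>U\<close> containing \<open>A\<close> exceeds it by a
  set of measure below \<open>\<epsilon>^2\<close>, and that measure is the squared distance of the
  two indicators.\<close>

lemma translation_continuous_indicator:
  assumes A: "A \<in> lmeasurable"
  shows "translation_continuous (indicator A)"
proof (rule translation_continuous_approx)
  show "(indicator A :: real \<Rightarrow> complex) \<in> L2" by (rule indicator_L2[OF A])
  fix \<epsilon> :: real assume "\<epsilon> > 0"
  then have "\<epsilon>\<^sup>2 > 0" by simp
  obtain U where U: "open U" "A \<subseteq> U" "U - A \<in> lmeasurable" "emeasure lebesgue (U - A) < ennreal (\<epsilon>\<^sup>2)"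
    using sets_lebesgue_outer_open[OF _ \<open>\<epsilon>\<^sup>2 > 0\<close>] A by blast
  have "A \<union> (U - A) = U" using U(2) by auto
  then have Um: "U \<in> lmeasurable" using A U(3) fmeasurable.Un by metis
  have "measure lebesgue (U - A) < \<epsilon>\<^sup>2"
    using U(3,4) by (simp add: emeasure_eq_measure2 ennreal_less_iff)
  moreover have "l2_norm (\<lambda>x. indicator A x - indicator U x) = l2_norm (indicator (U - A))"
    using U(2) by (intro l2_norm_cong) (auto simp: indicator_def)
  ultimately have "(l2_norm (\<lambda>x. indicator A x - indicator U x))\<^sup>2 < \<epsilon>\<^sup>2"
    by (simp add: l2_norm_indicator U(3))
  then have "l2_norm (\<lambda>x. indicator A x - indicator U x) < \<epsilon>"
    using \<open>\<epsilon> > 0\<close> by (simp add: power_less_imp_less_base)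
  then show "\<exists>g. translation_continuous g \<and> l2_norm (\<lambda>x. indicator A x - g x) < \<epsilon>"
    using translation_continuous_open[OF U(1) Um] by blast
qed

lemma translation_continuous_add:
  assumes "translation_continuous f" "translation_continuous g"
  shows "translation_continuous (\<lambda>x. f x + g x)"
  unfolding translation_continuous_def
proof (intro conjI allI impI)
  have L: "f \<in> L2" "g \<in> L2" using assms by (auto simp: translation_continuous_def)
  then show "(\<lambda>x. f x + g x) \<in> L2" by (rule L2_add)
  fix t :: "nat \<Rightarrow> real" assume t: "t \<longlonglongrightarrow> 0"
  define b where "b n = l2_norm (\<lambda>x. translation (t n) f x - f x) + l2_norm (\<lambda>x. translation (t n) g x - g x)" for n
  have "b \<longlonglongrightarrow> 0 + 0" unfolding b_def[abs_def]
    using assms t by (intro tendsto_add) (auto simp: translation_continuous_def l2_tendsto_iff)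
  then have b: "b \<longlonglongrightarrow> 0" by simp
  have "l2_norm (\<lambda>x. translation (t n) (\<lambda>x. f x + g x) x - (f x + g x)) \<le> b n" for n
  proof -
    have "(\<lambda>x. translation (t n) (\<lambda>x. f x + g x) x - (f x + g x))
      = (\<lambda>x. (translation (t n) f x - f x) + (translation (t n) g x - g x))"
      by (simp add: translation_def fun_eq_iff)
    then show ?thesis unfolding b_def
      using l2_norm_triangle[OF L2_diff[OF translation_L2[OF L(1)] L(1)] L2_diff[OF translation_L2[OF L(2)] L(2)]]
      by simp
  qed
  then have "(\<lambda>n. l2_norm (\<lambda>x. translation (t n) (\<lambda>x. f x + g x) x - (f x + g x))) \<longlonglongrightarrow> 0"
    by (intro tendsto_sandwich[OF _ _ tendsto_const b]) simp_all
  then show "l2_tendsto (\<lambda>n. translation (t n) (\<lambda>x. f x + g x)) (\<lambda>x. f x + g x)"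
    using L by (simp add: l2_tendsto_iff L2_add translation_L2)
qed

lemma translation_continuous_cmult:
  assumes "translation_continuous f"
  shows "translation_continuous (\<lambda>x. c * f x)"
  unfolding translation_continuous_def
proof (intro conjI allI impI)
  have L: "f \<in> L2" using assms by (auto simp: translation_continuous_def)
  then show cL: "(\<lambda>x. c * f x) \<in> L2" by (rule L2_cmult)
  fix t :: "nat \<Rightarrow> real" assume t: "t \<longlonglongrightarrow> 0"
  have "(\<lambda>n. cmod c * l2_norm (\<lambda>x. translation (t n) f x - f x)) \<longlonglongrightarrow> cmod c * 0"
    using assms t by (intro tendsto_intros) (auto simp: translation_continuous_def l2_tendsto_iff)
  then have "(\<lambda>n. l2_norm (\<lambda>x. translation (t n) (\<lambda>x. c * f x) x - c * f x)) \<longlonglongrightarrow> 0"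
    unfolding l2_norm_cmult[symmetric] by (simp add: translation_def right_diff_distrib)
  then show "l2_tendsto (\<lambda>n. translation (t n) (\<lambda>x. c * f x)) (\<lambda>x. c * f x)"
    using cL by (simp add: l2_tendsto_iff translation_L2)
qed

lemma translation_continuous_zero: "translation_continuous (\<lambda>x. 0)"
  by (simp add: translation_continuous_def translation_def l2_tendsto_const)

lemma translation_continuous_simple:
  assumes f: "f \<in> L2" and s: "simple_function lebesgue f"
  shows "translation_continuous f"
proof -
  have rep: "f = (\<lambda>x. \<Sum>y\<in>f ` UNIV. y * indicator (f -` {y}) x)"
  proof
    fix x
    have "f x = (\<Sum>y\<in>f ` space lebesgue. indicator (f -` {y} \<inter> space lebesgue) x *\<^sub>R y)"
      by (rule simple_function_indicator_representation_banach[OF s]) simp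
    also have "\<dots> = (\<Sum>y\<in>f ` UNIV. y * indicator (f -` {y}) x)"
      by (intro sum.cong) (auto simp: indicator_def)
    finally show "f x = (\<Sum>y\<in>f ` UNIV. y * indicator (f -` {y}) x)" .
  qed
  have "translation_continuous (\<lambda>x. \<Sum>y\<in>F. y * indicator (f -` {y}) x)" if "finite F" for F
    using that
  proof (induction F)
    case (insert y F)
    have "translation_continuous (\<lambda>x. y * indicator (f -` {y}) x)"
    \<comment> \<open>A level set at \<open>y \<noteq> 0\<close> has finite measure, since
      \<open>|f|^2\<close> is the constant \<open>|y|^2\<close> on it. The level set at 0 may have
      infinite measure, but its coefficient removes it.\<close>
    proof (cases "y = 0")
      case False
      have [measurable]: "f -` {y} \<in> sets lebesgue" using simple_functionD(2)[OF s, of "{y}"] by simp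
      have "integrable lebesgue (indicator (f -` {y}) :: real \<Rightarrow> real)"
      proof (rule Bochner_Integration.integrable_bound)
        show "integrable lebesgue (\<lambda>x. (1 / (cmod y)\<^sup>2) * (cmod (f x))\<^sup>2)"
          using L2_integrable[OF f] by simp
        show "AE x in lebesgue. norm (indicat_real (f -` {y}) x) \<le> norm ((1 / (cmod y)\<^sup>2) * (cmod (f x))\<^sup>2)"
          using False by (intro AE_I2) (auto simp: indicator_def)
      qed simp
      then show ?thesis
        by (intro translation_continuous_cmult translation_continuous_indicator) (simp add: lmeasurable_iff_integrable)
    qed (simp add: translation_continuous_zero)
    then show ?case unfolding sum.insert[OF insert.hyps]
      by (rule translation_continuous_add[OF _ insert.IH])
  qed (simp only: sum.empty translation_continuous_zero)
  moreover have "finite (f ` UNIV)" using simple_functionD(1)[OF s] by simp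
  ultimately show ?thesis by (subst rep) blast
qed

lemma L2_translation_tendsto:
  assumes f: "f \<in> L2" and t: "t \<longlonglongrightarrow> 0"
  shows "l2_tendsto (\<lambda>n. translation (t n) f) f"
proof -
  obtain F where F: "\<And>i. simple_function lebesgue (F i)" "\<And>x. (\<lambda>i. F i x) \<longlonglongrightarrow> f x"
    "\<And>i x. cmod (F i x) \<le> 2 * cmod (f x)"
    using borel_measurable_implies_sequence_metric[OF L2_measurable[OF f], of 0] by auto
  have lim: "l2_tendsto F f"
    by (rule l2_dominated_convergence[where w = "\<lambda>x. 2 * f x"])
       (use F f L2_measurable in \<open>auto intro: borel_measurable_simple_function simp: norm_mult\<close>)
  have "translation_continuous f"
  proof (rule translation_continuous_approx[OF f])
    fix \<epsilon> :: real assume "\<epsilon> > 0"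
    then obtain n where "l2_norm (\<lambda>x. F n x - f x) < \<epsilon>"
      using lim LIMSEQ_D[of "\<lambda>n. l2_norm (\<lambda>x. F n x - f x)" 0 \<epsilon>] by (auto simp: l2_tendsto_iff)
    then show "\<exists>g. translation_continuous g \<and> l2_norm (\<lambda>x. f x - g x) < \<epsilon>"
      using lim F(1) translation_continuous_simple l2_norm_minus_commute[of f "F n"]
      by (intro exI[of _ "F n"]) (auto simp: l2_tendsto_iff)
  qed
  then show ?thesis using t by (simp add: translation_continuous_def)
qed

subsection \<open>The Fourier integral\<close>

definition fourier_integral :: "(real \<Rightarrow> complex) \<Rightarrow> real \<Rightarrow> complex" where
  "fourier_integral f \<xi> = complex_of_real (1 / sqrt (2 * pi)) * (LINT x|lebesgue. f x * cis (- (x * \<xi>)))"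

lemma borel_measurable_cis [measurable (raw)]:
  "f \<in> borel_measurable M \<Longrightarrow> (\<lambda>x. cis (f x)) \<in> borel_measurable M"
  by (rule measurable_compose[of f M borel]) (auto intro!: borel_measurable_continuous_onI continuous_intros)

lemma borel_measurable_cnj [measurable (raw)]:
  "f \<in> borel_measurable M \<Longrightarrow> (\<lambda>x. cnj (f x)) \<in> borel_measurable M"
  by (simp add: borel_measurable_complex_iff)

lemma lebesgue_measurable_borel:
  fixes f :: "real \<Rightarrow> 'a::topological_space"
  shows "f \<in> borel_measurable borel \<Longrightarrow> f \<in> borel_measurable lebesgue"
  by (rule measurable_completion) simp

lemma integrable_mult_cis:
  assumes f: "integrable lebesgue f" and m: "m \<in> borel_measurable borel"
  shows "integrable lebesgue (\<lambda>x::real. f x * cis (m x))"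
proof (rule Bochner_Integration.integrable_bound[OF f])
  have [measurable]: "m \<in> borel_measurable lebesgue" "f \<in> borel_measurable lebesgue"
    using m f by (auto intro: lebesgue_measurable_borel)
  show "(\<lambda>x. f x * cis (m x)) \<in> borel_measurable lebesgue" by measurable
qed (simp add: norm_mult)

lemma integrable_fourier: "integrable lebesgue f \<Longrightarrow> integrable lebesgue (\<lambda>x. f x * cis (- (x * \<xi>)))"
  by (rule integrable_mult_cis) simp_all

lemma fourier_integral_cong_AE:
  assumes "AE x in lebesgue. f x = g x" "f \<in> borel_measurable lebesgue"
  shows "fourier_integral f = fourier_integral g"
proof
  fix \<xi>
  have [measurable]: "(\<lambda>x::real. cis (- (x * \<xi>))) \<in> borel_measurable lebesgue"
    by (rule lebesgue_measurable_borel) simp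
  have [measurable]: "f \<in> borel_measurable lebesgue" "g \<in> borel_measurable lebesgue"
    using assms lebesgue_measurable_cong_AE by blast+
  show "fourier_integral f \<xi> = fourier_integral g \<xi>"
    unfolding fourier_integral_def
  proof (intro arg_cong2[where f = "(*)"] refl integral_cong_AE)
    show "AE x in lebesgue. f x * cis (- (x * \<xi>)) = g x * cis (- (x * \<xi>))"
      using assms(1) by eventually_elim simp
  qed measurable
qed

lemma fourier_integral_lborel:
  assumes "f \<in> borel_measurable borel"
  shows "fourier_integral f \<xi> = complex_of_real (1 / sqrt (2 * pi)) * (LINT x|lborel. f x * cis (- (x * \<xi>)))"
  unfolding fourier_integral_def using assms by (subst integral_completion) auto

lemma fourier_integral_add:
  assumes "integrable lebesgue f" "integrable lebesgue g"
  shows "fourier_integral (\<lambda>x. f x + g x) \<xi> = fourier_integral f \<xi> + fourier_integral g \<xi>"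
  unfolding fourier_integral_def distrib_right
  using integrable_fourier[OF assms(1)] integrable_fourier[OF assms(2)]
  by (simp add: distrib_left)

lemma fourier_integral_diff:
  assumes "integrable lebesgue f" "integrable lebesgue g"
  shows "fourier_integral (\<lambda>x. f x - g x) \<xi> = fourier_integral f \<xi> - fourier_integral g \<xi>"
  unfolding fourier_integral_def left_diff_distrib
  using integrable_fourier[OF assms(1)] integrable_fourier[OF assms(2)]
  by (simp add: right_diff_distrib)

lemma fourier_integral_cmult: "fourier_integral (\<lambda>x. c * f x) \<xi> = c * fourier_integral f \<xi>"
  by (simp add: fourier_integral_def mult.assoc)

lemma fourier_integral_tendsto:
  assumes f: "integrable lebesgue f" and t: "t \<longlonglongrightarrow> \<xi>"
  shows "(\<lambda>n. fourier_integral f (t n)) \<longlonglongrightarrow> fourier_integral f \<xi>"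
  unfolding fourier_integral_def
proof (intro tendsto_mult tendsto_const integral_dominated_convergence[where w = "\<lambda>x. norm (f x)"])
  have "(\<lambda>n. f x * cis (- (x * t n))) \<longlonglongrightarrow> f x * cis (- (x * \<xi>))" for x
    by (intro tendsto_intros t)
  then show "AE x in lebesgue. (\<lambda>n. f x * cis (- (x * t n))) \<longlonglongrightarrow> f x * cis (- (x * \<xi>))" by simp
qed (use f in \<open>auto simp: norm_mult intro!: borel_measurable_integrable[OF integrable_fourier]\<close>)

lemma continuous_on_fourier_integral:
  assumes "integrable lebesgue f" shows "continuous_on A (fourier_integral f)"
  by (simp add: continuous_on_sequentially fourier_integral_tendsto[OF assms] o_def)

lemma borel_measurable_fourier_integral:
  "integrable lebesgue f \<Longrightarrow> fourier_integral f \<in> borel_measurable borel"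
  by (intro borel_measurable_continuous_onI continuous_on_fourier_integral)

lemma fourier_integral_bounded:
  assumes "integrable lebesgue f"
  shows "cmod (fourier_integral f \<xi>) \<le> (LINT x|lebesgue. cmod (f x))"
proof -
  have "1 \<le> sqrt (2 * pi)" using pi_gt3 by (simp add: real_le_rsqrt)
  then have "1 / sqrt (2 * pi) \<le> 1" by simp
  have "cmod (LINT x|lebesgue. f x * cis (- (x * \<xi>))) \<le> (LINT x|lebesgue. cmod (f x * cis (- (x * \<xi>))))"
    by (rule integral_norm_bound)
  also have "\<dots> = (LINT x|lebesgue. cmod (f x))" by (simp add: norm_mult)
  finally have "1 / sqrt (2 * pi) * cmod (LINT x|lebesgue. f x * cis (- (x * \<xi>))) \<le> 1 * (LINT x|lebesgue. cmod (f x))"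
    using \<open>1 / sqrt (2 * pi) \<le> 1\<close> by (intro mult_mono) auto
  then show ?thesis by (simp add: fourier_integral_def norm_mult norm_divide)
qed

lemma ex_borel_integrable:
  fixes f :: "real \<Rightarrow> complex"
  assumes "integrable lebesgue f"
  obtains f' where "f' \<in> borel_measurable borel" "AE x in lebesgue. f x = f' x" "integrable lborel f'"
proof -
  obtain f' where f': "f' \<in> borel_measurable borel" "AE x in lebesgue. f x = f' x"
    using ex_borel_complex[OF borel_measurable_integrable[OF assms]] .
  have "integrable lebesgue f'"
    using assms f' by (subst integrable_cong_AE[symmetric, of f]) (auto intro: lebesgue_measurable_borel)
  then have "integrable lborel f'" using f'(1) by (simp add: integrable_completion)
  then show ?thesis using that f' by blast
qed

lemma fourier_multiplication_borel:
  assumes [measurable]: "f \<in> borel_measurable borel" "g \<in> borel_measurable borel"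
    and f: "integrable lborel f" and g: "integrable lborel g"
  shows "(LINT \<xi>|lborel. (LINT x|lborel. f x * cis (- (x * \<xi>))) * g \<xi>)
       = (LINT x|lborel. f x * (LINT \<xi>|lborel. g \<xi> * cis (- (x * \<xi>))))"
proof -
  have "integrable (lborel \<Otimes>\<^sub>M lborel) (\<lambda>(x, \<xi>). f x * cis (- (x * \<xi>)) * g \<xi>)"
  proof (rule lborel_pair.Fubini_integrable)
    show "integrable lborel (\<lambda>x. LINT \<xi>|lborel. norm (case (x, \<xi>) of (x, \<xi>) \<Rightarrow> f x * cis (- (x * \<xi>)) * g \<xi>))"
      using f by (simp add: norm_mult)
    have "integrable lborel (\<lambda>\<xi>. f x * cis (- (x * \<xi>)) * g \<xi>)" for x
      by (rule Bochner_Integration.integrable_bound[of _ "\<lambda>\<xi>. f x * g \<xi>"])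
         (use g in \<open>auto simp: norm_mult\<close>)
    then show "AE x in lborel. integrable lborel (\<lambda>\<xi>. case (x, \<xi>) of (x, \<xi>) \<Rightarrow> f x * cis (- (x * \<xi>)) * g \<xi>)"
      by simp
  qed simp
  then have "(LINT \<xi>|lborel. LINT x|lborel. f x * cis (- (x * \<xi>)) * g \<xi>)
     = (LINT x|lborel. LINT \<xi>|lborel. f x * cis (- (x * \<xi>)) * g \<xi>)"
    by (rule lborel_pair.Fubini_integral)
  also have "\<dots> = (LINT x|lborel. LINT \<xi>|lborel. f x * (g \<xi> * cis (- (x * \<xi>))))"
    by (simp add: mult.commute mult.left_commute)
  finally show ?thesis by simp
qed

text \<open>Fubini for a kernel that is symmetric in \<open>x\<close> and \<open>\<xi>\<close>. The
  exchange is carried out for Borel representatives, which have the same transforms.\<close>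

lemma fourier_multiplication:
  assumes "integrable lebesgue f" "integrable lebesgue g"
  shows "(LINT \<xi>|lebesgue. fourier_integral f \<xi> * g \<xi>) = (LINT x|lebesgue. f x * fourier_integral g x)"
proof -
  obtain f' where f': "f' \<in> borel_measurable borel" "AE x in lebesgue. f x = f' x" "integrable lborel f'"
    using ex_borel_integrable[OF assms(1)] .
  obtain g' where g': "g' \<in> borel_measurable borel" "AE x in lebesgue. g x = g' x" "integrable lborel g'"
    using ex_borel_integrable[OF assms(2)] .
  have fi: "fourier_integral f = fourier_integral f'" "fourier_integral g = fourier_integral g'"
    by (rule fourier_integral_cong_AE[OF _ borel_measurable_integrable]; fact f'(2) g'(2) assms)+
  have int': "integrable lebesgue f'" "integrable lebesgue g'"
    using f' g' by (simp_all add: integrable_completion)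
  note [measurable] = f'(1) g'(1) borel_measurable_fourier_integral[OF int'(1)] borel_measurable_fourier_integral[OF int'(2)]
  have [measurable]: "f \<in> borel_measurable lebesgue" "g \<in> borel_measurable lebesgue"
    using assms by auto
  have [measurable]: "f' \<in> borel_measurable lebesgue" "g' \<in> borel_measurable lebesgue"
    "fourier_integral f' \<in> borel_measurable lebesgue" "fourier_integral g' \<in> borel_measurable lebesgue"
    by (rule lebesgue_measurable_borel; measurable)+
  have "(LINT \<xi>|lebesgue. fourier_integral f \<xi> * g \<xi>) = (LINT \<xi>|lebesgue. fourier_integral f' \<xi> * g' \<xi>)"
    unfolding fi
  proof (rule integral_cong_AE)
    show "AE \<xi> in lebesgue. fourier_integral f' \<xi> * g \<xi> = fourier_integral f' \<xi> * g' \<xi>"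
      using g'(2) by eventually_elim simp
  qed measurable
  also have "\<dots> = (LINT \<xi>|lborel. fourier_integral f' \<xi> * g' \<xi>)"
    by (rule integral_completion) simp
  also have "\<dots> = (LINT x|lborel. f' x * fourier_integral g' x)"
  proof -
    define c where "c = complex_of_real (1 / sqrt (2 * pi))"
    have "(LINT \<xi>|lborel. fourier_integral f' \<xi> * g' \<xi>)
        = c * (LINT \<xi>|lborel. (LINT x|lborel. f' x * cis (- (x * \<xi>))) * g' \<xi>)"
      unfolding fourier_integral_lborel[OF f'(1)] c_def[symmetric] mult.assoc
      by (rule integral_mult_right_zero)
    also have "\<dots> = c * (LINT x|lborel. f' x * (LINT \<xi>|lborel. g' \<xi> * cis (- (x * \<xi>))))"
      by (simp only: fourier_multiplication_borel[OF f'(1) g'(1) f'(3) g'(3)])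
    also have "\<dots> = (LINT x|lborel. c * (f' x * (LINT \<xi>|lborel. g' \<xi> * cis (- (x * \<xi>)))))"
      by (rule integral_mult_right_zero[symmetric])
    also have "\<dots> = (LINT x|lborel. f' x * fourier_integral g' x)"
      unfolding fourier_integral_lborel[OF g'(1)] c_def[symmetric]
      by (intro Bochner_Integration.integral_cong refl) (simp only: mult.left_commute mult.commute)
    finally show ?thesis .
  qed
  also have "\<dots> = (LINT x|lebesgue. f' x * fourier_integral g' x)"
    by (rule integral_completion[symmetric]) simp
  also have "\<dots> = (LINT x|lebesgue. f x * fourier_integral g x)"
    unfolding fi
  proof (rule integral_cong_AE)
    show "AE x in lebesgue. f' x * fourier_integral g' x = f x * fourier_integral g' x"
      using f'(2) by eventually_elim simp
  qed measurable
  finally show ?thesis .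
qed

text \<open>After the substitution \<open>s = \<sigma> \<xi>\<close> this is the characteristic
  function of the standard normal law. As \<open>\<sigma>\<close> tends to 0 the Gaussian on the
  left flattens to a constant, while the one on the right keeps mass 1 and concentrates at
  0.\<close>

lemma fourier_integral_normal:
  assumes "\<sigma> > 0"
  shows "fourier_integral (\<lambda>\<xi>. complex_of_real (std_normal_density (\<sigma> * \<xi>))) t
    = complex_of_real (std_normal_density (t / \<sigma>) / \<sigma>)"
proof -
  have "(LINT \<xi>|lborel. complex_of_real (std_normal_density (\<sigma> * \<xi>)) * cis (- (\<xi> * t)))
     = (LINT s|lborel. complex_of_real (std_normal_density s) * cis (- (s / \<sigma> * t))) / \<sigma>"
    using assms
    by (subst lborel_integral_real_affine[of \<sigma> "\<lambda>s. complex_of_real (std_normal_density s) * cis (- (s / \<sigma> * t))" 0])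
       (simp_all add: scaleR_conv_of_real)
  also have "(LINT s|lborel. complex_of_real (std_normal_density s) * cis (- (s / \<sigma> * t)))
     = char std_normal_distribution (- t / \<sigma>)"
    unfolding char_def
    by (subst integral_density)
       (auto simp: normal_density_nonneg scaleR_conv_of_real cis_conv_exp algebra_simps intro!: Bochner_Integration.integral_cong)
  also have "\<dots> = complex_of_real (exp (- (t / \<sigma>)\<^sup>2 / 2))"
    by (simp add: char_std_normal_distribution)
  finally show ?thesis
    by (subst fourier_integral_lborel) (auto simp: std_normal_density_def)
qed

text \<open>Plancherel: \<open>\<bar>fourier_integral f\<bar>\<^sup>2\<close> is up to a constant the transform of the autocorrelation. Testing it against wide
  Gaussians, the multiplication formula turns these into an approximate identity, which picks out the
  value \<open>\<parallel>f\<parallel>\<^sup>2\<close> of the autocorrelation at 0.\<close>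

definition autocorrelation :: "(real \<Rightarrow> complex) \<Rightarrow> real \<Rightarrow> complex" where
  "autocorrelation f t = (LINT x|lborel. f x * cnj (f (x - t)))"

text \<open>Writing \<open>cis (- (t * \<xi>))\<close> as \<open>cis (- (x * \<xi>))\<close> times
  the conjugate of \<open>cis (- ((x - t) * \<xi>))\<close> splits the double integral into a
  transform and its conjugate. One factor \<open>1 / sqrt (2 * pi)\<close> on the left faces two on
  the right, hence the constant.\<close>

lemma
  assumes [measurable]: "f \<in> borel_measurable borel" and f: "integrable lborel f"
  shows autocorrelation_integrable: "integrable lborel (autocorrelation f)" (is ?th1)
    and fourier_integral_autocorrelation: "fourier_integral (autocorrelation f) \<xi>
      = complex_of_real (sqrt (2 * pi) * (cmod (fourier_integral f \<xi>))\<^sup>2)" (is ?th2)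
proof -
  have refl_int: "integrable lborel (\<lambda>t. f (x - t))" for x
    using lborel_integrable_real_affine[OF f, of "-1" x] by simp
  have refl_norm: "(LINT t|lborel. norm (f (x - t))) = (LINT t|lborel. norm (f t))" for x
    by (subst lborel_integral_real_affine[of "-1" "\<lambda>t. norm (f t)" x]) auto
  \<comment> \<open>Kept general in \<open>m\<close>: the zero phase gives integrability of the
    autocorrelation, the phase \<open>- (t * \<xi>)\<close> the exchange of integrals in its
    transform.\<close>
  have int: "integrable (lborel \<Otimes>\<^sub>M lborel) (\<lambda>(x, t). f x * cnj (f (x - t)) * cis (m t))"
    if [measurable]: "m \<in> borel_measurable borel" for m
  proof (rule lborel_pair.Fubini_integrable)
    show "integrable lborel (\<lambda>x. LINT t|lborel. norm (case (x, t) of (x, t) \<Rightarrow> f x * cnj (f (x - t)) * cis (m t)))"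
      using f by (simp add: norm_mult refl_norm)
    have "integrable lborel (\<lambda>t. f x * cnj (f (x - t)) * cis (m t))" for x
      by (rule Bochner_Integration.integrable_bound[of _ "\<lambda>t. f x * f (x - t)"])
         (use refl_int in \<open>auto simp: norm_mult\<close>)
    then show "AE x in lborel. integrable lborel (\<lambda>t. case (x, t) of (x, t) \<Rightarrow> f x * cnj (f (x - t)) * cis (m t))"
      by simp
  qed simp
  have "integrable (lborel \<Otimes>\<^sub>M lborel) (\<lambda>(x, t). f x * cnj (f (x - t)))"
    using int[of "\<lambda>_. 0"] by simp
  from lborel_pair.integrable_snd[OF this] show ?th1
    by (simp add: autocorrelation_def[abs_def])
  then have meas: "autocorrelation f \<in> borel_measurable borel" using borel_measurable_integrable by force
  have "(LINT t|lborel. autocorrelation f t * cis (- (t * \<xi>)))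
      = (LINT t|lborel. LINT x|lborel. f x * cnj (f (x - t)) * cis (- (t * \<xi>)))"
    by (simp add: autocorrelation_def)
  also have "\<dots> = (LINT x|lborel. LINT t|lborel. f x * cnj (f (x - t)) * cis (- (t * \<xi>)))"
    by (rule lborel_pair.Fubini_integral[OF int]) simp
  also have "\<dots> = (LINT x|lborel. f x * cis (- (x * \<xi>)) * cnj (LINT s|lborel. f s * cis (- (s * \<xi>))))"
  proof (rule Bochner_Integration.integral_cong[OF refl])
    fix x
    have "(LINT t|lborel. f x * cnj (f (x - t)) * cis (- (t * \<xi>)))
      = (LINT t|lborel. f x * cis (- (x * \<xi>)) * cnj (f (x - t) * cis (- ((x - t) * \<xi>))))"
    proof (intro Bochner_Integration.integral_cong refl)
      fix t
      have "cis (- (t * \<xi>)) = cis (- (x * \<xi>)) * cnj (cis (- ((x - t) * \<xi>)))"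
        unfolding cis_cnj cis_mult by (simp add: algebra_simps)
      then show "f x * cnj (f (x - t)) * cis (- (t * \<xi>))
        = f x * cis (- (x * \<xi>)) * cnj (f (x - t) * cis (- ((x - t) * \<xi>)))"
        by (simp only: complex_cnj_mult mult_ac)
    qed
    also have "\<dots> = f x * cis (- (x * \<xi>)) * cnj (LINT t|lborel. f (x - t) * cis (- ((x - t) * \<xi>)))"
      by (simp only: integral_mult_right_zero Bochner_Integration.integral_cnj)
    also have "(LINT t|lborel. f (x - t) * cis (- ((x - t) * \<xi>))) = (LINT s|lborel. f s * cis (- (s * \<xi>)))"
      by (subst lborel_integral_real_affine[of "-1" "\<lambda>s. f s * cis (- (s * \<xi>))" x]) auto
    finally show "(LINT t|lborel. f x * cnj (f (x - t)) * cis (- (t * \<xi>)))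
      = f x * cis (- (x * \<xi>)) * cnj (LINT s|lborel. f s * cis (- (s * \<xi>)))" .
  qed
  also have "\<dots> = (LINT s|lborel. f s * cis (- (s * \<xi>))) * cnj (LINT s|lborel. f s * cis (- (s * \<xi>)))"
    by simp
  also have "\<dots> = complex_of_real ((cmod (LINT s|lborel. f s * cis (- (s * \<xi>))))\<^sup>2)"
    by (rule complex_norm_square[symmetric])
  finally have eq: "(LINT t|lborel. autocorrelation f t * cis (- (t * \<xi>)))
     = complex_of_real ((cmod (LINT s|lborel. f s * cis (- (s * \<xi>))))\<^sup>2)" .
  have scale: "q * (1 / q * y)\<^sup>2 = 1 / q * y\<^sup>2" if "q > 0" for q y :: real
    using that by (simp add: power2_eq_square field_simps)
  show ?th2
    unfolding fourier_integral_lborel[OF meas] fourier_integral_lborel[OF assms(1)] eq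
      of_real_mult[symmetric] of_real_eq_iff norm_mult norm_of_real
    by (subst abs_of_nonneg, simp, subst scale) simp_all
qed

lemma Plancherel_borel:
  assumes f_meas [measurable]: "f \<in> borel_measurable borel" and f: "integrable lborel f" and fL: "f \<in> L2"
  shows "integrable lborel (\<lambda>\<xi>. (cmod (fourier_integral f \<xi>))\<^sup>2)"
    and "(LINT \<xi>|lborel. (cmod (fourier_integral f \<xi>))\<^sup>2) = (l2_norm f)\<^sup>2"
proof -
  define r where "r = autocorrelation f"
  have fl: "integrable lebesgue f" using f by (simp add: integrable_completion)
  have [measurable]: "fourier_integral f \<in> borel_measurable borel" by (rule borel_measurable_fourier_integral[OF fl])
  have r_int: "integrable lborel r" unfolding r_def by (rule autocorrelation_integrable[OF f_meas f])
  then have r_meas [measurable]: "r \<in> borel_measurable borel" using borel_measurable_integrable by force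
  \<comment> \<open>As an inner product with a translate, \<open>r\<close> is bounded by
    Cauchy-Schwarz and continuous at 0 by continuity of translations.\<close>
  have r_inner: "r t = l2_inner f (translation t f)" for t
    unfolding r_def autocorrelation_def l2_inner_def translation_def
    by (rule integral_completion[symmetric]) simp
  have r_bd: "cmod (r t) \<le> (l2_norm f)\<^sup>2" for t
    using l2_Cauchy_Schwarz[OF fL translation_L2[OF fL], of t]
    by (simp add: r_inner l2_norm_translation power2_eq_square)
  have r_0: "r 0 = complex_of_real ((l2_norm f)\<^sup>2)"
    unfolding r_inner l2_inner_self[symmetric] by (simp add: translation_def)
  have r_lim: "(\<lambda>n. r (t n)) \<longlonglongrightarrow> r 0" if "t \<longlonglongrightarrow> 0" for t
    unfolding r_inner[of "t _"] r_0 l2_inner_self[symmetric]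
    by (intro l2_tendsto_inner l2_tendsto_const L2_translation_tendsto fL that)
  define \<sigma> where "\<sigma> n = inverse (real (Suc n))" for n
  have \<sigma>: "\<sigma> n > 0" for n by (simp add: \<sigma>_def)
  have \<sigma>0: "\<sigma> \<longlonglongrightarrow> 0" unfolding \<sigma>_def[abs_def] by (rule LIMSEQ_inverse_real_of_nat)
  have \<sigma>_anti: "\<sigma> n \<le> \<sigma> m" if "m \<le> n" for m n
    using that by (simp add: \<sigma>_def)
  \<comment> \<open>The factor \<open>sqrt (2 * pi)\<close> turns the weight into
    \<open>exp (- (\<sigma> n * \<xi>)^2 / 2)\<close>, which increases to 1, and is at the same time
    the constant in the transform of the autocorrelation.\<close>
  define G where "G n \<xi> = (cmod (fourier_integral f \<xi>))\<^sup>2 * (sqrt (2 * pi) * std_normal_density (\<sigma> n * \<xi>))" for n \<xi>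
  have nd_int: "integrable lborel (\<lambda>\<xi>. std_normal_density (\<sigma> n * \<xi>))" for n
    using lborel_integrable_real_affine[of std_normal_density "\<sigma> n" 0] \<sigma>[of n] by auto
  have G_int: "integrable lborel (G n)" for n
  proof (rule Bochner_Integration.integrable_bound)
    show "integrable lborel (\<lambda>\<xi>. (LINT x|lebesgue. cmod (f x))\<^sup>2 * (sqrt (2 * pi) * std_normal_density (\<sigma> n * \<xi>)))"
      using nd_int by simp
    show "G n \<in> borel_measurable lborel" unfolding G_def by measurable
    show "AE \<xi> in lborel. norm (G n \<xi>) \<le> norm ((LINT x|lebesgue. cmod (f x))\<^sup>2 * (sqrt (2 * pi) * std_normal_density (\<sigma> n * \<xi>)))"
      unfolding G_def using fourier_integral_bounded[OF fl]
      by (intro AE_I2) (auto simp: abs_mult normal_density_nonneg intro!: mult_right_mono power_mono)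
  qed
  have G_eq: "complex_of_real (integral\<^sup>L lborel (G n)) = (LINT s|lborel. complex_of_real (std_normal_density s) * r (\<sigma> n * s))" for n
  proof -
    have "complex_of_real (integral\<^sup>L lborel (G n))
      = (LINT \<xi>|lborel. fourier_integral r \<xi> * complex_of_real (std_normal_density (\<sigma> n * \<xi>)))"
      unfolding integral_complex_of_real[symmetric] r_def G_def
        fourier_integral_autocorrelation[OF f_meas f]
      by (intro Bochner_Integration.integral_cong refl) (simp add: mult_ac)
    also have "\<dots> = (LINT \<xi>|lebesgue. fourier_integral r \<xi> * complex_of_real (std_normal_density (\<sigma> n * \<xi>)))"
      using borel_measurable_fourier_integral[of r] r_int
      by (intro integral_completion[symmetric]) (simp add: integrable_completion)
    also have "\<dots> = (LINT t|lebesgue. r t * fourier_integral (\<lambda>\<xi>. complex_of_real (std_normal_density (\<sigma> n * \<xi>))) t)"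
      using r_int nd_int by (intro fourier_multiplication) (simp_all add: integrable_completion)
    also have "\<dots> = (LINT t|lborel. r t * complex_of_real (std_normal_density (t / \<sigma> n) / \<sigma> n))"
      unfolding fourier_integral_normal[OF \<sigma>] by (rule integral_completion) simp
    also have "\<dots> = (LINT s|lborel. complex_of_real (std_normal_density s) * r (\<sigma> n * s))"
      using \<sigma>[of n]
      by (subst lborel_integral_real_affine[of "\<sigma> n" _ 0])
         (auto simp: scaleR_conv_of_real field_simps simp flip: integral_mult_right_zero)
    finally show ?thesis .
  qed
  have "(\<lambda>n. LINT s|lborel. complex_of_real (std_normal_density s) * r (\<sigma> n * s))
     \<longlonglongrightarrow> (LINT s|lborel. complex_of_real (std_normal_density s) * r 0)"
  proof (rule integral_dominated_convergence[where w = "\<lambda>s. std_normal_density s * (l2_norm f)\<^sup>2"])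
    have "(\<lambda>n. complex_of_real (std_normal_density s) * r (\<sigma> n * s)) \<longlonglongrightarrow> complex_of_real (std_normal_density s) * r 0" for s
      by (intro tendsto_intros r_lim tendsto_mult_left_zero \<sigma>0)
    then show "AE s in lborel. (\<lambda>n. complex_of_real (std_normal_density s) * r (\<sigma> n * s)) \<longlonglongrightarrow> complex_of_real (std_normal_density s) * r 0"
      by simp
    show "AE s in lborel. norm (complex_of_real (std_normal_density s) * r (\<sigma> n * s)) \<le> std_normal_density s * (l2_norm f)\<^sup>2" for n
      by (intro AE_I2) (auto simp: norm_mult normal_density_nonneg intro!: mult_left_mono r_bd)
  qed auto
  also have "(LINT s|lborel. complex_of_real (std_normal_density s) * r 0) = complex_of_real ((l2_norm f)\<^sup>2)"
    by (simp add: r_0 integral_normal_density)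
  finally have lim: "(\<lambda>n. integral\<^sup>L lborel (G n)) \<longlonglongrightarrow> (l2_norm f)\<^sup>2"
    unfolding G_eq[symmetric] by (simp add: tendsto_of_real_iff del: of_real_power)
  have nd: "sqrt (2 * pi) * std_normal_density s = exp (- s\<^sup>2 / 2)" for s
    by (simp add: std_normal_density_def)
  have mono: "mono (\<lambda>n. G n \<xi>)" for \<xi>
  proof (intro monoI)
    fix m n :: nat assume "m \<le> n"
    then have "(\<sigma> n * \<xi>)\<^sup>2 \<le> (\<sigma> m * \<xi>)\<^sup>2"
      unfolding power_mult_distrib using \<sigma>[of n] \<sigma>_anti by (intro mult_right_mono power_mono) auto
    then show "G m \<xi> \<le> G n \<xi>" unfolding G_def nd by (intro mult_left_mono) auto
  qed
  have Glim: "(\<lambda>n. G n \<xi>) \<longlonglongrightarrow> (cmod (fourier_integral f \<xi>))\<^sup>2" for \<xi>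
  proof -
    have "(\<lambda>n. G n \<xi>) \<longlonglongrightarrow> (cmod (fourier_integral f \<xi>))\<^sup>2 * exp (- (0 * \<xi>)\<^sup>2 / 2)"
      unfolding G_def nd by (intro tendsto_intros \<sigma>0) auto
    then show ?thesis by simp
  qed
  \<comment> \<open>Monotone convergence, because integrability of the limit is itself to be proved;
    it follows from the convergence of the integrals of \<open>G n\<close>.\<close>
  show "integrable lborel (\<lambda>\<xi>. (cmod (fourier_integral f \<xi>))\<^sup>2)"
    by (rule integrable_monotone_convergence[OF G_int AE_I2[OF mono] AE_I2[OF Glim] lim]) simp
  show "(LINT \<xi>|lborel. (cmod (fourier_integral f \<xi>))\<^sup>2) = (l2_norm f)\<^sup>2"
    by (rule integral_monotone_convergence[OF G_int AE_I2[OF mono] AE_I2[OF Glim] lim]) simp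
qed

lemma
  assumes f: "integrable lebesgue f" and fL: "f \<in> L2"
  shows fourier_integral_L2: "fourier_integral f \<in> L2"
    and Plancherel: "l2_norm (fourier_integral f) = l2_norm f"
proof -
  obtain f' where f': "f' \<in> borel_measurable borel" "AE x in lebesgue. f x = f' x" "integrable lborel f'"
    using ex_borel_integrable[OF f] .
  have fi: "fourier_integral f = fourier_integral f'"
    by (rule fourier_integral_cong_AE[OF f'(2) borel_measurable_integrable[OF f]])
  have f'L: "f' \<in> L2" by (rule L2_cong_AE[OF fL f'(2)])
  have norm: "l2_norm f = l2_norm f'" by (rule l2_norm_cong_AE[OF fL f'(2)])
  have meas [measurable]: "fourier_integral f' \<in> borel_measurable borel"
    using f' by (intro borel_measurable_fourier_integral) (simp add: integrable_completion)
  note P = Plancherel_borel[OF f'(1,3) f'L]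
  show "fourier_integral f \<in> L2"
    using P(1) meas unfolding fi by (simp add: L2_def integrable_completion lebesgue_measurable_borel)
  have "(l2_norm (fourier_integral f))\<^sup>2 = (l2_norm f)\<^sup>2"
    unfolding fi norm P(2)[symmetric] l2_norm_sq[of "fourier_integral f'"]
    by (rule integral_completion) simp
  then show "l2_norm (fourier_integral f) = l2_norm f" by (simp add: power2_eq_iff_nonneg)
qed

subsection \<open>The Fourier transform on \<open>L\<^sup>2\<close>\<close>

definition truncate_at :: "nat \<Rightarrow> (real \<Rightarrow> complex) \<Rightarrow> real \<Rightarrow> complex" where
  "truncate_at N f x = indicator {- real N..real N} x * f x"

lemma truncate_at_L2: "f \<in> L2 \<Longrightarrow> truncate_at N f \<in> L2"
  unfolding truncate_at_def[abs_def]
  by (rule L2_mult_bounded[where B = 1]) (auto simp: indicator_def intro: lebesgue_measurable_borel)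

lemma truncate_at_integrable: "f \<in> L2 \<Longrightarrow> integrable lebesgue (truncate_at N f)"
  unfolding truncate_at_def[abs_def] by (intro L2_prod_integrable indicator_L2) simp_all

lemma truncate_at_tendsto:
  assumes f: "f \<in> L2" shows "l2_tendsto (\<lambda>N. truncate_at N f) f"
proof (rule l2_dominated_convergence[OF _ _ f])
  show "truncate_at N f \<in> borel_measurable lebesgue" "f \<in> borel_measurable lebesgue" for N
    using f truncate_at_L2 L2_measurable by blast+
  show "cmod (truncate_at N f x) \<le> cmod (f x)" for N x
    by (simp add: truncate_at_def indicator_def)
  show "(\<lambda>N. truncate_at N f x) \<longlonglongrightarrow> f x" for x
  proof (rule tendsto_eventually)
    obtain N :: nat where "\<bar>x\<bar> \<le> real N" using real_arch_simple by blast
    then show "\<forall>\<^sub>F N in sequentially. truncate_at N f x = f x"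
      unfolding eventually_sequentially
      by (intro exI[of _ N]) (auto simp: truncate_at_def indicator_def)
  qed
qed

lemma fourier_transform_iff_truncate:
  "fourier_transform f g \<longleftrightarrow> f \<in> L2 \<and> l2_tendsto (\<lambda>N. fourier_integral (truncate_at N f)) g"
proof -
  have "(\<lambda>\<xi>. complex_of_real (1 / sqrt (2 * pi)) *
          (LINT x:{- real N..real N}|lebesgue. f x * exp (- (\<i> * complex_of_real (x * \<xi>)))))
      = fourier_integral (truncate_at N f)" for N
  proof -
    have "exp (- (\<i> * (complex_of_real x * complex_of_real y))) = cis (- (x * y))" for x y
      by (simp add: cis_conv_exp)
    then show ?thesis
      by (simp add: fun_eq_iff fourier_integral_def truncate_at_def set_lebesgue_integral_def
          scaleR_conv_of_real of_real_indicator mult.assoc)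
  qed
  then show ?thesis by (simp add: fourier_transform_def)
qed

lemma Plancherel_diff:
  assumes "u \<in> L2" "v \<in> L2" "integrable lebesgue u" "integrable lebesgue v"
  shows "l2_norm (\<lambda>\<xi>. fourier_integral u \<xi> - fourier_integral v \<xi>) = l2_norm (\<lambda>x. u x - v x)"
proof -
  have "(\<lambda>\<xi>. fourier_integral u \<xi> - fourier_integral v \<xi>) = fourier_integral (\<lambda>x. u x - v x)"
    using assms by (simp add: fourier_integral_diff fun_eq_iff)
  then show ?thesis using assms by (simp add: Plancherel L2_diff)
qed

text \<open>By Plancherel the transforms of the truncations stay close to those of any other
  approximants, so arbitrary integrable approximants certify a transform. Together with
  \<open>fourier_transformD\<close> this frees later arguments from the intervals
  \<open>[-N, N]\<close>, which affine changes of variable do not preserve.\<close>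

lemma fourier_transformI:
  assumes f: "f \<in> L2" and g: "g \<in> L2"
    and ap: "\<And>\<epsilon>. \<epsilon> > 0 \<Longrightarrow> \<exists>h. h \<in> L2 \<and> integrable lebesgue h \<and> l2_norm (\<lambda>x. f x - h x) < \<epsilon>
       \<and> l2_norm (\<lambda>\<xi>. fourier_integral h \<xi> - g \<xi>) < \<epsilon>"
  shows "fourier_transform f g"
proof -
  let ?u = "\<lambda>N. truncate_at N f"
  have uL: "?u N \<in> L2" and uI: "integrable lebesgue (?u N)" for N
    using f by (auto simp: truncate_at_L2 truncate_at_integrable)
  have "(\<lambda>N. l2_norm (\<lambda>\<xi>. fourier_integral (?u N) \<xi> - g \<xi>)) \<longlonglongrightarrow> 0"
  proof (rule LIMSEQ_I)
    fix \<epsilon> :: real assume "\<epsilon> > 0"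
    then obtain h where h: "h \<in> L2" "integrable lebesgue h" "l2_norm (\<lambda>x. f x - h x) < \<epsilon> / 3"
      "l2_norm (\<lambda>\<xi>. fourier_integral h \<xi> - g \<xi>) < \<epsilon> / 3"
      using ap[of "\<epsilon> / 3"] by auto
    obtain N0 where N0: "\<And>N. N \<ge> N0 \<Longrightarrow> l2_norm (\<lambda>x. ?u N x - f x) < \<epsilon> / 3"
      using truncate_at_tendsto[OF f] LIMSEQ_D[of "\<lambda>N. l2_norm (\<lambda>x. ?u N x - f x)" 0 "\<epsilon> / 3"] \<open>\<epsilon> > 0\<close>
      by (auto simp: l2_tendsto_iff)
    have "norm (l2_norm (\<lambda>\<xi>. fourier_integral (?u N) \<xi> - g \<xi>) - 0) < \<epsilon>" if "N \<ge> N0" for N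
    proof -
      have "l2_norm (\<lambda>\<xi>. fourier_integral (?u N) \<xi> - g \<xi>)
         \<le> l2_norm (\<lambda>\<xi>. fourier_integral (?u N) \<xi> - fourier_integral h \<xi>) + l2_norm (\<lambda>\<xi>. fourier_integral h \<xi> - g \<xi>)"
        by (intro l2_norm_triangle_diff fourier_integral_L2 uL uI h g)
      also have "l2_norm (\<lambda>\<xi>. fourier_integral (?u N) \<xi> - fourier_integral h \<xi>) = l2_norm (\<lambda>x. ?u N x - h x)"
        by (rule Plancherel_diff[OF uL h(1) uI h(2)])
      also have "\<dots> \<le> l2_norm (\<lambda>x. ?u N x - f x) + l2_norm (\<lambda>x. f x - h x)"
        by (intro l2_norm_triangle_diff uL f h)
      finally show ?thesis using N0[OF that] h(3,4) by simp
    qed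
    then show "\<exists>N0. \<forall>N\<ge>N0. norm (l2_norm (\<lambda>\<xi>. fourier_integral (?u N) \<xi> - g \<xi>) - 0) < \<epsilon>" by blast
  qed
  then show ?thesis
    using f g by (simp add: fourier_transform_iff_truncate l2_tendsto_iff fourier_integral_L2[OF uI uL])
qed

lemma fourier_transformD:
  assumes "fourier_transform f g"
  shows "f \<in> L2" "g \<in> L2"
    "\<epsilon> > 0 \<Longrightarrow> \<exists>h. h \<in> L2 \<and> integrable lebesgue h \<and> l2_norm (\<lambda>x. f x - h x) < \<epsilon>
       \<and> l2_norm (\<lambda>\<xi>. fourier_integral h \<xi> - g \<xi>) < \<epsilon>"
proof -
  show f: "f \<in> L2" and "g \<in> L2"
    using assms by (auto simp: fourier_transform_iff_truncate l2_tendsto_iff)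
  assume \<epsilon>: "\<epsilon> > 0"
  let ?u = "\<lambda>N. truncate_at N f"
  have "(\<lambda>N. l2_norm (\<lambda>\<xi>. fourier_integral (?u N) \<xi> - g \<xi>)) \<longlonglongrightarrow> 0"
    using assms by (auto simp: fourier_transform_iff_truncate l2_tendsto_iff)
  then have "\<forall>\<^sub>F N in sequentially. l2_norm (\<lambda>\<xi>. fourier_integral (?u N) \<xi> - g \<xi>) < \<epsilon>"
    using \<epsilon> by (rule order_tendstoD)
  moreover have "(\<lambda>N. l2_norm (\<lambda>x. ?u N x - f x)) \<longlonglongrightarrow> 0"
    using truncate_at_tendsto[OF f] by (simp add: l2_tendsto_iff)
  then have "\<forall>\<^sub>F N in sequentially. l2_norm (\<lambda>x. ?u N x - f x) < \<epsilon>"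
    using \<epsilon> by (rule order_tendstoD)
  ultimately have "\<forall>\<^sub>F N in sequentially. l2_norm (\<lambda>\<xi>. fourier_integral (?u N) \<xi> - g \<xi>) < \<epsilon>
     \<and> l2_norm (\<lambda>x. ?u N x - f x) < \<epsilon>"
    by (rule eventually_conj)
  then obtain N where "l2_norm (\<lambda>\<xi>. fourier_integral (?u N) \<xi> - g \<xi>) < \<epsilon>" "l2_norm (\<lambda>x. ?u N x - f x) < \<epsilon>"
    unfolding eventually_sequentially by blast
  then show "\<exists>h. h \<in> L2 \<and> integrable lebesgue h \<and> l2_norm (\<lambda>x. f x - h x) < \<epsilon>
       \<and> l2_norm (\<lambda>\<xi>. fourier_integral h \<xi> - g \<xi>) < \<epsilon>"
    using truncate_at_L2[OF f] truncate_at_integrable[OF f] l2_norm_minus_commute[of f]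
    by (intro exI[of _ "?u N"]) simp
qed

lemma fourier_transform_cong_AE:
  assumes "fourier_transform f g" "AE \<xi> in lebesgue. g \<xi> = g' \<xi>"
  shows "fourier_transform f g'"
proof (rule fourier_transformI)
  show "f \<in> L2" "g' \<in> L2" using fourier_transformD(1,2)[OF assms(1)] L2_cong_AE assms(2) by blast+
  fix \<epsilon> :: real assume "\<epsilon> > 0"
  then obtain h where h: "h \<in> L2" "integrable lebesgue h" "l2_norm (\<lambda>x. f x - h x) < \<epsilon>"
      "l2_norm (\<lambda>\<xi>. fourier_integral h \<xi> - g \<xi>) < \<epsilon>"
    using fourier_transformD(3)[OF assms(1)] by blast
  have "l2_norm (\<lambda>\<xi>. fourier_integral h \<xi> - g \<xi>) = l2_norm (\<lambda>\<xi>. fourier_integral h \<xi> - g' \<xi>)"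
    using assms(2) by (intro l2_norm_cong_AE L2_diff fourier_integral_L2 h fourier_transformD(2)[OF assms(1)]) auto
  then show "\<exists>h. h \<in> L2 \<and> integrable lebesgue h \<and> l2_norm (\<lambda>x. f x - h x) < \<epsilon>
       \<and> l2_norm (\<lambda>\<xi>. fourier_integral h \<xi> - g' \<xi>) < \<epsilon>"
    using h by auto
qed

text \<open>Plancherel makes the transforms of the truncations a Cauchy sequence, and completeness
  supplies the limit. A Borel representative is taken so that the supports and phases formed from it
  later are measurable.\<close>

lemma fourier_transform_exists:
  assumes f: "f \<in> L2"
  obtains g where "g \<in> borel_measurable borel" "fourier_transform f g"
proof -
  let ?u = "\<lambda>N. truncate_at N f"
  have uL: "?u N \<in> L2" and uI: "integrable lebesgue (?u N)" for N
    using f by (auto simp: truncate_at_L2 truncate_at_integrable)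
  obtain g where g: "l2_tendsto (\<lambda>N. fourier_integral (?u N)) g"
  proof (rule L2_complete)
    show "fourier_integral (?u N) \<in> L2" for N by (rule fourier_integral_L2[OF uI uL])
    fix \<epsilon> :: real assume "\<epsilon> > 0"
    then obtain N0 where N0: "\<And>N. N \<ge> N0 \<Longrightarrow> l2_norm (\<lambda>x. ?u N x - f x) < \<epsilon> / 2"
      using truncate_at_tendsto[OF f] LIMSEQ_D[of "\<lambda>N. l2_norm (\<lambda>x. ?u N x - f x)" 0 "\<epsilon> / 2"]
      by (auto simp: l2_tendsto_iff)
    have "l2_norm (\<lambda>x. fourier_integral (?u i) x - fourier_integral (?u j) x) < \<epsilon>" if "i \<ge> N0" "j \<ge> N0" for i j
      unfolding Plancherel_diff[OF uL uL uI uI]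
      using l2_norm_triangle_diff[OF uL f uL, of i j] N0[OF that(1)] N0[OF that(2)]
        l2_norm_minus_commute[of f "?u j"] by simp
    then show "\<exists>N. \<forall>i\<ge>N. \<forall>j\<ge>N. l2_norm (\<lambda>x. fourier_integral (?u i) x - fourier_integral (?u j) x) < \<epsilon>"
      by blast
  qed
  then have "fourier_transform f g" using f by (simp add: fourier_transform_iff_truncate)
  moreover obtain g' where "g' \<in> borel_measurable borel" "AE x in lebesgue. g x = g' x"
    using ex_borel_complex[OF L2_measurable[OF fourier_transformD(2)[OF \<open>fourier_transform f g\<close>]]] .
  ultimately show ?thesis using that fourier_transform_cong_AE by blast
qed

lemma fourier_transform_add:
  assumes "fourier_transform f g" "fourier_transform f' g'"
  shows "fourier_transform (\<lambda>x. f x + f' x) (\<lambda>\<xi>. g \<xi> + g' \<xi>)"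
proof (rule fourier_transformI)
  note L = fourier_transformD(1,2)[OF assms(1)] fourier_transformD(1,2)[OF assms(2)]
  show "(\<lambda>x. f x + f' x) \<in> L2" "(\<lambda>\<xi>. g \<xi> + g' \<xi>) \<in> L2" using L by auto
  fix \<epsilon> :: real assume "\<epsilon> > 0"
  then have "\<epsilon> / 2 > 0" by simp
  obtain h where h: "h \<in> L2" "integrable lebesgue h" "l2_norm (\<lambda>x. f x - h x) < \<epsilon> / 2"
      "l2_norm (\<lambda>\<xi>. fourier_integral h \<xi> - g \<xi>) < \<epsilon> / 2"
    using fourier_transformD(3)[OF assms(1) \<open>\<epsilon> / 2 > 0\<close>] by blast
  obtain h' where h': "h' \<in> L2" "integrable lebesgue h'" "l2_norm (\<lambda>x. f' x - h' x) < \<epsilon> / 2"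
      "l2_norm (\<lambda>\<xi>. fourier_integral h' \<xi> - g' \<xi>) < \<epsilon> / 2"
    using fourier_transformD(3)[OF assms(2) \<open>\<epsilon> / 2 > 0\<close>] by blast
  have "l2_norm (\<lambda>x. (f x + f' x) - (h x + h' x)) < \<epsilon>"
    using l2_norm_triangle[OF L2_diff[OF L(1) h(1)] L2_diff[OF L(3) h'(1)]] h(3) h'(3)
    by (simp add: algebra_simps)
  moreover have "l2_norm (\<lambda>\<xi>. fourier_integral (\<lambda>x. h x + h' x) \<xi> - (g \<xi> + g' \<xi>)) < \<epsilon>"
    using l2_norm_triangle[OF L2_diff[OF fourier_integral_L2[OF h(2,1)] L(2)] L2_diff[OF fourier_integral_L2[OF h'(2,1)] L(4)]] h(4) h'(4)
    by (simp add: algebra_simps fourier_integral_add h h')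
  moreover have "(\<lambda>x. h x + h' x) \<in> L2" "integrable lebesgue (\<lambda>x. h x + h' x)" using h h' by auto
  ultimately show "\<exists>h. h \<in> L2 \<and> integrable lebesgue h \<and> l2_norm (\<lambda>x. f x + f' x - h x) < \<epsilon>
       \<and> l2_norm (\<lambda>\<xi>. fourier_integral h \<xi> - (g \<xi> + g' \<xi>)) < \<epsilon>"
    by blast
qed

lemma fourier_transform_cmult:
  assumes "fourier_transform f g"
  shows "fourier_transform (\<lambda>x. c * f x) (\<lambda>\<xi>. c * g \<xi>)"
proof (rule fourier_transformI)
  note L = fourier_transformD(1,2)[OF assms(1)]
  show "(\<lambda>x. c * f x) \<in> L2" "(\<lambda>\<xi>. c * g \<xi>) \<in> L2" using L by auto
  fix \<epsilon> :: real assume \<epsilon>: "\<epsilon> > 0"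
  have c1: "cmod c + 1 > 0" by (simp add: add_nonneg_pos)
  then have "\<epsilon> / (cmod c + 1) > 0" using \<epsilon> by simp
  then obtain h where h: "h \<in> L2" "integrable lebesgue h" "l2_norm (\<lambda>x. f x - h x) < \<epsilon> / (cmod c + 1)"
      "l2_norm (\<lambda>\<xi>. fourier_integral h \<xi> - g \<xi>) < \<epsilon> / (cmod c + 1)"
    using fourier_transformD(3)[OF assms(1)] by blast
  have small: "cmod c * y < \<epsilon>" if "y < \<epsilon> / (cmod c + 1)" "y \<ge> 0" for y
  proof -
    have "cmod c * y \<le> (cmod c + 1) * y" using that(2) by (simp add: distrib_right)
    also have "\<dots> < \<epsilon>" using that(1) c1 by (simp add: field_simps)
    finally show ?thesis .
  qed
  have "l2_norm (\<lambda>x. c * f x - c * h x) < \<epsilon>"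
    using small[OF h(3)] by (simp add: l2_norm_cmult flip: right_diff_distrib)
  moreover have "l2_norm (\<lambda>\<xi>. fourier_integral (\<lambda>x. c * h x) \<xi> - c * g \<xi>) < \<epsilon>"
    using small[OF h(4)] by (simp add: l2_norm_cmult fourier_integral_cmult flip: right_diff_distrib)
  moreover have "(\<lambda>x. c * h x) \<in> L2" "integrable lebesgue (\<lambda>x. c * h x)" using h by auto
  ultimately show "\<exists>h. h \<in> L2 \<and> integrable lebesgue h \<and> l2_norm (\<lambda>x. c * f x - h x) < \<epsilon>
       \<and> l2_norm (\<lambda>\<xi>. fourier_integral h \<xi> - c * g \<xi>) < \<epsilon>"
    by blast
qed

lemma fourier_transform_norm:
  assumes "fourier_transform f g" shows "l2_norm g = l2_norm f"
proof -
  have f: "f \<in> L2" and g: "l2_tendsto (\<lambda>N. fourier_integral (truncate_at N f)) g"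
    using assms by (auto simp: fourier_transform_iff_truncate)
  have "l2_norm (fourier_integral (truncate_at N f)) = l2_norm (truncate_at N f)" for N
    by (rule Plancherel[OF truncate_at_integrable[OF f] truncate_at_L2[OF f]])
  then show ?thesis
    using l2_tendsto_norm[OF g] l2_tendsto_norm[OF truncate_at_tendsto[OF f]] LIMSEQ_unique by simp
qed

text \<open>Polarisation: equality of norms for sums gives the real parts, and applying this to
  \<open>\<i> * g'\<close> gives the imaginary parts.\<close>

lemma fourier_transform_inner:
  assumes "fourier_transform f g" "fourier_transform f' g'"
  shows "l2_inner g g' = l2_inner f f'"
proof -
  have re: "Re (l2_inner g h) = Re (l2_inner f k)" if "fourier_transform k h" for h k
    using fourier_transform_norm[OF fourier_transform_add[OF assms(1) that]]
      l2_norm_add_sq[OF fourier_transformD(1)[OF assms(1)] fourier_transformD(1)[OF that]]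
      l2_norm_add_sq[OF fourier_transformD(2)[OF assms(1)] fourier_transformD(2)[OF that]]
      fourier_transform_norm[OF assms(1)] fourier_transform_norm[OF that] by simp
  have "Re (l2_inner g (\<lambda>\<xi>. \<i> * g' \<xi>)) = Re (l2_inner f (\<lambda>x. \<i> * f' x))"
    by (rule re[OF fourier_transform_cmult[OF assms(2)]])
  then have "Im (l2_inner g g') = Im (l2_inner f f')" by (simp add: l2_inner_cmult_right)
  then show ?thesis using re[OF assms(2)] by (simp add: complex_eq_iff)
qed

text \<open>The multiplication formula for truncations passes to the limit. The conjugates turn its
  bilinear pairing into an inner product, for which continuity is available.\<close>

lemma fourier_transform_multiplication:
  assumes "fourier_transform f g" "fourier_transform f' g'"
  shows "l2_inner g (\<lambda>x. cnj (f' x)) = l2_inner f (\<lambda>x. cnj (g' x))"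
proof -
  have f: "f \<in> L2" "f' \<in> L2" using assms by (auto dest: fourier_transformD)
  have cnj_lim: "l2_tendsto (\<lambda>n x. cnj (u n x)) (\<lambda>x. cnj (v x))" if "l2_tendsto u v" for u v
    using that unfolding l2_tendsto_iff complex_cnj_diff[symmetric] l2_norm_cnj by (simp add: L2_cnj)
  have eq: "l2_inner (fourier_integral (truncate_at N f)) (\<lambda>x. cnj (truncate_at N f' x))
     = l2_inner (truncate_at N f) (\<lambda>x. cnj (fourier_integral (truncate_at N f') x))" for N
    using fourier_multiplication[OF truncate_at_integrable[OF f(1)] truncate_at_integrable[OF f(2)], of N N]
    by (simp add: l2_inner_def)
  have "(\<lambda>N. l2_inner (fourier_integral (truncate_at N f)) (\<lambda>x. cnj (truncate_at N f' x)))
      \<longlonglongrightarrow> l2_inner g (\<lambda>x. cnj (f' x))"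
    using assms(1) by (intro l2_tendsto_inner cnj_lim truncate_at_tendsto f) (simp add: fourier_transform_iff_truncate)
  moreover have "(\<lambda>N. l2_inner (truncate_at N f) (\<lambda>x. cnj (fourier_integral (truncate_at N f') x)))
      \<longlonglongrightarrow> l2_inner f (\<lambda>x. cnj (g' x))"
    using assms(2) by (intro l2_tendsto_inner cnj_lim truncate_at_tendsto f) (simp add: fourier_transform_iff_truncate)
  ultimately show ?thesis unfolding eq using LIMSEQ_unique by blast
qed

text \<open>The inverse transform of \<open>g\<close> is the conjugate \<open>f\<close> of the transform of the conjugate of \<open>g\<close>: by the
  multiplication formula the transform \<open>q\<close> of \<open>f\<close> satisfies \<open>\<langle>q, g\<rangle> = \<parallel>f\<parallel>\<^sup>2 = \<parallel>q\<parallel>\<^sup>2 = \<parallel>g\<parallel>\<^sup>2\<close>.\<close>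

lemma fourier_transform_surj:
  assumes g: "g \<in> L2"
  obtains f where "fourier_transform f g"
proof -
  obtain k where k: "fourier_transform (\<lambda>x. cnj (g x)) k"
    using fourier_transform_exists[OF L2_cnj[OF g]] by blast
  define f where "f = (\<lambda>x. cnj (k x))"
  have fL: "f \<in> L2" unfolding f_def using fourier_transformD(2)[OF k] by (rule L2_cnj)
  then obtain q where q: "fourier_transform f q" using fourier_transform_exists by blast
  have qL: "q \<in> L2" by (rule fourier_transformD(2)[OF q])
  have "l2_inner q g = l2_inner f f"
    using fourier_transform_multiplication[OF q k] by (simp add: f_def)
  moreover have "l2_norm f = l2_norm g"
    using fourier_transform_norm[OF k] by (simp add: f_def l2_norm_cnj)
  ultimately have "(l2_norm (\<lambda>\<xi>. q \<xi> - g \<xi>))\<^sup>2 = 0"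
    using fourier_transform_norm[OF q] l2_norm_diff_sq[OF qL g] by (simp add: l2_inner_self)
  then have "AE \<xi> in lebesgue. q \<xi> - g \<xi> = 0" using qL g by (intro l2_norm_zero_AE) auto
  then have "AE \<xi> in lebesgue. q \<xi> = g \<xi>" by simp
  then show ?thesis using fourier_transform_cong_AE[OF q] that by blast
qed

lemma fourier_integral_affine:
  assumes a: "a > 0"
  shows "fourier_integral (affine_op a b h) \<xi> = cis (- (b / a * \<xi>)) * affine_op (1 / a) 0 (fourier_integral h) \<xi>"
proof -
  define F where "F y = complex_of_real (sqrt a) * h y * cis (- ((y + b) / a * \<xi>))" for y
  \<comment> \<open>The Jacobian \<open>1 / a\<close> and the factor \<open>sqrt a\<close> combine
    to \<open>sqrt (1 / a)\<close>, the normalisation of the reciprocal dilation.\<close>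
  have sa: "complex_of_real a = complex_of_real (sqrt a) * complex_of_real (sqrt a)"
    using a by (simp flip: of_real_mult)
  have "(LINT x|lebesgue. affine_op a b h x * cis (- (x * \<xi>))) = (LINT x|lebesgue. F (- b + a * x))"
    using a by (intro Bochner_Integration.integral_cong refl) (simp add: F_def affine_op_def algebra_simps)
  also have "\<dots> = (LINT y|lebesgue. F y) / a"
    using a lebesgue_integral_real_affine[of a F "- b"] by (simp add: scaleR_conv_of_real)
  also have "(LINT y|lebesgue. F y) = (LINT y|lebesgue. complex_of_real (sqrt a) * cis (- (b / a * \<xi>)) * (h y * cis (- (y * (\<xi> / a)))))"
  proof (intro Bochner_Integration.integral_cong refl)
    fix y
    have "cis (- ((y + b) / a * \<xi>)) = cis (- (b / a * \<xi>)) * cis (- (y * (\<xi> / a)))"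
      unfolding cis_mult by (simp add: add_divide_distrib algebra_simps)
    then show "F y = complex_of_real (sqrt a) * cis (- (b / a * \<xi>)) * (h y * cis (- (y * (\<xi> / a))))"
      unfolding F_def by (simp only: mult_ac)
  qed
  also have "\<dots> = complex_of_real (sqrt a) * cis (- (b / a * \<xi>)) * (LINT y|lebesgue. h y * cis (- (y * (\<xi> / a))))"
    by (rule integral_mult_right_zero)
  finally show ?thesis
    using a unfolding fourier_integral_def affine_op_def by (simp add: sa real_sqrt_divide)
qed

lemma fourier_transform_affine:
  assumes fg: "fourier_transform f g" and a: "a > 0"
  shows "fourier_transform (affine_op a b f) (\<lambda>\<xi>. cis (- (b / a * \<xi>)) * affine_op (1 / a) 0 g \<xi>)"
proof (rule fourier_transformI)
  note L = fourier_transformD(1,2)[OF fg]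
  show "affine_op a b f \<in> L2" using L(1) a by (rule affine_L2)
  have cisL: "(\<lambda>\<xi>. cis (- (b / a * \<xi>)) * q \<xi>) \<in> L2" if "q \<in> L2" for q
    using that by (rule L2_mult_bounded[where B = 1]) (auto intro!: lebesgue_measurable_borel)
  show "(\<lambda>\<xi>. cis (- (b / a * \<xi>)) * affine_op (1 / a) 0 g \<xi>) \<in> L2"
    using a L(2) by (intro cisL affine_L2) auto
  fix \<epsilon> :: real assume "\<epsilon> > 0"
  then obtain h where h: "h \<in> L2" "integrable lebesgue h" "l2_norm (\<lambda>x. f x - h x) < \<epsilon>"
      "l2_norm (\<lambda>\<xi>. fourier_integral h \<xi> - g \<xi>) < \<epsilon>"
    using fourier_transformD(3)[OF fg] by blast
  have "l2_norm (\<lambda>x. affine_op a b f x - affine_op a b h x) < \<epsilon>"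
    using h(3) a by (simp add: l2_norm_affine flip: affine_diff)
  moreover have "l2_norm (\<lambda>\<xi>. fourier_integral (affine_op a b h) \<xi> - cis (- (b / a * \<xi>)) * affine_op (1 / a) 0 g \<xi>) < \<epsilon>"
  proof -
    have "l2_norm (\<lambda>\<xi>. fourier_integral (affine_op a b h) \<xi> - cis (- (b / a * \<xi>)) * affine_op (1 / a) 0 g \<xi>)
        = l2_norm (affine_op (1 / a) 0 (\<lambda>\<xi>. fourier_integral h \<xi> - g \<xi>))"
      unfolding fourier_integral_affine[OF a] right_diff_distrib[symmetric] affine_diff
      by (rule l2_norm_cong) (simp add: norm_mult)
    then show ?thesis using h(4) a by (simp add: l2_norm_affine)
  qed
  moreover have "affine_op a b h \<in> L2" using h(1) a by (rule affine_L2)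
  moreover have "integrable lebesgue (affine_op a b h)"
    using lebesgue_integrable_real_affine[OF h(2), of a "-b"] a by (simp add: affine_op_def[abs_def])
  ultimately show "\<exists>k. k \<in> L2 \<and> integrable lebesgue k \<and> l2_norm (\<lambda>x. affine_op a b f x - k x) < \<epsilon>
       \<and> l2_norm (\<lambda>\<xi>. fourier_integral k \<xi> - cis (- (b / a * \<xi>)) * affine_op (1 / a) 0 g \<xi>) < \<epsilon>"
    by blast
qed

text \<open>The positive and negative parts of \<open>u\<close> have equal transforms, hence equal
  mass. Scaled to probability densities they have the same characteristic function, and Levy's
  uniqueness theorem identifies them.\<close>

lemma fourier_integral_real_inj:
  fixes u :: "real \<Rightarrow> real"
  assumes [measurable]: "u \<in> borel_measurable borel" and u: "integrable lborel u"
    and zero: "\<And>\<xi>. (LINT x|lborel. complex_of_real (u x) * cis (- (x * \<xi>))) = 0"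
  shows "AE x in lborel. u x = 0"
proof -
  define p n where "p x = max 0 (u x)" and "n x = max 0 (- u x)" for x
  have [measurable]: "p \<in> borel_measurable borel" "n \<in> borel_measurable borel"
    unfolding p_def[abs_def] n_def[abs_def] by measurable
  have up: "u x = p x - n x" and nonneg: "p x \<ge> 0" "n x \<ge> 0" for x by (auto simp: p_def n_def)
  have int: "integrable lborel p" "integrable lborel n"
    unfolding p_def[abs_def] n_def[abs_def] using u by auto
  have cint: "integrable lborel (\<lambda>x. complex_of_real (v x) * cis (x * t))" if v: "integrable lborel v" for v t
  proof (rule Bochner_Integration.integrable_bound[OF v])
    have [measurable]: "v \<in> borel_measurable borel" using borel_measurable_integrable[OF v] by simp
    show "(\<lambda>x. complex_of_real (v x) * cis (x * t)) \<in> borel_measurable lborel" by simp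
  qed (simp add: norm_mult)
  have eq: "(LINT x|lborel. complex_of_real (p x) * cis (x * t)) = (LINT x|lborel. complex_of_real (n x) * cis (x * t))" for t
    using zero[of "- t"] cint[OF int(1), of t] cint[OF int(2), of t] by (simp add: up left_diff_distrib)
  define m where "m = (LINT x|lborel. p x)"
  have m: "(LINT x|lborel. n x) = m"
    using eq[of 0] by (simp add: m_def)
  show ?thesis
  \<comment> \<open>Mass 0 cannot be normalised, but then both parts vanish almost
    everywhere.\<close>
  proof (cases "m = 0")
    case True
    then have "AE x in lborel. p x = 0"
      using int nonneg by (simp add: m_def integral_nonneg_eq_0_iff_AE)
    moreover have "(LINT x|lborel. n x) = 0" using True m by simp
    then have "AE x in lborel. n x = 0"
      using int nonneg by (simp add: integral_nonneg_eq_0_iff_AE)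
    ultimately show ?thesis by eventually_elim (simp add: up)
  next
    case False
    moreover have "m \<ge> 0" unfolding m_def using nonneg by simp
    ultimately have m0: "m > 0" by simp
    define M :: "(real \<Rightarrow> real) \<Rightarrow> real measure" where "M v = density lborel (\<lambda>x. ennreal (v x / m))" for v
    have rd: "real_distribution (M v)" and ch: "char (M v) t = (LINT x|lborel. complex_of_real (v x) * cis (x * t)) / m"
      if [measurable]: "v \<in> borel_measurable borel" and v: "integrable lborel v" "\<And>x. v x \<ge> 0" "(LINT x|lborel. v x) = m" for v t
    proof -
      have "(\<integral>\<^sup>+x. ennreal (v x / m) \<partial>lborel) = ennreal (LINT x|lborel. v x / m)"
        using v m0 by (intro nn_integral_eq_integral) auto
      also have "\<dots> = 1" using v m0 by simp
      finally have "prob_space (M v)"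
        unfolding M_def by (intro prob_spaceI) (simp add: emeasure_density)
      then show "real_distribution (M v)"
        by (simp add: real_distribution_def real_distribution_axioms_def M_def)
      show "char (M v) t = (LINT x|lborel. complex_of_real (v x) * cis (x * t)) / m"
        unfolding char_def M_def using m0 v
        by (subst integral_density)
           (auto simp: scaleR_conv_of_real cis_conv_exp mult_ac simp flip: integral_divide_zero intro!: Bochner_Integration.integral_cong)
    qed
    have "M p = M n"
    proof (rule Levy_uniqueness)
      show "real_distribution (M p)" "real_distribution (M n)"
        using rd int nonneg m m_def by auto
      show "char (M p) = char (M n)"
        using int nonneg m by (intro ext) (simp add: ch m_def[symmetric] eq)
    qed
    then have "AE x in lborel. ennreal (p x / m) = ennreal (n x / m)"
      unfolding M_def by (subst (asm) sigma_finite_measure.density_unique_iff[OF sigma_finite_lborel]) auto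
    then show ?thesis
      by eventually_elim (use nonneg m0 in \<open>simp add: up\<close>)
  qed
qed

text \<open>Conjugating a function conjugates its transform and reflects the frequency, so the
  conjugate has vanishing transform as well, and with it the real and imaginary parts.\<close>

lemma fourier_integral_inj:
  assumes h: "integrable lebesgue h" and zero: "\<And>\<xi>. fourier_integral h \<xi> = 0"
  shows "AE x in lebesgue. h x = 0"
proof -
  obtain k where k [measurable]: "k \<in> borel_measurable borel" and hk: "AE x in lebesgue. h x = k x" and kint: "integrable lborel k"
    using ex_borel_integrable[OF h] .
  have cint: "integrable lborel (\<lambda>x. k x * cis (m x))" if [measurable]: "m \<in> borel_measurable borel" for m
    by (rule Bochner_Integration.integrable_bound[OF kint]) (auto simp: norm_mult)
  have k0: "(LINT x|lborel. k x * cis (- (x * \<xi>))) = 0" for \<xi>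
    using zero[of \<xi>] fourier_integral_cong_AE[OF hk borel_measurable_integrable[OF h]]
    by (simp add: fourier_integral_lborel[OF k])
  have "(LINT x|lborel. cnj (k x) * cis (- (x * \<xi>))) = cnj (LINT x|lborel. k x * cis (- (x * (- \<xi>))))" for \<xi>
    unfolding Bochner_Integration.integral_cnj[symmetric] by (simp add: cis_cnj)
  then have c0: "(LINT x|lborel. cnj (k x) * cis (- (x * \<xi>))) = 0" for \<xi>
    unfolding k0 by simp
  have ccint: "integrable lborel (\<lambda>x. cnj (k x) * cis (m x))" if [measurable]: "m \<in> borel_measurable borel" for m
    by (rule Bochner_Integration.integrable_bound[OF kint]) (auto simp: norm_mult)
  have "AE x in lborel. Re (k x) = 0"
  proof (rule fourier_integral_real_inj)
    fix \<xi>
    have "complex_of_real (Re z) * w = (z * w + cnj z * w) / 2" for z w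
      by (simp add: complex_add_cnj flip: distrib_right)
    note eq = this
    show "(LINT x|lborel. complex_of_real (Re (k x)) * cis (- (x * \<xi>))) = 0"
      using cint[of "\<lambda>x. - (x * \<xi>)"] ccint[of "\<lambda>x. - (x * \<xi>)"] unfolding eq by (simp add: k0 c0)
  qed (use kint in auto)
  moreover have "AE x in lborel. Im (k x) = 0"
  proof (rule fourier_integral_real_inj)
    fix \<xi>
    have "complex_of_real (Im z) * w = (z * w - cnj z * w) / (2 * \<i>)" for z w
    proof -
      have "complex_of_real (Im z) * w * (2 * \<i>) = z * w - cnj z * w"
        by (simp add: complex_eq_iff algebra_simps)
      then show ?thesis by (subst nonzero_eq_divide_eq) simp_all
    qed
    note eq = this
    show "(LINT x|lborel. complex_of_real (Im (k x)) * cis (- (x * \<xi>))) = 0"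
      using cint[of "\<lambda>x. - (x * \<xi>)"] ccint[of "\<lambda>x. - (x * \<xi>)"] unfolding eq by (simp add: k0 c0)
  qed (use kint in auto)
  ultimately have "AE x in lborel. k x = 0"
    by eventually_elim (simp add: complex_eq_iff)
  from AE_completion[OF this] hk show ?thesis by eventually_elim simp
qed

subsection \<open>Wavelet systems on the Fourier side\<close>

lemma translation_funpow: "(translation a ^^ k) f = translation (real k * a) f"
  by (induction k) (auto simp: translation_def fun_eq_iff algebra_simps)

lemma int_pow_translation: "int_pow (translation 1) l f = translation (real_of_int l) f"
  by (auto simp: int_pow_def inv_translation translation_funpow)

lemma dilation_funpow: "(dilation ^^ k) f = affine_op (2 ^ k) 0 f"
  by (induction k)
     (auto simp: dilation_def affine_op_def fun_eq_iff real_sqrt_mult mult_ac simp flip: of_real_mult)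

lemma inv_dilation_funpow: "(inv dilation ^^ k) f = affine_op (inverse 2 ^ k) 0 f"
proof (induction k)
  case (Suc k)
  have "(inv dilation ^^ Suc k) f = inv dilation (affine_op (inverse 2 ^ k) 0 f)"
    using Suc by (simp only: funpow.simps o_apply)
  also have "\<dots> = affine_op (inverse 2 ^ Suc k) 0 f"
    by (simp add: inv_dilation affine_op_def fun_eq_iff real_sqrt_mult real_sqrt_divide field_simps)
  finally show ?case .
qed (simp add: affine_op_def fun_eq_iff)

lemma wavelet_system_eq: "wavelet_system \<psi> (n, l) = affine_op (2 powi n) (real_of_int l) \<psi>"
proof -
  have "int_pow dilation n f = affine_op (2 powi n) 0 f" for f
    by (simp add: int_pow_def dilation_funpow inv_dilation_funpow power_int_def)
  then show ?thesis
    by (simp add: wavelet_system_def int_pow_translation) (simp add: affine_op_def translation_def fun_eq_iff)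
qed

lemma translation_affine_op: "translation \<alpha> (affine_op a b f) = affine_op a (b + a * \<alpha>) f"
  by (simp add: translation_def affine_op_def fun_eq_iff algebra_simps)

lemma powi_pos: "(0 :: real) < 2 powi n" by (rule zero_less_power_int) simp

text \<open>Only pairs involving level 0 are asked for; arbitrary pairs of levels follow by
  rescaling. Stated through the values of \<open>g\<close> up to null sets, it does not depend on
  the representative of the transform.\<close>

definition dyadic_disjoint :: "(real \<Rightarrow> complex) \<Rightarrow> bool" where
  "dyadic_disjoint g \<longleftrightarrow> (\<forall>j::int. j \<noteq> 0 \<longrightarrow> (AE \<xi> in lebesgue. g \<xi> = 0 \<or> g (2 powi j * \<xi>) = 0))"

text \<open>For negative \<open>j\<close> the assumption at \<open>- j\<close> is evaluated at
  \<open>2^j \<xi>\<close>, which exchanges the roles of the two dilates.\<close>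

lemma dyadic_disjointI:
  assumes "\<And>j::nat. j \<ge> 1 \<Longrightarrow> AE \<xi> in lebesgue. g (2 ^ j * \<xi>) = 0 \<or> g \<xi> = 0"
  shows "dyadic_disjoint g"
  unfolding dyadic_disjoint_def
proof (intro allI impI)
  fix j :: int assume "j \<noteq> 0"
  then consider "j > 0" | "j < 0" by linarith
  then show "AE \<xi> in lebesgue. g \<xi> = 0 \<or> g (2 powi j * \<xi>) = 0"
  proof cases
    case 1
    then have "AE \<xi> in lebesgue. g (2 ^ nat j * \<xi>) = 0 \<or> g \<xi> = 0" by (intro assms) simp
    then show ?thesis by eventually_elim (use 1 in \<open>auto simp: power_int_def\<close>)
  next
    case 2
    then have "AE \<xi> in lebesgue. g (2 ^ nat (- j) * \<xi>) = 0 \<or> g \<xi> = 0" by (intro assms) simp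
    from lebesgue_affine_AE[OF this, of "2 powi j" 0] powi_pos[of j]
    show ?thesis using 2 by (simp add: power_int_def mult.assoc[symmetric] power_mult_distrib[symmetric] disj_commute)
  qed
qed

lemma dyadic_disjoint_AE:
  assumes "dyadic_disjoint g" "n \<noteq> m"
  shows "AE \<xi> in lebesgue. g (2 powi n * \<xi>) = 0 \<or> g (2 powi m * \<xi>) = 0"
proof -
  have "AE \<xi> in lebesgue. g \<xi> = 0 \<or> g (2 powi (m - n) * \<xi>) = 0"
    using assms by (simp add: dyadic_disjoint_def)
  from lebesgue_affine_AE[OF this, of "2 powi n" 0] powi_pos[of n]
  show ?thesis by (simp add: mult.assoc[symmetric] power_int_add[symmetric])
qed

lemma powi_inverse: "1 / (2::real) powi n = 2 powi (- n)"
  by (simp add: power_int_minus field_simps)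

text \<open>Shifts become modulations under the transform and leave supports alone, so
  \<open>b\<close> and \<open>c\<close> may be arbitrary reals. This is what admits translates by
  any \<open>\<alpha>\<close> of elements of the system.\<close>

lemma dyadic_disjoint_orthogonal:
  assumes g: "fourier_transform \<psi> g" "dyadic_disjoint g" and nm: "n \<noteq> m"
  shows "l2_inner (affine_op (2 powi n) b \<psi>) (affine_op (2 powi m) c \<psi>) = 0"
proof -
  have "l2_inner (affine_op (2 powi n) b \<psi>) (affine_op (2 powi m) c \<psi>)
      = l2_inner (\<lambda>\<xi>. cis (- (b / 2 powi n * \<xi>)) * affine_op (1 / 2 powi n) 0 g \<xi>)
          (\<lambda>\<xi>. cis (- (c / 2 powi m * \<xi>)) * affine_op (1 / 2 powi m) 0 g \<xi>)"
    by (rule fourier_transform_inner[symmetric]; rule fourier_transform_affine[OF g(1) powi_pos])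
  also have "\<dots> = 0"
    unfolding l2_inner_def
  proof (rule integral_eq_zero_AE)
    have "AE \<xi> in lebesgue. g (2 powi (- n) * \<xi>) = 0 \<or> g (2 powi (- m) * \<xi>) = 0"
      using nm by (intro dyadic_disjoint_AE g) simp
    then show "AE \<xi> in lebesgue. cis (- (b / 2 powi n * \<xi>)) * affine_op (1 / 2 powi n) 0 g \<xi> *
        cnj (cis (- (c / 2 powi m * \<xi>)) * affine_op (1 / 2 powi m) 0 g \<xi>) = 0"
      by eventually_elim (auto simp: affine_op_def powi_inverse)
  qed
  finally show ?thesis .
qed

lemma waveletD:
  assumes "wavelet \<psi>"
  shows "\<psi> \<in> L2" "wavelet_system \<psi> i \<in> L2"
    "l2_inner (wavelet_system \<psi> i) (wavelet_system \<psi> j) = (if i = j then 1 else 0)"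
    "l2_closed_span (range (wavelet_system \<psi>)) = L2"
  using assms unfolding wavelet_def orthonormal_basis_def by blast+

lemma core_space_eq: "core_space \<psi> = l2_closed_span (wavelet_system \<psi> ` {(n, l). n < 0})"
  unfolding core_space_def by (rule arg_cong[where f = l2_closed_span]) auto

text \<open>In an inner product the translation can be moved to the other factor, where it preserves
  the scale. A translated element of the core space therefore stays orthogonal to all scales
  \<open>m \<ge> 0\<close>, and expanding it in the basis puts it back into the closed span of the
  negative scales.\<close>

lemma dyadic_disjoint_imp_wavelet_L:
  assumes \<psi>: "wavelet \<psi>" and g: "fourier_transform \<psi> g" "dyadic_disjoint g"
  shows "\<psi> \<in> wavelet_L \<infinity>"
proof -
  let ?J = "{(n::int, l::int). n < 0}"
  let ?e = "wavelet_system \<psi>"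
  note eL = waveletD(2)[OF \<psi>] and on = waveletD(3)[OF \<psi>]
  have "translation \<alpha> f \<in> core_space \<psi>" if f: "f \<in> core_space \<psi>" for \<alpha> f
  proof -
    have fL: "f \<in> L2" using f by (auto simp: core_space_def l2_closed_span_def l2_tendsto_def)
    define h where "h = translation \<alpha> f"
    have hL: "h \<in> L2" unfolding h_def by (rule translation_L2[OF fL])
    have zero: "l2_inner h (?e p) = 0" if "p \<notin> ?J" for p
    proof -
      obtain m k where p: "p = (m, k)" "m \<ge> 0" using \<open>p \<notin> ?J\<close> by (cases p) auto
      \<comment> \<open>Chosen so that translating by \<open>\<alpha>\<close> restores the integer
        shift \<open>k\<close>.\<close>
      define b where "b = real_of_int k - 2 powi m * \<alpha>"
      have ep: "?e p = translation \<alpha> (affine_op (2 powi m) b \<psi>)"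
        by (simp add: p wavelet_system_eq translation_affine_op b_def)
      have "l2_inner h (?e p) = l2_inner f (affine_op (2 powi m) b \<psi>)"
        unfolding h_def ep translation_eq_affine by (rule l2_inner_affine) simp
      also have "\<dots> = 0"
      proof (rule l2_closed_span_orthogonal[OF eL])
        show "affine_op (2 powi m) b \<psi> \<in> L2" by (rule affine_L2[OF waveletD(1)[OF \<psi>] powi_pos])
        show "f \<in> l2_closed_span (?e ` ?J)" using f by (simp add: core_space_eq)
        show "l2_inner (?e i) (affine_op (2 powi m) b \<psi>) = 0" if "i \<in> ?J" for i
          using that p(2) by (cases i) (auto simp: wavelet_system_eq intro!: dyadic_disjoint_orthogonal[OF g])
      qed
      finally show ?thesis .
    qed
    have "h \<in> l2_closed_span (range ?e)" using hL waveletD(4)[OF \<psi>] by simp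
    then have ap: "\<And>\<epsilon>. \<epsilon> > 0 \<Longrightarrow> \<exists>F. finite F \<and> (l2_norm h)\<^sup>2 - (\<Sum>i\<in>F. (cmod (l2_inner h (?e i)))\<^sup>2) < \<epsilon>"
      using l2_closed_span_iff[OF eL on hL, of UNIV] by simp
    have "h \<in> l2_closed_span (?e ` ?J)"
      unfolding l2_closed_span_iff[OF eL on hL]
    proof (intro allI impI)
      fix \<epsilon> :: real assume "\<epsilon> > 0"
      then obtain F where F: "finite F" "(l2_norm h)\<^sup>2 - (\<Sum>i\<in>F. (cmod (l2_inner h (?e i)))\<^sup>2) < \<epsilon>"
        using ap by blast
      \<comment> \<open>Indices outside \<open>?J\<close> contribute 0, so a good finite set for the
        full system can be cut down to the negative scales.\<close>
      have "(\<Sum>i\<in>F. (cmod (l2_inner h (?e i)))\<^sup>2) = (\<Sum>i\<in>F \<inter> ?J. (cmod (l2_inner h (?e i)))\<^sup>2)"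
        using F(1) zero by (intro sum.mono_neutral_right) auto
      then show "\<exists>F. finite F \<and> F \<subseteq> ?J \<and> (l2_norm h)\<^sup>2 - (\<Sum>i\<in>F. (cmod (l2_inner h (?e i)))\<^sup>2) < \<epsilon>"
        using F by (intro exI[of _ "F \<inter> ?J"]) auto
    qed
    then show ?thesis by (simp add: h_def core_space_eq)
  qed
  then show ?thesis
    using \<psi> by (auto simp: wavelet_L_def translation_group_def)
qed

lemma dyadic_approximation:
  fixes \<alpha> :: real
  shows "(\<lambda>n. real_of_int \<lfloor>2 ^ n * \<alpha>\<rfloor> / 2 ^ n) \<longlonglongrightarrow> \<alpha>"
proof -
  have le: "norm (real_of_int \<lfloor>2 ^ n * \<alpha>\<rfloor> / 2 ^ n - \<alpha>) \<le> inverse 2 ^ n" for n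
  proof -
    have "\<bar>real_of_int \<lfloor>2 ^ n * \<alpha>\<rfloor> - 2 ^ n * \<alpha>\<bar> \<le> 1" by linarith
    then have "\<bar>real_of_int \<lfloor>2 ^ n * \<alpha>\<rfloor> - 2 ^ n * \<alpha>\<bar> / 2 ^ n \<le> 1 / 2 ^ n"
      by (intro divide_right_mono) auto
    moreover have "real_of_int \<lfloor>2 ^ n * \<alpha>\<rfloor> / 2 ^ n - \<alpha> = (real_of_int \<lfloor>2 ^ n * \<alpha>\<rfloor> - 2 ^ n * \<alpha>) / 2 ^ n"
      by (simp add: field_simps)
    ultimately show ?thesis by (simp add: abs_divide power_inverse field_simps)
  qed
  have "(\<lambda>n. inverse 2 ^ n :: real) \<longlonglongrightarrow> 0" by (rule LIMSEQ_power_zero) simp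
  with le have "(\<lambda>n. real_of_int \<lfloor>2 ^ n * \<alpha>\<rfloor> / 2 ^ n - \<alpha>) \<longlonglongrightarrow> 0"
    by (rule Lim_null_comparison[OF always_eventually, OF allI])
  then show ?thesis by (simp add: LIM_zero_iff)
qed

text \<open>Invariance of the core space makes the correlation of \<open>\<psi>\<close> with its coarser dilates vanish at all
  dyadic shifts. This correlation is the Fourier integral of an integrable function, so it is
  continuous and vanishes everywhere.\<close>

lemma wavelet_L_imp_dyadic_disjoint:
  assumes L: "\<And>n. \<psi> \<in> wavelet_L (enat n)" and g: "fourier_transform \<psi> g"
  shows "dyadic_disjoint g"
proof (rule dyadic_disjointI)
  fix j :: nat assume "j \<ge> 1"
  have \<psi>: "wavelet \<psi>" using L[of 0] by (simp add: wavelet_L_def)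
  let ?e = "wavelet_system \<psi>"
  define a :: real where "a = 2 powi (- int j)"
  have a: "a > 0" "1 / a = 2 ^ j" by (simp_all add: a_def power_int_minus divide_inverse)
  \<comment> \<open>A product of two \<open>L2\<close> functions is integrable, so its Fourier
    integral is a genuine continuous function even if \<open>g\<close> is not integrable.\<close>
  define H where "H \<xi> = affine_op (2 ^ j) 0 g \<xi> * cnj (g \<xi>)" for \<xi>
  have H: "integrable lebesgue H"
    unfolding H_def[abs_def] by (intro L2_inner_integrable affine_L2 fourier_transformD(2)[OF g]) simp
  have corr: "l2_inner (translation \<alpha> (?e (- int j, 0))) (?e (0, 0)) = complex_of_real (sqrt (2 * pi)) * fourier_integral H \<alpha>" for \<alpha>
  proof -
    have "fourier_transform (translation \<alpha> (?e (- int j, 0))) (\<lambda>\<xi>. cis (- (\<alpha> * \<xi>)) * affine_op (2 ^ j) 0 g \<xi>)"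
      using fourier_transform_affine[OF g a(1), of "a * \<alpha>"] a
      by (simp add: wavelet_system_eq translation_affine_op flip: a_def)
    moreover have "fourier_transform (?e (0, 0)) g"
      using g by (simp add: wavelet_system_eq affine_op_def)
    ultimately have "l2_inner (translation \<alpha> (?e (- int j, 0))) (?e (0, 0))
      = l2_inner (\<lambda>\<xi>. cis (- (\<alpha> * \<xi>)) * affine_op (2 ^ j) 0 g \<xi>) g"
      by (rule fourier_transform_inner[symmetric])
    also have "\<dots> = (LINT \<xi>|lebesgue. H \<xi> * cis (- (\<xi> * \<alpha>)))"
      unfolding l2_inner_def H_def by (simp add: mult_ac)
    finally show ?thesis unfolding fourier_integral_def by (simp flip: of_real_mult mult.assoc)
  qed
  have dyadic: "fourier_integral H (real_of_int m / 2 ^ n) = 0" for m :: int and n :: nat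
  proof -
    have "?e (- int j, 0) \<in> core_space \<psi>"
    proof -
      have "?e (- int j, 0) \<in> cfun.span (?e ` {(n, l). n < 0})"
        using \<open>j \<ge> 1\<close> by (intro cfun.span_base imageI) auto
      then show ?thesis
        unfolding core_space_eq l2_closed_span_def
        by (intro CollectI exI[of _ "\<lambda>_. ?e (- int j, 0)"]) (auto intro!: l2_tendsto_const waveletD(2)[OF \<psi>])
    qed
    \<comment> \<open>The shift \<open>m / 2^n\<close> needs membership at level \<open>n\<close>;
      density of the shifts requires every \<open>n\<close>.\<close>
    then have "translation (real_of_int m / 2 ^ n) (?e (- int j, 0)) \<in> core_space \<psi>"
      using L[of n] by (auto simp: wavelet_L_def translation_group_def)
    then have "l2_inner (translation (real_of_int m / 2 ^ n) (?e (- int j, 0))) (?e (0, 0)) = 0"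
      unfolding core_space_eq
      by (rule l2_closed_span_orthogonal[OF waveletD(2)[OF \<psi>] waveletD(2)[OF \<psi>], rotated])
         (auto simp: waveletD(3)[OF \<psi>])
    then show ?thesis unfolding corr by simp
  qed
  have "fourier_integral H \<alpha> = 0" for \<alpha>
    using fourier_integral_tendsto[OF H dyadic_approximation[of \<alpha>]]
    unfolding dyadic by (simp add: LIMSEQ_const_iff)
  then have "AE \<xi> in lebesgue. H \<xi> = 0" by (rule fourier_integral_inj[OF H])
  then show "AE \<xi> in lebesgue. g (2 ^ j * \<xi>) = 0 \<or> g \<xi> = 0"
    by eventually_elim (simp add: H_def affine_op_def)
qed

text \<open>The orthogonality exploited is that of the wavelet \<open>\<phi>\<close> attached to
  \<open>W\<close>, not that of \<open>\<psi>\<close>: its transform is nonnegative, so no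
  cancellation can hide an overlap. The conclusion concerns only the modulus of \<open>g\<close>,
  which is this transform almost everywhere.\<close>

lemma msf_wavelet_imp_dyadic_disjoint:
  assumes "msf_wavelet \<psi>"
  obtains g where "fourier_transform \<psi> g" "dyadic_disjoint g"
proof -
  obtain W g where W: "wavelet_set W" and g: "fourier_transform \<psi> g"
    and mod: "AE \<xi> in lebesgue. cmod (g \<xi>) = 1 / sqrt (2 * pi) * indicator W \<xi>"
    using assms by (auto simp: msf_wavelet_def)
  define k where "k \<xi> = 1 / sqrt (2 * pi) * indicator W \<xi>" for \<xi> :: real
  obtain \<phi> where \<phi>: "wavelet \<phi>" and FT: "fourier_transform \<phi> (\<lambda>\<xi>. complex_of_real (k \<xi>))"
    using W by (auto simp: wavelet_set_def k_def)
  have k0: "k \<xi> \<ge> 0" for \<xi> by (simp add: k_def)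
  have "dyadic_disjoint g"
  proof (rule dyadic_disjointI)
    fix j :: nat assume "j \<ge> 1"
    let ?k = "\<lambda>\<xi>. complex_of_real (k \<xi>)"
    define a :: real where "a = 2 powi (- int j)"
    have a: "a > 0" "1 / a = 2 ^ j" by (simp_all add: a_def power_int_minus divide_inverse)
    have "fourier_transform (wavelet_system \<phi> (- int j, 0)) (affine_op (2 ^ j) 0 ?k)"
      using fourier_transform_affine[OF FT a(1), of 0] a by (simp add: wavelet_system_eq flip: a_def)
    moreover have "fourier_transform (wavelet_system \<phi> (0, 0)) ?k"
      using FT by (simp add: wavelet_system_eq affine_op_def)
    ultimately have "l2_inner (affine_op (2 ^ j) 0 ?k) ?k = l2_inner (wavelet_system \<phi> (- int j, 0)) (wavelet_system \<phi> (0, 0))"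
      by (rule fourier_transform_inner)
    also have "\<dots> = 0" using \<open>j \<ge> 1\<close> by (simp add: waveletD(3)[OF \<phi>])
    finally have 0: "l2_inner (affine_op (2 ^ j) 0 ?k) ?k = 0" .
    have eq: "affine_op (2 ^ j) 0 ?k \<xi> * cnj (?k \<xi>) = complex_of_real (sqrt (2 ^ j) * (k (2 ^ j * \<xi>) * k \<xi>))" for \<xi>
      by (simp add: affine_op_def)
    have "integrable lebesgue (\<lambda>\<xi>. affine_op (2 ^ j) 0 ?k \<xi> * cnj (?k \<xi>))"
      by (intro L2_inner_integrable affine_L2 fourier_transformD(2)[OF FT]) simp
    then have int: "integrable lebesgue (\<lambda>\<xi>. sqrt (2 ^ j) * (k (2 ^ j * \<xi>) * k \<xi>))"
      unfolding eq by (rule complex_of_real_integrable_eq[THEN iffD1])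
    have "(LINT \<xi>|lebesgue. sqrt (2 ^ j) * (k (2 ^ j * \<xi>) * k \<xi>)) = 0"
      using 0 unfolding l2_inner_def eq by (simp only: integral_complex_of_real of_real_eq_0_iff)
    then have "AE \<xi> in lebesgue. sqrt (2 ^ j) * (k (2 ^ j * \<xi>) * k \<xi>) = 0"
      by (subst (asm) integral_nonneg_eq_0_iff_AE[OF int]) (auto simp: k0)
    moreover have "AE \<xi> in lebesgue. cmod (g (2 ^ j * \<xi>)) = k (2 ^ j * \<xi>)"
      using lebesgue_affine_AE[OF mod, of "2 ^ j" 0] by (simp add: k_def)
    moreover have "AE \<xi> in lebesgue. cmod (g \<xi>) = k \<xi>" using mod by (simp add: k_def)
    ultimately show "AE \<xi> in lebesgue. g (2 ^ j * \<xi>) = 0 \<or> g \<xi> = 0"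
      by eventually_elim (metis mult_eq_0_iff norm_eq_zero power_not_zero real_sqrt_eq_zero_cancel_iff zero_neq_numeral)
  qed
  with g show ?thesis by (rule that)
qed

subsection \<open>Minimally supported frequency\<close>

text \<open>The line is cut into unit intervals and the pieces are shifted onto
  \<open>[0, 1)\<close>, where they add up to the constant \<open>c\<close>.\<close>

lemma nn_integral_periodization:
  fixes k :: "real \<Rightarrow> real"
  assumes [measurable]: "k \<in> borel_measurable borel" and k0: "\<And>t. k t \<ge> 0" and c: "c \<ge> 0"
    and sums: "\<And>\<beta>. ((\<lambda>l::int. k (\<beta> - real_of_int l)) has_sum c) UNIV"
  shows "(\<integral>\<^sup>+t. ennreal (k t) \<partial>lborel) = ennreal c"
proof -
  \<comment> \<open>Enumerating the integers by naturals turns the unordered sum into a series that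
    can be exchanged with the integral.\<close>
  define d where "d i = real_of_int (int_decode i)" for i
  have sums': "(\<Sum>i. ennreal (k (\<beta> - d i))) = ennreal c" for \<beta>
  proof -
    have "((\<lambda>i. k (\<beta> - d i)) has_sum c) UNIV"
      unfolding d_def using sums[of \<beta>]
      by (subst has_sum_reindex_bij_betw[OF bij_int_decode, of "\<lambda>l. k (\<beta> - real_of_int l)"])
    then have "(\<lambda>i. k (\<beta> - d i)) sums c" by (rule has_sum_imp_sums)
    then show ?thesis using k0 by (simp add: suminf_ennreal2 sums_iff)
  qed
  \<comment> \<open>Exactly one integer shift brings \<open>t\<close> into the half-open interval,
    namely \<open>- \<lfloor>t\<rfloor>\<close>.\<close>
  have "(\<Sum>i. indicator {0..<1} (t + d i) :: ennreal) = 1" for t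
  proof -
    define i0 where "i0 = int_encode (- \<lfloor>t\<rfloor>)"
    have "indicator {0..<1} (t + d i) = (if i = i0 then 1 else 0 :: ennreal)" for i
    proof -
      have "t + d i \<in> {0..<1} \<longleftrightarrow> int_decode i = - \<lfloor>t\<rfloor>"
        unfolding d_def by (simp add: floor_eq_iff) linarith
      also have "\<dots> \<longleftrightarrow> i = i0" unfolding i0_def by (metis int_decode_inverse int_encode_inverse)
      finally show ?thesis by (simp add: indicator_def)
    qed
    then show ?thesis using sums_single[of i0 "\<lambda>_. 1 :: ennreal"] by (simp add: sums_iff)
  qed
  then have "(\<integral>\<^sup>+t. ennreal (k t) \<partial>lborel) = (\<integral>\<^sup>+t. (\<Sum>i. ennreal (k t) * indicator {0..<1} (t + d i)) \<partial>lborel)"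
    by simp
  also have "\<dots> = (\<Sum>i. \<integral>\<^sup>+t. ennreal (k t) * indicator {0..<1} (t + d i) \<partial>lborel)"
    by (rule nn_integral_suminf) simp
  also have "\<dots> = (\<Sum>i. \<integral>\<^sup>+\<beta>. ennreal (k (\<beta> - d i)) * indicator {0..<1} \<beta> \<partial>lborel)"
  proof (rule suminf_cong)
    fix i
    show "(\<integral>\<^sup>+t. ennreal (k t) * indicator {0..<1} (t + d i) \<partial>lborel) = (\<integral>\<^sup>+\<beta>. ennreal (k (\<beta> - d i)) * indicator {0..<1} \<beta> \<partial>lborel)"
      by (subst nn_integral_real_affine[of _ 1 "- d i"]) auto
  qed
  also have "\<dots> = (\<integral>\<^sup>+\<beta>. (\<Sum>i. ennreal (k (\<beta> - d i)) * indicator {0..<1} \<beta>) \<partial>lborel)"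
    by (rule nn_integral_suminf[symmetric]) simp
  also have "\<dots> = (\<integral>\<^sup>+\<beta>. ennreal c * indicator {0..<1} (\<beta>::real) \<partial>lborel)"
    by (simp add: sums')
  also have "\<dots> = ennreal c" by (simp add: nn_integral_cmult_indicator)
  finally show ?thesis .
qed

text \<open>Any translate of a function with transform \<open>\<chi>\<^sub>A\<close> is expanded by the \<open>T\<^sup>l\<psi>\<close> alone. Integrating
  Parseval's identity over the translations in \<open>[0, 1]\<close> gives an integral over the line, to which
  Plancherel applies.\<close>

lemma wavelet_modulus_integral:
  assumes \<psi>: "wavelet \<psi>" and g: "fourier_transform \<psi> g" "dyadic_disjoint g"
    and A: "A \<in> lmeasurable" "bounded A" "\<And>\<xi>. \<xi> \<in> A \<Longrightarrow> g \<xi> \<noteq> 0"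
  shows "2 * pi * (LINT \<xi>|lebesgue. indicator A \<xi> * (cmod (g \<xi>))\<^sup>2) = measure lebesgue A"
proof -
  let ?e = "wavelet_system \<psi>"
  let ?I = "indicator A :: real \<Rightarrow> complex"
  note gL = fourier_transformD(2)[OF g(1)]
  have IL: "?I \<in> L2" by (rule indicator_L2[OF A(1)])
  obtain f where f: "fourier_transform f ?I" using fourier_transform_surj[OF IL] .
  have fL: "f \<in> L2" by (rule fourier_transformD(1)[OF f])
  define H where "H \<xi> = ?I \<xi> * cnj (g \<xi>)" for \<xi>
  have H1: "integrable lebesgue H" unfolding H_def[abs_def] by (rule L2_inner_integrable[OF IL gL])
  have H2: "H \<in> L2" unfolding H_def[abs_def]
    by (rule L2_mult_bounded[where B = 1, OF L2_cnj[OF gL] L2_measurable[OF IL]]) (simp add: indicator_def)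
  define k where "k t = (cmod (complex_of_real (sqrt (2 * pi)) * fourier_integral H t))\<^sup>2" for t
  have FTf: "fourier_transform (translation \<beta> f) (\<lambda>\<xi>. cis (- (\<beta> * \<xi>)) * ?I \<xi>)" for \<beta>
    using fourier_transform_affine[OF f, of 1 \<beta>] by (simp add: translation_eq_affine) (simp add: affine_op_def)
  \<comment> \<open>At scale 0 the coefficient samples the Fourier integral of \<open>H\<close> at
    \<open>\<beta> - l\<close>. At every other scale the relevant dilate of \<open>g\<close>
    vanishes almost everywhere on \<open>A\<close>, because \<open>g\<close> itself is nonzero
    there.\<close>
  have inner: "l2_inner (translation \<beta> f) (?e (n, l)) = (if n = 0 then complex_of_real (sqrt (2 * pi)) * fourier_integral H (\<beta> - real_of_int l) else 0)" for \<beta> n l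
  proof -
    have eq: "l2_inner (translation \<beta> f) (?e (n, l)) = (LINT \<xi>|lebesgue. cis (- (\<beta> * \<xi>)) * ?I \<xi> *
        cnj (cis (- (real_of_int l / 2 powi n * \<xi>)) * affine_op (1 / 2 powi n) 0 g \<xi>))"
      unfolding wavelet_system_eq l2_inner_def[symmetric]
      by (rule fourier_transform_inner[OF FTf fourier_transform_affine[OF g(1) powi_pos], symmetric])
    show ?thesis
    proof (cases "n = 0")
      case True
      have "cis (- (\<beta> * \<xi>)) * ?I \<xi> * cnj (cis (- (real_of_int l * \<xi>)) * g \<xi>) = H \<xi> * cis (- (\<xi> * (\<beta> - real_of_int l)))" for \<xi>
      proof -
        have "cis (- (\<xi> * (\<beta> - real_of_int l))) = cis (- (\<beta> * \<xi>)) * cnj (cis (- (real_of_int l * \<xi>)))"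
          unfolding cis_cnj cis_mult by (simp add: algebra_simps)
        then show ?thesis unfolding H_def by (simp only: complex_cnj_mult mult_ac)
      qed
      then show ?thesis using True unfolding eq fourier_integral_def
        by (simp add: affine_op_def flip: of_real_mult mult.assoc)
    next
      case False
      have "AE \<xi> in lebesgue. g (2 powi 0 * \<xi>) = 0 \<or> g (2 powi (- n) * \<xi>) = 0"
        using False by (intro dyadic_disjoint_AE g) simp
      then have "AE \<xi> in lebesgue. cis (- (\<beta> * \<xi>)) * ?I \<xi> *
        cnj (cis (- (real_of_int l / 2 powi n * \<xi>)) * affine_op (1 / 2 powi n) 0 g \<xi>) = 0"
        by eventually_elim (use A(3) in \<open>auto simp: affine_op_def powi_inverse indicator_def\<close>)
      then show ?thesis using False unfolding eq by (simp add: integral_eq_zero_AE)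
    qed
  qed
  have sums: "((\<lambda>l::int. k (\<beta> - real_of_int l)) has_sum measure lebesgue A) UNIV" for \<beta>
  proof -
    let ?f = "translation \<beta> f"
    have "?f \<in> l2_closed_span (range ?e)" using translation_L2[OF fL] waveletD(4)[OF \<psi>] by simp
    then have "((\<lambda>p. (cmod (l2_inner ?f (?e p)))\<^sup>2) has_sum (l2_norm ?f)\<^sup>2) UNIV"
      by (rule l2_Parseval[OF waveletD(2,3)[OF \<psi>]])
    also have "(l2_norm ?f)\<^sup>2 = measure lebesgue A"
      using fourier_transform_norm[OF f] l2_norm_indicator[OF A(1)] by (simp add: l2_norm_translation)
    finally have "((\<lambda>p. (cmod (l2_inner ?f (?e p)))\<^sup>2) has_sum measure lebesgue A) UNIV" .
    moreover have "((\<lambda>p. (cmod (l2_inner ?f (?e p)))\<^sup>2) has_sum c) (range (\<lambda>l. (0, l)))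
        \<longleftrightarrow> ((\<lambda>p. (cmod (l2_inner ?f (?e p)))\<^sup>2) has_sum c) UNIV" for c
      by (rule has_sum_cong_neutral) (auto simp: inner)
    ultimately have "((\<lambda>p. (cmod (l2_inner ?f (?e p)))\<^sup>2) has_sum measure lebesgue A) (range (\<lambda>l. (0, l)))"
      by simp
    then show ?thesis
      by (subst (asm) has_sum_reindex) (auto simp: inj_on_def o_def inner k_def)
  qed
  have FH [measurable]: "fourier_integral H \<in> borel_measurable borel" by (rule borel_measurable_fourier_integral[OF H1])
  have [measurable]: "k \<in> borel_measurable borel" unfolding k_def[abs_def] by measurable
  have "(\<integral>\<^sup>+t. ennreal (k t) \<partial>lborel) = ennreal (measure lebesgue A)"
    by (intro nn_integral_periodization sums) (simp_all add: k_def)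
  then have "(LINT t|lborel. k t) = measure lebesgue A"
    by (subst integral_eq_nn_integral) (simp_all add: k_def)
  moreover have "(LINT t|lborel. k t) = 2 * pi * (l2_norm (fourier_integral H))\<^sup>2"
    unfolding l2_norm_sq k_def using FH by (subst integral_completion) (simp_all add: norm_mult power_mult_distrib)
  moreover have "l2_norm (fourier_integral H) = l2_norm H" by (rule Plancherel[OF H1 H2])
  moreover have "(l2_norm H)\<^sup>2 = (LINT \<xi>|lebesgue. indicator A \<xi> * (cmod (g \<xi>))\<^sup>2)"
    unfolding l2_norm_sq H_def
    by (intro Bochner_Integration.integral_cong refl) (simp add: norm_mult indicator_def)
  ultimately show ?thesis by simp
qed

text \<open>The integral identity is tested on the part of the support where \<open>u\<close> has a
  fixed sign. There a nonnegative integrand has integral 0, so both sign sets are null and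
  \<open>u\<close> vanishes almost everywhere on the support.\<close>

lemma wavelet_modulus:
  assumes \<psi>: "wavelet \<psi>" and g: "fourier_transform \<psi> g" "dyadic_disjoint g"
    and meas: "g \<in> borel_measurable borel"
  shows "AE \<xi> in lebesgue. cmod (g \<xi>) = 1 / sqrt (2 * pi) * indicator {\<xi>. g \<xi> \<noteq> 0} \<xi>"
proof -
  have [measurable]: "g \<in> borel_measurable lebesgue" using meas by (rule lebesgue_measurable_borel)
  define u where "u \<xi> = 2 * pi * (cmod (g \<xi>))\<^sup>2 - 1" for \<xi>
  have [measurable]: "u \<in> borel_measurable lebesgue" unfolding u_def[abs_def] by measurable
  \<comment> \<open>\<open>s\<close> is the sign under test, taken as 1 and as -1; the cutoff by
    \<open>R\<close> makes the measure finite, and countably many \<open>R\<close> exhaust the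
    line.\<close>
  have null: "AE \<xi> in lebesgue. \<not> (g \<xi> \<noteq> 0 \<and> s * u \<xi> > 0 \<and> \<xi> \<in> {- real R..real R})" for s :: real and R :: nat
  proof -
    define A where "A = {\<xi>. g \<xi> \<noteq> 0 \<and> s * u \<xi> > 0 \<and> \<xi> \<in> {- real R..real R}}"
    have Am: "A \<in> sets lebesgue"
    proof -
      have "{\<xi> \<in> space lebesgue. g \<xi> \<noteq> 0 \<and> s * u \<xi> > 0} \<in> sets lebesgue" by measurable
      moreover have "{- real R..real R} \<in> sets lebesgue" by simp
      moreover have "A = {\<xi> \<in> space lebesgue. g \<xi> \<noteq> 0 \<and> s * u \<xi> > 0} \<inter> {- real R..real R}" by (auto simp: A_def)
      ultimately show ?thesis by (simp only: sets.Int)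
    qed
    have bA: "bounded A" by (rule bounded_subset[of "{- real R..real R}"]) (auto simp: A_def)
    have Al: "A \<in> lmeasurable" by (rule bounded_set_imp_lmeasurable[OF bA Am])
    have gi: "integrable lebesgue (\<lambda>\<xi>. indicator A \<xi> * (cmod (g \<xi>))\<^sup>2)"
      using integrable_mult_indicator[OF Am L2_integrable[OF fourier_transformD(2)[OF g(1)]]] by simp
    have ii: "integrable lebesgue (indicator A :: real \<Rightarrow> real)" using Al by (simp add: lmeasurable_iff_integrable)
    have eq: "indicator A \<xi> * (s * u \<xi>) = s * (2 * pi * (indicator A \<xi> * (cmod (g \<xi>))\<^sup>2) - indicator A \<xi>)" for \<xi>
      by (simp add: u_def algebra_simps)
    have int: "integrable lebesgue (\<lambda>\<xi>. indicator A \<xi> * (s * u \<xi>))"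
      unfolding eq using gi ii by simp
    have "(LINT \<xi>|lebesgue. indicator A \<xi> * (s * u \<xi>)) = s * (2 * pi * (LINT \<xi>|lebesgue. indicator A \<xi> * (cmod (g \<xi>))\<^sup>2) - measure lebesgue A)"
      unfolding eq using gi ii Am by simp
    also have "\<dots> = 0" by (subst wavelet_modulus_integral[OF \<psi> g Al bA]) (simp_all add: A_def)
    finally have "AE \<xi> in lebesgue. indicator A \<xi> * (s * u \<xi>) = 0"
      by (subst (asm) integral_nonneg_eq_0_iff_AE[OF int]) (auto simp: A_def indicator_def)
    then show ?thesis by eventually_elim (auto simp: A_def indicator_def split: if_splits)
  qed
  have "AE \<xi> in lebesgue. \<forall>R. \<not> (g \<xi> \<noteq> 0 \<and> 1 * u \<xi> > 0 \<and> \<xi> \<in> {- real R..real R})"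
    using null[of 1] by (simp only: AE_all_countable simp_thms)
  moreover have "AE \<xi> in lebesgue. \<forall>R. \<not> (g \<xi> \<noteq> 0 \<and> (- 1) * u \<xi> > 0 \<and> \<xi> \<in> {- real R..real R})"
    using null[of "- 1"] by (simp only: AE_all_countable simp_thms)
  ultimately show ?thesis
  proof eventually_elim
    case (elim \<xi>)
    obtain R :: nat where "\<bar>\<xi>\<bar> \<le> real R" using real_arch_simple by blast
    then have R: "\<xi> \<in> {- real R..real R}" by auto
    show ?case
    proof (cases "g \<xi> = 0")
      case False
      then have "u \<xi> = 0" using elim R by (metis linorder_neqE_linordered_idom mult_1 mult_minus_left neg_0_less_iff_less)
      then have "(cmod (g \<xi>))\<^sup>2 = (1 / sqrt (2 * pi))\<^sup>2" by (simp add: u_def field_simps power_divide)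
      then have "cmod (g \<xi>) = 1 / sqrt (2 * pi)" by (simp add: power2_eq_iff_nonneg)
      then show ?thesis using False by simp
    qed simp
  qed
qed

section \<open>Unimodular multipliers and removal of the phase\<close>

text \<open>Multiplication by \<open>\<Theta>\<close> is unitary and carries \<open>e\<close> to
  \<open>e'\<close> on the Fourier side. Totality is pulled back: the \<open>f'\<close> whose
  transform is \<open>cnj \<Theta>\<close> times that of \<open>f\<close> has the same norm as
  \<open>f\<close>, and the same coefficients against \<open>e\<close> as \<open>f\<close> against
  \<open>e'\<close>. Membership in the closed span depends on nothing else.\<close>

lemma orthonormal_basis_multiplier:
  assumes e: "orthonormal_basis e" and h: "\<And>i. fourier_transform (e i) (h i)"
    and e': "\<And>i. fourier_transform (e' i) (\<lambda>\<xi>. \<Theta> \<xi> * h i \<xi>)"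
    and \<Theta>: "\<Theta> \<in> borel_measurable lebesgue" "\<And>\<xi>. cmod (\<Theta> \<xi>) = 1"
  shows "orthonormal_basis e'"
proof -
  have eL: "\<And>i. e i \<in> L2" and on: "\<And>i j. l2_inner (e i) (e j) = (if i = j then 1 else 0)"
    and span: "l2_closed_span (range e) = L2"
    using e unfolding orthonormal_basis_def by blast+
  have unit: "\<Theta> \<xi> * cnj (\<Theta> \<xi>) = 1" for \<xi>
    using complex_norm_square[of "\<Theta> \<xi>"] \<Theta>(2)[of \<xi>] by simp
  have e'L: "e' i \<in> L2" for i by (rule fourier_transformD(1)[OF e'])
  have on': "l2_inner (e' i) (e' j) = (if i = j then 1 else 0)" for i j
  proof -
    have "l2_inner (e' i) (e' j) = l2_inner (\<lambda>\<xi>. \<Theta> \<xi> * h i \<xi>) (\<lambda>\<xi>. \<Theta> \<xi> * h j \<xi>)"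
      by (rule fourier_transform_inner[OF e' e', symmetric])
    also have "\<dots> = l2_inner (h i) (h j)"
      unfolding l2_inner_def
    proof (intro Bochner_Integration.integral_cong refl)
      fix \<xi>
      have "\<Theta> \<xi> * h i \<xi> * cnj (\<Theta> \<xi> * h j \<xi>) = (\<Theta> \<xi> * cnj (\<Theta> \<xi>)) * (h i \<xi> * cnj (h j \<xi>))"
        by (simp only: complex_cnj_mult mult_ac)
      then show "\<Theta> \<xi> * h i \<xi> * cnj (\<Theta> \<xi> * h j \<xi>) = h i \<xi> * cnj (h j \<xi>)" by (simp add: unit)
    qed
    also have "\<dots> = l2_inner (e i) (e j)" by (rule fourier_transform_inner[OF h h])
    finally show ?thesis by (simp add: on)
  qed
  have "f \<in> l2_closed_span (range e')" if f: "f \<in> L2" for f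
  proof -
    obtain q where q: "fourier_transform f q" using fourier_transform_exists[OF f] by blast
    define q' where "q' \<xi> = cnj (\<Theta> \<xi>) * q \<xi>" for \<xi>
    have [measurable]: "\<Theta> \<in> borel_measurable lebesgue" by (rule \<Theta>(1))
    have "q' \<in> L2" unfolding q'_def[abs_def]
      by (rule L2_mult_bounded[OF fourier_transformD(2)[OF q], where B = 1]) (simp_all add: \<Theta>(2))
    then obtain f' where f': "fourier_transform f' q'" using fourier_transform_surj by blast
    have "l2_norm q' = l2_norm q" by (rule l2_norm_cong) (simp add: q'_def norm_mult \<Theta>(2))
    then have norm: "l2_norm f' = l2_norm f"
      using fourier_transform_norm[OF f'] fourier_transform_norm[OF q] by simp
    have inner: "l2_inner f (e' i) = l2_inner f' (e i)" for i
      unfolding fourier_transform_inner[OF q e', symmetric] fourier_transform_inner[OF f' h, symmetric]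
      by (simp add: l2_inner_def q'_def mult_ac)
    note f'L = fourier_transformD(1)[OF f']
    have "f' \<in> l2_closed_span (range e)" using f'L span by simp
    then show ?thesis
      unfolding l2_closed_span_iff[OF e'L on' f] l2_closed_span_iff[OF eL on f'L] by (simp add: norm inner)
  qed
  then have "l2_closed_span (range e') = L2" by (auto simp: l2_closed_span_def l2_tendsto_def)
  then show ?thesis unfolding orthonormal_basis_def using e'L on' by blast
qed

text \<open>By disjointness one unimodular function \<open>\<Theta>\<close> can make all dilates of \<open>g\<close> nonnegative at once; at
  most one term of the series defining it is nonzero.\<close>

lemma dyadic_disjoint_phase:
  assumes g: "dyadic_disjoint g" and [measurable]: "g \<in> borel_measurable borel"
  obtains \<Theta> where "\<Theta> \<in> borel_measurable lebesgue" "\<And>\<xi>. cmod (\<Theta> \<xi>) = 1"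
    "\<And>n::int. AE \<xi> in lebesgue. \<Theta> \<xi> * g (2 powi n * \<xi>) = complex_of_real (cmod (g (2 powi n * \<xi>)))"
proof -
  \<comment> \<open>Through \<open>int_decode\<close> the series runs over all dilates. Points where
    two terms are nonzero form a null set by disjointness, so the value there does not
    matter.\<close>
  define s where "s \<xi> = (\<Sum>i. sgn (g (2 powi int_decode i * \<xi>)))" for \<xi>
  \<comment> \<open>The value 1 at zeros of \<open>s\<close>, as on orbits that miss the support,
    keeps the modulus 1 everywhere.\<close>
  define \<Theta> where "\<Theta> \<xi> = (if s \<xi> = 0 then 1 else cnj (sgn (s \<xi>)))" for \<xi>
  have sgn_meas: "(sgn :: complex \<Rightarrow> complex) \<in> borel_measurable borel"
    unfolding sgn_div_norm[abs_def] by measurable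
  have [measurable]: "(\<lambda>\<xi>. sgn (g (c * \<xi>))) \<in> borel_measurable borel" for c
    by (rule measurable_compose[OF _ sgn_meas]) measurable
  have [measurable]: "s \<in> borel_measurable borel" unfolding s_def[abs_def] by measurable
  have [measurable]: "(\<lambda>\<xi>. sgn (s \<xi>)) \<in> borel_measurable borel"
    by (rule measurable_compose[OF _ sgn_meas]) measurable
  have "\<Theta> \<in> borel_measurable borel" unfolding \<Theta>_def[abs_def] by measurable
  then have m: "\<Theta> \<in> borel_measurable lebesgue" by (rule lebesgue_measurable_borel)
  have u: "cmod (\<Theta> \<xi>) = 1" for \<xi> by (simp add: \<Theta>_def norm_sgn)
  have ae: "AE \<xi> in lebesgue. \<Theta> \<xi> * g (2 powi n * \<xi>) = complex_of_real (cmod (g (2 powi n * \<xi>)))" for n :: int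
  proof -
    have "AE \<xi> in lebesgue. \<forall>m. m \<noteq> n \<longrightarrow> g (2 powi n * \<xi>) = 0 \<or> g (2 powi m * \<xi>) = 0"
      unfolding AE_all_countable
    proof
      fix m
      show "AE \<xi> in lebesgue. m \<noteq> n \<longrightarrow> g (2 powi n * \<xi>) = 0 \<or> g (2 powi m * \<xi>) = 0"
        using dyadic_disjoint_AE[OF g, of n m] by (cases "m = n") auto
    qed
    then show ?thesis
    proof eventually_elim
      case (elim \<xi>)
      show ?case
      proof (cases "g (2 powi n * \<xi>) = 0")
        case False
        define z where "z = g (2 powi n * \<xi>)"
        have z: "z \<noteq> 0" using False by (simp add: z_def)
        have "sgn (g (2 powi int_decode i * \<xi>)) = (if i = int_encode n then sgn z else 0)" for i
        proof (cases "int_decode i = n")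
          case True
          then show ?thesis by (auto simp: z_def)
        next
          case ne: False
          then have "i \<noteq> int_encode n" by auto
          moreover have "g (2 powi int_decode i * \<xi>) = 0" using elim ne False by blast
          ultimately show ?thesis by simp
        qed
        then have "s \<xi> = sgn z"
          unfolding s_def using sums_single[of "int_encode n" "\<lambda>_. sgn z"] by (simp add: sums_iff)
        then have "\<Theta> \<xi> = cnj (sgn z)" using z by (simp add: \<Theta>_def sgn_zero_iff)
        then have "\<Theta> \<xi> * z = cnj z * z / cmod z" by (simp add: sgn_eq)
        also have "\<dots> = cmod z"
          using z complex_norm_square[of z] by (simp add: power2_eq_square field_simps)
        finally show ?thesis by (simp add: z_def)
      qed simp
    qed
  qed
  show ?thesis by (rule that[OF m u ae])
qed

text \<open>Knowing the modulus of \<open>g\<close>, it remains to exhibit a wavelet with transform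
  \<open>k\<close>. The candidate \<open>\<phi>\<close> generates a system that differs from that of
  \<open>\<psi>\<close> by the same multiplier \<open>\<Theta>\<close> at every scale, so it is
  again an orthonormal basis.\<close>

lemma dyadic_disjoint_imp_msf_wavelet:
  assumes \<psi>: "wavelet \<psi>" and g: "fourier_transform \<psi> g" "dyadic_disjoint g"
    and meas: "g \<in> borel_measurable borel"
  shows "msf_wavelet \<psi>"
proof -
  define W where "W = {\<xi>. g \<xi> \<noteq> 0}"
  define k where "k \<xi> = complex_of_real (1 / sqrt (2 * pi) * indicator W \<xi>)" for \<xi>
  have mod: "AE \<xi> in lebesgue. cmod (g \<xi>) = 1 / sqrt (2 * pi) * indicator W \<xi>"
    unfolding W_def by (rule wavelet_modulus[OF \<psi> g meas])
  have gk: "AE \<xi> in lebesgue. complex_of_real (cmod (g \<xi>)) = k \<xi>"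
    using mod by eventually_elim (simp add: k_def)
  obtain \<Theta> where \<Theta>: "\<Theta> \<in> borel_measurable lebesgue" "\<And>\<xi>. cmod (\<Theta> \<xi>) = 1"
    and phase: "\<And>n::int. AE \<xi> in lebesgue. \<Theta> \<xi> * g (2 powi n * \<xi>) = complex_of_real (cmod (g (2 powi n * \<xi>)))"
    using dyadic_disjoint_phase[OF g(2) meas] by blast
  have "(\<lambda>\<xi>. complex_of_real (cmod (g \<xi>))) \<in> L2"
    using L2_integrable[OF fourier_transformD(2)[OF g(1)]] L2_measurable[OF fourier_transformD(2)[OF g(1)]]
    by (simp add: L2_def)
  then have kL: "k \<in> L2" by (rule L2_cong_AE[OF _ gk])
  obtain \<phi> where \<phi>: "fourier_transform \<phi> k" using fourier_transform_surj[OF kL] .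
  define h where "h p = (\<lambda>\<xi>. cis (- (real_of_int (snd p) / 2 powi (fst p) * \<xi>)) * affine_op (1 / 2 powi (fst p)) 0 g \<xi>)"
    for p :: "int \<times> int"
  have "orthonormal_basis (wavelet_system \<phi>)"
  proof (rule orthonormal_basis_multiplier[OF _ _ _ \<Theta>])
    show "orthonormal_basis (wavelet_system \<psi>)" using \<psi> by (simp add: wavelet_def)
    show "fourier_transform (wavelet_system \<psi> p) (h p)" for p
      unfolding h_def using fourier_transform_affine[OF g(1) powi_pos] by (cases p) (simp add: wavelet_system_eq)
    show "fourier_transform (wavelet_system \<phi> p) (\<lambda>\<xi>. \<Theta> \<xi> * h p \<xi>)" for p
    proof -
      obtain n l where p: "p = (n, l)" by (cases p)
      have "fourier_transform (wavelet_system \<phi> p) (\<lambda>\<xi>. cis (- (real_of_int l / 2 powi n * \<xi>)) * affine_op (1 / 2 powi n) 0 k \<xi>)"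
        unfolding p wavelet_system_eq by (rule fourier_transform_affine[OF \<phi> powi_pos])
      moreover have "AE \<xi> in lebesgue. complex_of_real (cmod (g (2 powi (- n) * \<xi>))) = k (2 powi (- n) * \<xi>)"
        using lebesgue_affine_AE[OF gk, of "2 powi (- n)" 0] powi_pos[of "- n"] by simp
      then have "AE \<xi> in lebesgue. cis (- (real_of_int l / 2 powi n * \<xi>)) * affine_op (1 / 2 powi n) 0 k \<xi> = \<Theta> \<xi> * h p \<xi>"
        using phase[of "- n"]
      proof eventually_elim
        case (elim \<xi>)
        have "\<Theta> \<xi> * h p \<xi> = cis (- (real_of_int l / 2 powi n * \<xi>)) * (complex_of_real (sqrt (2 powi (- n))) * (\<Theta> \<xi> * g (2 powi (- n) * \<xi>)))"
          by (simp add: h_def p affine_op_def powi_inverse mult_ac)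
        also have "\<Theta> \<xi> * g (2 powi (- n) * \<xi>) = k (2 powi (- n) * \<xi>)" using elim by simp
        finally show ?case by (simp add: affine_op_def powi_inverse)
      qed
      ultimately show ?thesis by (rule fourier_transform_cong_AE)
    qed
  qed
  then have "wavelet \<phi>" using fourier_transformD(1)[OF \<phi>] by (simp add: wavelet_def)
  then have "wavelet_set W" using \<phi> unfolding wavelet_set_def k_def[abs_def] by blast
  then show ?thesis using \<psi> g(1) mod unfolding msf_wavelet_def by blast
qed

theorem corollary6:
  "wavelet_M \<infinity> = (\<Inter>n::nat. wavelet_L (enat n)) \<and>
   wavelet_M \<infinity> = {\<psi>. msf_wavelet \<psi>}"
proof -
  have M: "wavelet_M \<infinity> = wavelet_L \<infinity>" by (simp add: wavelet_M_def)
  \<comment> \<open>The three inclusions close up into a cycle; this one holds because dyadic shifts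
    are among the real shifts.\<close>
  have 1: "wavelet_L \<infinity> \<subseteq> (\<Inter>n::nat. wavelet_L (enat n))"
    by (fastforce simp: wavelet_L_def translation_group_def)
  have 2: "msf_wavelet \<psi>" if L: "\<psi> \<in> (\<Inter>n::nat. wavelet_L (enat n))" for \<psi>
  proof -
    have \<psi>: "wavelet \<psi>" using L by (simp add: wavelet_L_def)
    obtain g where g: "g \<in> borel_measurable borel" "fourier_transform \<psi> g"
      using fourier_transform_exists[OF waveletD(1)[OF \<psi>]] .
    have "dyadic_disjoint g" using L by (intro wavelet_L_imp_dyadic_disjoint[OF _ g(2)]) blast
    then show ?thesis by (rule dyadic_disjoint_imp_msf_wavelet[OF \<psi> g(2) _ g(1)])
  qed
  have 3: "\<psi> \<in> wavelet_L \<infinity>" if msf: "msf_wavelet \<psi>" for \<psi>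
  proof -
    have "wavelet \<psi>" using msf by (simp add: msf_wavelet_def)
    then show ?thesis
      using msf_wavelet_imp_dyadic_disjoint[OF msf] dyadic_disjoint_imp_wavelet_L by blast
  qed
  show ?thesis unfolding M using 1 2 3 by blast
qed

end
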